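(* Let $d\in\mathbb{N}$, let $\Omega\subset\mathbb{R}^d$ be a bounded open domain with $\mathcal{C}^1$ boundary and outer unit normal $\nu$, and let $f\in\mathcal{C}^1(\mathbb{R}^d;\mathbb{R}^d)$ satisfy $\nu(x)^\top f(x)\le 0$ for all $x\in\partial\Omega$. Let $w:\Omega\to\mathbb{R}_+$ be a measurable weight with $w^{-1}\in W^{1,\infty}(\Omega)$, and assume $f_i\in \mathrm{L}^\infty_w(\Omega)\cap\mathcal{C}^1(\bar\Omega)$ for $i=1,\dots,d$ and $\operatorname{ess\,sup}_{x\in\Omega}-\frac{f(x)^\top\nabla w(x)}{w(x)}<\infty$. Let $X=\mathrm{L}^1_w(\Omega)$, $X^*=\mathrm{L}^\infty_w(\Omega)$, $H=\mathrm{L}^2_{w^2}(\Omega)$, let $S^*(t)\varphi=\varphi\circ\Phi^t$ be the composition semigroup on $X^*$ with generator $A^*$, and let $S(t)$ be its preadjoint on $X$. Let $C:X\to\mathbb{R}^r$, $C\phi=(\langle\phi,c_i\rangle_{X,X^*})_{i=1}^r$ with $c_1,\dots,c_r\in X^*$, be of finite rank $r\in\mathbb{N}$, and let $S(t)$ be exponentially stable over $X$ with decay rate $\omega_0<0$. Let $m$ be an even natural number. If $$\operatorname{range}(C^* )\subseteq\mathcal{D}((A^* )^m)\subseteq X^*,$$ then there exist $p_n\in X^*$, $n\in\mathbb{N}_0$, such that for all $\phi,\psi\in X$ $$\int_0^\infty\langle CS(t)\phi,CS(t)\psi\rangle_{\mathbb{R}^r}\,dt=\sum_{n=0}^\inf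ty\langle\phi,p_n\rangle_{X,X^*}\langle\psi,p_n\rangle_{X,X^*}\quad\text{with}\quad\sum_{n=N}^\infty\|p_n\|_H^2\in\mathcal{O}(N^{-m}).$$
   Context: For $z\in\bar\Omega$, $\Phi^t(z)$ denotes the value at time $t\ge 0$ of the solution of $\dot x=f(x)$, $x(0)=z$; the condition $\nu^\top f\le 0$ on $\partial\Omega$ guarantees that $\Phi^t(z)$ exists and stays in $\bar\Omega$ for all $t\ge0$. The weight $w$ is positive and finite almost everywhere; $\nabla w$ is understood almost everywhere, $\nabla w=-w^2\nabla(w^{-1})$. The weighted spaces are defined by the norms $\|\phi\|_{\mathrm{L}^p_w(\Omega)}=\big(\int_\Omega|\phi|^p w\,dx\big)^{1/p}$ for $1\le p<\infty$ and $\|\phi\|_{\mathrm{L}^\infty_w(\Omega)}=\operatorname{ess\,sup}_{x\in\Omega}|\phi(x)w(x)|$. The dual of $X=\mathrm{L}^1_w(\Omega)$ is identified with $X^*=\mathrm{L}^\infty_w(\Omega)$ through $\langle\phi,\varphi\rangle_{X,X^*}=\int_\Omega\phi\varphi w^2\,dx$; the inner product of $H=\mathrm{L}^2_{w^2}(\Omega)$ is $\int_\Omega\phi\varphi w^2\,dx$, and $X^*\subset H\subset X$. The preadjoint $S(t)\in\mathcal{L}(X)$ satisfies $\langle S(t)\rho,\varphi\rangle_{X,X^*}=\langle\rho,S^*(t)\varphi\rangle_{X,X^*}$. $A^*:\mathcal{D}(A^* )\subseteq X^*\to X^*$ is the infinitesimal generator of the weak-* continuous semigroup $S^*(t)$ (weak-*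 limit of $(S^*(t)\varphi-\varphi)/t$ as $t\to0^+$), given by $A^*\varphi=f^\top\nabla\varphi$. "Exponentially stable over $X$ with decay rate $\omega_0$" means that there is $M\ge1$ with $\|S(t)\|_{\mathcal{L}(X)}\le Me^{\omega_0t}$ for all $t\ge0$, where $\omega_0<0$. The adjoint of $C$ is $C^*:\mathbb{R}^r\to X^*$, $C^*a=\sum_{i=1}^ra_ic_i$. The left-hand side of the displayed formula is the paper's value bilinear form $\langle\phi,\psi\rangle_P$. *)

theory Defs
  imports "HOL-Probability.Essential_Supremum" "HOL-Library.Landau_Symbols"
begin

section \<open>The domain and the vector field\<close>

definition local_defining_function ::
    "'a::euclidean_space set \<Rightarrow> 'a set \<Rightarrow> ('a \<Rightarrow> real) \<Rightarrow> ('a \<Rightarrow> 'a) \<Rightarrow> bool" where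
  "local_defining_function \<Omega> U g dg \<longleftrightarrow>
     open U \<and> (\<forall>y\<in>U. GDERIV g y :> dg y) \<and> continuous_on U dg \<and> (\<forall>y\<in>U. dg y \<noteq> 0) \<and>
     \<Omega> \<inter> U = {y\<in>U. g y < 0} \<and> frontier \<Omega> \<inter> U = {y\<in>U. g y = 0}"

definition C1_boundary :: "'a::euclidean_space set \<Rightarrow> bool" where
  "C1_boundary \<Omega> \<longleftrightarrow> (\<forall>x\<in>frontier \<Omega>. \<exists>U g dg. x \<in> U \<and> local_defining_function \<Omega> U g dg)"

definition outer_unit_normal :: "'a::euclidean_space set \<Rightarrow> 'a \<Rightarrow> 'a \<Rightarrow> bool" where
  "outer_unit_normal \<Omega> x n \<longleftrightarrow>
     (\<exists>U g dg. x \<in> U \<and> local_defining_function \<Omega> U g dg \<and> n = dg x /\<^sub>R norm (dg x))"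

definition C1_on :: "'a::real_normed_vector set \<Rightarrow> ('a \<Rightarrow> 'b::real_normed_vector) \<Rightarrow> bool" where
  "C1_on S g \<longleftrightarrow> (\<exists>g' :: 'a \<Rightarrow> 'a \<Rightarrow>\<^sub>L 'b.
     (\<forall>x\<in>S. (g has_derivative blinfun_apply (g' x)) (at x within S)) \<and> continuous_on S g')"

text \<open>\<open>\<Phi> t z\<close> is the value at time \<open>t\<close> of the solution of \<open>x' = f(x)\<close>, \<open>x(0) = z\<close>. Invariance of the
  closure of \<open>\<Omega>\<close> is not part of the definition; it follows from the sign of \<open>f\<close> along the normal.\<close>

definition flow_on :: "('a::euclidean_space \<Rightarrow> 'a) \<Rightarrow> 'a set \<Rightarrow> (real \<Rightarrow> 'a \<Rightarrow> 'a) \<Rightarrow> bool" where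
  "flow_on f K \<Phi> \<longleftrightarrow> (\<forall>z\<in>K. \<Phi> 0 z = z \<and>
     (\<forall>t\<ge>0. ((\<lambda>s. \<Phi> s z) has_vector_derivative f (\<Phi> t z)) (at t within {0..})))"

section \<open>Weighted Lebesgue spaces\<close>

text \<open>Elements of the spaces are represented by functions on the whole space of which only the
  values on \<open>\<Omega>\<close>, up to null sets, matter.\<close>

definition Lp :: "real \<Rightarrow> 'a::euclidean_space set \<Rightarrow> ('a \<Rightarrow> real) \<Rightarrow> ('a \<Rightarrow> real) set" where
  "Lp p \<Omega> v = {\<phi> \<in> borel_measurable (lebesgue_on \<Omega>).
     integrable (lebesgue_on \<Omega>) (\<lambda>x. \<bar>\<phi> x\<bar> powr p * v x)}"

definition Lp_norm :: "real \<Rightarrow> 'a::euclidean_space set \<Rightarrow> ('a \<Rightarrow> real) \<Rightarrow> ('a \<Rightarrow> real) \<Rightarrow> real" where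
  "Lp_norm p \<Omega> v \<phi> = (LINT x|lebesgue_on \<Omega>. \<bar>\<phi> x\<bar> powr p * v x) powr (1 / p)"

definition Linf :: "'a::euclidean_space set \<Rightarrow> ('a \<Rightarrow> real) \<Rightarrow> ('a \<Rightarrow> real) set" where
  "Linf \<Omega> v = {\<phi> \<in> borel_measurable (lebesgue_on \<Omega>).
     esssup (lebesgue_on \<Omega>) (\<lambda>x. ereal \<bar>\<phi> x * v x\<bar>) < \<infinity>}"

text \<open>The duality pairing of \<open>L\<^sup>1\<close> with weight \<open>w\<close> and \<open>L\<^sup>\<infinity>\<close> with weight \<open>w\<close>; its density is the
  \<^emph>\<open>square\<close> of the weight.\<close>

definition pairing ::
    "'a::euclidean_space set \<Rightarrow> ('a \<Rightarrow> real) \<Rightarrow> ('a \<Rightarrow> real) \<Rightarrow> ('a \<Rightarrow> real) \<Rightarrow> real" where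
  "pairing \<Omega> w \<phi> \<psi> = (LINT x|lebesgue_on \<Omega>. \<phi> x * \<psi> x * (w x)\<^sup>2)"

section \<open>The Sobolev space of order one with bounded weak derivatives\<close>

fun Ck :: "nat \<Rightarrow> (real ^ 'd \<Rightarrow> real) \<Rightarrow> bool" where
  "Ck 0 \<eta> = continuous_on UNIV \<eta>"
| "Ck (Suc k) \<eta> = ((\<forall>x. \<eta> differentiable at x) \<and>
     (\<forall>i. Ck k (\<lambda>x. frechet_derivative \<eta> (at x) (axis i 1))))"

definition test_function :: "(real ^ 'd) set \<Rightarrow> (real ^ 'd \<Rightarrow> real) \<Rightarrow> bool" where
  "test_function \<Omega> \<eta> \<longleftrightarrow> (\<forall>k. Ck k \<eta>) \<and>
     compact (closure {x. \<eta> x \<noteq> 0}) \<and> closure {x. \<eta> x \<noteq> 0} \<subseteq> \<Omega>"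

definition bounded_weak_gradient ::
    "(real ^ 'd) set \<Rightarrow> (real ^ 'd \<Rightarrow> real) \<Rightarrow> (real ^ 'd \<Rightarrow> real ^ 'd) \<Rightarrow> bool" where
  "bounded_weak_gradient \<Omega> u G \<longleftrightarrow>
     (\<forall>i. (\<lambda>x. G x $ i) \<in> Linf \<Omega> (\<lambda>_. 1)) \<and>
     (\<forall>\<eta> i. test_function \<Omega> \<eta> \<longrightarrow>
        (LINT x|lebesgue_on \<Omega>. u x * frechet_derivative \<eta> (at x) (axis i 1)) =
        - (LINT x|lebesgue_on \<Omega>. G x $ i * \<eta> x))"

definition W1inf :: "(real ^ 'd) set \<Rightarrow> (real ^ 'd \<Rightarrow> real) set" where
  "W1inf \<Omega> = {u \<in> Linf \<Omega> (\<lambda>_. 1). \<exists>G. bounded_weak_gradient \<Omega> u G}"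

text \<open>The weak gradient is unique almost everywhere, so the choice of representative is immaterial.\<close>

definition weak_gradient ::
    "(real ^ 'd) set \<Rightarrow> (real ^ 'd \<Rightarrow> real) \<Rightarrow> real ^ 'd \<Rightarrow> real ^ 'd" where
  "weak_gradient \<Omega> u = (SOME G. bounded_weak_gradient \<Omega> u G)"

definition weight_gradient ::
    "(real ^ 'd) set \<Rightarrow> (real ^ 'd \<Rightarrow> real) \<Rightarrow> real ^ 'd \<Rightarrow> real ^ 'd" where
  "weight_gradient \<Omega> w x = - ((w x)\<^sup>2 *\<^sub>R weak_gradient \<Omega> (\<lambda>y. inverse (w y)) x)"

section \<open>The composition semigroup, its generator and its preadjoint\<close>

definition comp_semigroup ::
    "(real \<Rightarrow> 'a \<Rightarrow> 'a) \<Rightarrow> real \<Rightarrow> ('a \<Rightarrow> real) \<Rightarrow> 'a \<Rightarrow> real" where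
  "comp_semigroup \<Phi> t \<phi> = \<phi> \<circ> \<Phi> t"

text \<open>The graph of the weak-* generator; the value is determined up to null sets only, which is why
  it is a relation.\<close>

definition weak_star_generator ::
    "'a::euclidean_space set \<Rightarrow> ('a \<Rightarrow> real) \<Rightarrow> (real \<Rightarrow> 'a \<Rightarrow> 'a) \<Rightarrow>
     ('a \<Rightarrow> real) \<Rightarrow> ('a \<Rightarrow> real) \<Rightarrow> bool" where
  "weak_star_generator \<Omega> w \<Phi> \<phi> \<psi> \<longleftrightarrow> \<phi> \<in> Linf \<Omega> w \<and> \<psi> \<in> Linf \<Omega> w \<and>
     (\<forall>\<rho>\<in>Lp 1 \<Omega> w.
        ((\<lambda>t. pairing \<Omega> w \<rho> (\<lambda>x. (comp_semigroup \<Phi> t \<phi> x - \<phi> x) / t))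
           \<longlongrightarrow> pairing \<Omega> w \<rho> \<psi>) (at_right 0))"

definition generator_power_domain ::
    "'a::euclidean_space set \<Rightarrow> ('a \<Rightarrow> real) \<Rightarrow> (real \<Rightarrow> 'a \<Rightarrow> 'a) \<Rightarrow> nat \<Rightarrow> ('a \<Rightarrow> real) set" where
  "generator_power_domain \<Omega> w \<Phi> m =
     {\<phi> \<in> Linf \<Omega> w. \<exists>\<psi>. (weak_star_generator \<Omega> w \<Phi> ^^ m) \<phi> \<psi>}"

text \<open>Bounded linear operators on \<open>L\<^sup>1\<close> with weight \<open>w\<close>, linearity being understood almost
  everywhere.\<close>

definition bounded_operator_L1 ::
    "'a::euclidean_space set \<Rightarrow> ('a \<Rightarrow> real) \<Rightarrow> (('a \<Rightarrow> real) \<Rightarrow> 'a \<Rightarrow> real) \<Rightarrow> bool" where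
  "bounded_operator_L1 \<Omega> w T \<longleftrightarrow>
     (\<forall>\<rho>\<in>Lp 1 \<Omega> w. T \<rho> \<in> Lp 1 \<Omega> w) \<and>
     (\<forall>\<rho>\<in>Lp 1 \<Omega> w. \<forall>\<sigma>\<in>Lp 1 \<Omega> w. \<forall>a b.
        AE x in lebesgue_on \<Omega>. T (\<lambda>y. a * \<rho> y + b * \<sigma> y) x = a * T \<rho> x + b * T \<sigma> x) \<and>
     (\<exists>K. \<forall>\<rho>\<in>Lp 1 \<Omega> w. Lp_norm 1 \<Omega> w (T \<rho>) \<le> K * Lp_norm 1 \<Omega> w \<rho>)"

definition preadjoint_semigroup ::
    "'a::euclidean_space set \<Rightarrow> ('a \<Rightarrow> real) \<Rightarrow> (real \<Rightarrow> 'a \<Rightarrow> 'a) \<Rightarrow>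
     (real \<Rightarrow> ('a \<Rightarrow> real) \<Rightarrow> 'a \<Rightarrow> real) \<Rightarrow> bool" where
  "preadjoint_semigroup \<Omega> w \<Phi> S \<longleftrightarrow> (\<forall>t\<ge>0. bounded_operator_L1 \<Omega> w (S t) \<and>
     (\<forall>\<rho>\<in>Lp 1 \<Omega> w. \<forall>\<phi>\<in>Linf \<Omega> w.
        pairing \<Omega> w (S t \<rho>) \<phi> = pairing \<Omega> w \<rho> (comp_semigroup \<Phi> t \<phi>)))"

definition exponentially_stable ::
    "'a::euclidean_space set \<Rightarrow> ('a \<Rightarrow> real) \<Rightarrow> (real \<Rightarrow> ('a \<Rightarrow> real) \<Rightarrow> 'a \<Rightarrow> real) \<Rightarrow> real \<Rightarrow> bool" where
  "exponentially_stable \<Omega> w S \<omega>\<^sub>0 \<longleftrightarrow> \<omega>\<^sub>0 < 0 \<and>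
     (\<exists>M\<ge>1. \<forall>t\<ge>0. \<forall>\<rho>\<in>Lp 1 \<Omega> w.
        Lp_norm 1 \<Omega> w (S t \<rho>) \<le> M * exp (\<omega>\<^sub>0 * t) * Lp_norm 1 \<Omega> w \<rho>)"

section \<open>The observation operator\<close>

definition observation ::
    "'a::euclidean_space set \<Rightarrow> ('a \<Rightarrow> real) \<Rightarrow> ('r::finite \<Rightarrow> 'a \<Rightarrow> real) \<Rightarrow> ('a \<Rightarrow> real) \<Rightarrow> real ^ 'r" where
  "observation \<Omega> w c \<phi> = (\<chi> i. pairing \<Omega> w \<phi> (c i))"

definition observation_adjoint ::
    "('r::finite \<Rightarrow> 'a \<Rightarrow> real) \<Rightarrow> real ^ 'r \<Rightarrow> 'a \<Rightarrow> real" where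
  "observation_adjoint c a = (\<lambda>x. \<Sum>i\<in>UNIV. a $ i * c i x)"

end

theory Submission
  imports Defs
begin

text \<open>
  Write \<open>F \<rho> q t = \<langle>\<rho>, S\<^sup>*(t) (A\<^sup>*)\<^sup>q c\<rangle>\<close>, a vector with one component for every \<open>c\<^sub>i\<close>. The value form is the
  \<open>L\<^sup>2\<close> inner product in time of \<open>F \<phi> 0\<close> and \<open>F \<psi> 0\<close>. If \<open>e\<^sub>n\<close> is an orthonormal system in
  \<open>L\<^sup>2\<close> in time, then \<open>p\<^sub>n(x) = \<integral> e\<^sub>n(t) \<bullet> c(\<Phi>\<^sup>t x) dt\<close> satisfies \<open>\<langle>\<phi>, p\<^sub>n\<rangle> = \<integral> e\<^sub>n \<bullet> F \<phi> 0\<close> by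
  Fubini (\<open>pairing_coefficient\<close>), so the claimed expansion is Parseval's identity, and the rate of
  decay of the \<open>p\<^sub>n\<close> says how well the scalar signals \<open>t \<mapsto> c(\<Phi>\<^sup>t x)\<close> are approximated by the first
  \<open>N\<close> basis functions. Everything therefore depends on the choice of \<open>e\<^sub>n\<close>.

  The choice is as follows. On level \<open>b\<close>, cut the time interval \<open>[0, 3 \<sqdot> 2\<^sup>b)\<close> into cells of
  length \<open>2\<^sup>-\<^sup>b\<close>, and use on each cell the polynomials of degree less than \<open>m\<close>. This takes
  \<open>O(4\<^sup>b)\<close> functions. A signal with \<open>m\<close> exponentially decaying derivatives is approximated by its
  Taylor polynomials on the cells with an error \<open>O(2\<^sup>-\<^sup>b\<^sup>m)\<close>, and what happens after the time
  \<open>3 \<sqdot> 2\<^sup>b\<close> is even smaller; so the square of the \<open>L\<^sup>2\<close> error is \<open>O(4\<^sup>-\<^sup>b\<^sup>m)\<close>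
  (\<open>pw_poly_approximation\<close>). Enumerate the functions of all levels in one sequence and
  orthonormalise it by Gram and Schmidt. The defect in Bessel's inequality after \<open>N\<close> vectors is at
  most the squared distance to \<^emph>\<open>any\<close> combination of the first \<open>N\<close> functions
  (\<open>best_approximation\<close>). With \<open>N\<close> of the order \<open>4\<^sup>b\<close> it is \<open>O(N\<^sup>-\<^sup>m)\<close>. In particular it tends to
  zero, so Parseval's identity holds for these signals.

  Two points link the scalar functions \<open>F \<rho> q\<close> to the signals along the orbits.

  First, \<open>F \<rho> (q + 1)\<close> must be the derivative of \<open>F \<rho> q\<close> in a sense that is strong enough for
  Taylor's formula. The weak-* generator gives only a right derivative. Continuity from the left comes from a bound
  \<open>\<parallel>S\<^sup>*(h) \<psi> - \<psi>\<parallel> \<le> K h\<close>, which holds because weak-* convergent sequences are bounded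
  (\<open>weak_star_bounded_imp_uniformly_bounded\<close>, proved by a gliding hump); a continuous function with
  a bounded right derivative obeys the mean value inequality (\<open>right_derivative_bound\<close>), and
  Taylor's formula follows.

  Second, a bound for \<open>\<langle>\<rho>, \<psi>\<rangle>\<close> by \<open>K \<parallel>\<rho>\<parallel>\<close> for all \<open>\<rho>\<close> is a bound for \<open>\<psi> w\<close> almost everywhere
  (\<open>AE_bound_by_duality\<close>). So the Taylor estimate for the functions \<open>F \<rho> 0\<close> turns into the same
  estimate for \<open>w(x) c(\<Phi>\<^sup>t x)\<close>, for every \<open>t\<close> and almost every \<open>x\<close>, and by Fubini for almost every
  \<open>x\<close> and almost every \<open>t\<close>. Integrating Bessel's defect over the bounded set \<open>\<Omega>\<close> gives the tail
  bound in \<open>H\<close>. The same duality, applied to indicator functions, shows that \<open>\<Phi>\<^sup>t\<close> pulls null sets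
  back to null sets and keeps almost every point of \<open>\<Omega>\<close> inside \<open>\<Omega>\<close> (\<open>flow_avoids_null\<close>), so that
  composition with the flow respects equality almost everywhere.
\<close>

section \<open>Trajectories depend continuously on their initial point\<close>

lemma C1_lipschitz_on_cball:
  fixes f :: "'a::euclidean_space \<Rightarrow> 'a"
  assumes "C1_on UNIV f"
  obtains L where "0 \<le> L"
    "\<And>x y. x \<in> cball 0 R \<Longrightarrow> y \<in> cball 0 R \<Longrightarrow> norm (f x - f y) \<le> L * norm (x - y)"
proof -
  obtain g' :: "'a \<Rightarrow> 'a \<Rightarrow>\<^sub>L 'a"
    where g': "\<And>x. (f has_derivative blinfun_apply (g' x)) (at x)" "continuous_on UNIV g'"
    using assms unfolding C1_on_def by auto
  have "compact (g' ` cball 0 R)"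
    by (intro compact_continuous_image continuous_on_subset[OF g'(2)]) auto
  then obtain B where "\<forall>y\<in>g' ` cball 0 R. norm y \<le> B"
    using compact_imp_bounded bounded_iff by metis
  then have B: "\<And>x. x \<in> cball 0 R \<Longrightarrow> norm (g' x) \<le> B" by blast
  have "norm (f x - f y) \<le> max B 0 * norm (x - y)" if "x \<in> cball 0 R" "y \<in> cball 0 R" for x y
  proof (rule differentiable_bound[of "cball 0 R" f "\<lambda>x. blinfun_apply (g' x)"])
    show "\<And>x. x \<in> cball 0 R \<Longrightarrow> (f has_derivative blinfun_apply (g' x)) (at x within cball 0 R)"
      using g'(1) has_derivative_at_withinI by blast
    show "\<And>x. x \<in> cball 0 R \<Longrightarrow> onorm (blinfun_apply (g' x)) \<le> max B 0"
      using B by (simp add: norm_blinfun.rep_eq[symmetric] max.coboundedI1)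
  qed (use that in auto)
  then show ?thesis by (intro that[of "max B 0"]) auto
qed

definition trajectory :: "('a::euclidean_space \<Rightarrow> 'a) \<Rightarrow> (real \<Rightarrow> 'a) \<Rightarrow> bool" where
  "trajectory f x \<longleftrightarrow> (\<forall>t\<ge>0. (x has_vector_derivative f (x t)) (at t within {0..}))"

lemma trajectory_continuous: "trajectory f x \<Longrightarrow> continuous_on {0..} x"
  unfolding trajectory_def
  by (intro continuous_on_vector_derivative[where f' = "\<lambda>t. f (x t)"]) auto

lemma trajectory_deriv:
  assumes "trajectory f x" "0 < t" shows "(x has_vector_derivative f (x t)) (at t)"
proof -
  have "at t within {0..} = at t"
    using assms(2) by (intro at_within_interior) auto
  then show ?thesis using assms by (auto simp: trajectory_def dest!: spec[of _ t])
qed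

text \<open>Gronwall's argument: as long as both trajectories stay in a ball on which \<open>f\<close> is
  \<open>L\<close>-Lipschitz, \<open>exp (-2Ls) \<bar>y s - x s\<bar>\<^sup>2\<close> has a nonpositive derivative.\<close>

lemma trajectory_gap_in_ball:
  fixes x y :: "real \<Rightarrow> 'a::euclidean_space"
  assumes x: "trajectory f x" and y: "trajectory f y" and t: "0 \<le> t"
    and L: "\<And>u v. u \<in> cball 0 (R + 1) \<Longrightarrow> v \<in> cball 0 (R + 1) \<Longrightarrow> norm (f u - f v) \<le> L * norm (u - v)"
    and R: "\<And>s. 0 \<le> s \<Longrightarrow> s \<le> t \<Longrightarrow> norm (x s) \<le> R"
    and close: "\<And>s. 0 < s \<Longrightarrow> s < t \<Longrightarrow> norm (y s - x s) \<le> 1"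
  shows "norm (y t - x t) \<le> norm (y 0 - x 0) * exp (L * t)"
proof (cases "t = 0")
  case False
  define d where "d s = y s - x s" for s
  define \<phi> where "\<phi> s = exp (-2 * L * s) * (d s \<bullet> d s)" for s
  have cont: "continuous_on {0..t} d"
    unfolding d_def using trajectory_continuous[OF x] trajectory_continuous[OF y]
    by (auto intro!: continuous_intros elim: continuous_on_subset)
  have "\<phi> t \<le> \<phi> 0"
  proof (rule DERIV_nonpos_imp_decreasing_open[of 0 t \<phi>])
    show "0 \<le> t" by fact
    show "continuous_on {0..t} \<phi>" unfolding \<phi>_def using cont by (intro continuous_intros)
    fix s assume s: "0 < s" "s < t"
    have "((\<lambda>s. d s) has_vector_derivative (f (y s) - f (x s))) (at s)"
      unfolding d_def by (intro derivative_intros trajectory_deriv x y s)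
    then have dd: "(d has_derivative (\<lambda>h. h *\<^sub>R (f (y s) - f (x s)))) (at s)"
      by (simp add: has_vector_derivative_def)
    have "(\<phi> has_derivative (\<lambda>h. h * (exp (-2 * L * s) * (2 * (d s \<bullet> (f (y s) - f (x s))) - 2 * L * (d s \<bullet> d s))))) (at s)"
      unfolding \<phi>_def by (auto intro!: derivative_eq_intros dd simp: algebra_simps inner_commute fun_eq_iff)
    then have der: "DERIV \<phi> s :> exp (-2 * L * s) * (2 * (d s \<bullet> (f (y s) - f (x s))) - 2 * L * (d s \<bullet> d s))"
      by (simp add: has_field_derivative_def mult_commute_abs)
    have ns: "norm (x s) \<le> R" using R s by simp
    have "norm (y s) \<le> norm (x s) + norm (y s - x s)" by (metis add.commute diff_add_cancel norm_triangle_ineq)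
    then have "norm (y s) \<le> R + 1" using close[OF s] ns by linarith
    then have "norm (f (y s) - f (x s)) \<le> L * norm (d s)"
      unfolding d_def using ns by (intro L) auto
    then have "d s \<bullet> (f (y s) - f (x s)) \<le> norm (d s) * (L * norm (d s))"
      by (meson norm_cauchy_schwarz mult_left_mono norm_ge_zero order_trans)
    also have "\<dots> = L * (d s \<bullet> d s)" by (simp add: dot_square_norm power2_eq_square)
    finally have "exp (-2 * L * s) * (2 * (d s \<bullet> (f (y s) - f (x s))) - 2 * L * (d s \<bullet> d s)) \<le> 0"
      by (intro mult_nonneg_nonpos) auto
    then show "\<exists>y. DERIV \<phi> s :> y \<and> y \<le> 0" using der by blast
  qed
  then have "exp (-2 * L * t) * (norm (d t))\<^sup>2 \<le> (norm (d 0))\<^sup>2"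
    by (simp add: \<phi>_def dot_square_norm)
  then have "(exp (-2 * L * t) * (norm (d t))\<^sup>2) * exp (2 * L * t) \<le> (norm (d 0))\<^sup>2 * exp (2 * L * t)"
    by (intro mult_right_mono) auto
  then have "(norm (d t))\<^sup>2 \<le> (norm (d 0))\<^sup>2 * exp (2 * L * t)"
    by (simp add: mult.commute mult.left_commute exp_add[symmetric] mult_exp_exp[symmetric] exp_minus field_simps)
  also have "\<dots> = (norm (d 0) * exp (L * t))\<^sup>2"
    by (simp add: power_mult_distrib exp_double[symmetric] mult.assoc)
  finally show ?thesis unfolding d_def by (rule power2_le_imp_le) simp
qed simp

text \<open>The vector field is Lipschitz only locally, but a gap that starts so small that Gronwall's bound
  stays below \<open>1\<close> up to time \<open>T\<close> can never reach \<open>1\<close>: at the first time at which it does, the bound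
  of the previous lemma is already available.\<close>

lemma trajectory_gap:
  fixes x y :: "real \<Rightarrow> 'a::euclidean_space"
  assumes x: "trajectory f x" and y: "trajectory f y" and t: "0 \<le> t" "t \<le> T" and L0: "0 \<le> L"
    and L: "\<And>u v. u \<in> cball 0 (R + 1) \<Longrightarrow> v \<in> cball 0 (R + 1) \<Longrightarrow> norm (f u - f v) \<le> L * norm (u - v)"
    and R: "\<And>s. 0 \<le> s \<Longrightarrow> s \<le> T \<Longrightarrow> norm (x s) \<le> R"
    and close: "norm (y 0 - x 0) * exp (L * T) < 1"
  shows "norm (y t - x t) \<le> norm (y 0 - x 0) * exp (L * T)"
proof -
  have *: "norm (y t - x t) \<le> norm (y 0 - x 0) * exp (L * T)"
    if "0 \<le> t" "t \<le> T" "\<And>s. 0 < s \<Longrightarrow> s < t \<Longrightarrow> norm (y s - x s) \<le> 1" for t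
  proof -
    have "norm (y t - x t) \<le> norm (y 0 - x 0) * exp (L * t)"
      using that R by (intro trajectory_gap_in_ball[OF x y _ L]) auto
    also have "\<dots> \<le> norm (y 0 - x 0) * exp (L * T)"
      using that L0 by (intro mult_left_mono) (auto intro: mult_left_mono)
    finally show ?thesis .
  qed
  have "norm (y s - x s) < 1" if s: "0 \<le> s" "s \<le> T" for s
  proof (rule ccontr)
    assume "\<not> norm (y s - x s) < 1"
    define B where "B = {s \<in> {0..T}. 1 \<le> norm (y s - x s)}"
    have "continuous_on {0..T} (\<lambda>s. norm (y s - x s))"
      using trajectory_continuous[OF x] trajectory_continuous[OF y]
      by (auto intro!: continuous_intros elim: continuous_on_subset)
    then have "closed ({0..T} \<inter> (\<lambda>s. norm (y s - x s)) -` {1..})"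
      by (intro continuous_closed_preimage) auto
    then have "compact ({0..T} \<inter> (\<lambda>s. norm (y s - x s)) -` {1..})"
      by (meson Int_lower1 bounded_closed_interval bounded_subset compact_eq_bounded_closed)
    moreover have "B = {0..T} \<inter> (\<lambda>s. norm (y s - x s)) -` {1..}" by (auto simp: B_def)
    ultimately have "compact B" by simp
    moreover have "s \<in> B" using s \<open>\<not> norm (y s - x s) < 1\<close> by (auto simp: B_def)
    ultimately obtain \<tau> where \<tau>: "\<tau> \<in> B" "\<And>r. r \<in> B \<Longrightarrow> \<tau> \<le> r"
      using compact_attains_inf[of B] by auto
    have "norm (y r - x r) \<le> 1" if "0 < r" "r < \<tau>" for r
      using \<tau>(2)[of r] \<tau>(1) that by (force simp: B_def)
    then have "norm (y \<tau> - x \<tau>) \<le> norm (y 0 - x 0) * exp (L * T)"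
      using \<tau>(1) by (intro *) (auto simp: B_def)
    then show False using \<tau>(1) close by (simp add: B_def)
  qed
  then show ?thesis using t by (intro *) (auto intro: less_imp_le)
qed

lemma trajectory_bounded:
  assumes "trajectory f x"
  obtains R where "\<And>s. 0 \<le> s \<Longrightarrow> s \<le> T \<Longrightarrow> norm (x s) \<le> R"
proof -
  have "compact (x ` {0..T})"
    using continuous_on_subset[OF trajectory_continuous[OF assms]]
    by (intro compact_continuous_image) auto
  then obtain R where "\<forall>y\<in>x ` {0..T}. norm y \<le> R"
    using compact_imp_bounded bounded_iff by metis
  then show ?thesis by (intro that[of R]) auto
qed

lemma trajectory_unique:
  fixes x y :: "real \<Rightarrow> 'a::euclidean_space"
  assumes f: "C1_on UNIV f" and x: "trajectory f x" and y: "trajectory f y"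
    and eq: "x 0 = y 0" and t: "0 \<le> t"
  shows "x t = y t"
proof -
  obtain R where R: "\<And>s. 0 \<le> s \<Longrightarrow> s \<le> t \<Longrightarrow> norm (x s) \<le> R"
    using trajectory_bounded[OF x, of t] by metis
  obtain L where L: "0 \<le> L"
    "\<And>u v. u \<in> cball 0 (R + 1) \<Longrightarrow> v \<in> cball 0 (R + 1) \<Longrightarrow> norm (f u - f v) \<le> L * norm (u - v)"
    using C1_lipschitz_on_cball[OF f] by metis
  have "norm (y t - x t) \<le> norm (y 0 - x 0) * exp (L * t)"
    by (rule trajectory_gap[OF x y t order_refl L(1) L(2) R]) (use eq in auto)
  then show ?thesis using eq by simp
qed

lemma flow_on_trajectory: "flow_on f K \<Phi> \<Longrightarrow> z \<in> K \<Longrightarrow> trajectory f (\<lambda>t. \<Phi> t z)"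
  by (auto simp: flow_on_def trajectory_def)

text \<open>Both sides are trajectories that start at \<open>\<Phi> t z\<close>. This point must lie in \<open>K\<close>, because the
  flow is specified only for starting points in \<open>K\<close>.\<close>

lemma flow_on_semigroup:
  assumes f: "C1_on UNIV f" and flow: "flow_on f K \<Phi>"
    and z: "z \<in> K" and t: "0 \<le> t" "\<Phi> t z \<in> K" and s: "0 \<le> s"
  shows "\<Phi> s (\<Phi> t z) = \<Phi> (t + s) z"
proof (rule trajectory_unique[OF f, of "\<lambda>s. \<Phi> s (\<Phi> t z)" "\<lambda>s. \<Phi> (t + s) z" s])
  show "trajectory f (\<lambda>s. \<Phi> s (\<Phi> t z))" by (rule flow_on_trajectory[OF flow t(2)])
  show "trajectory f (\<lambda>s. \<Phi> (t + s) z)"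
    unfolding trajectory_def
  proof safe
    fix s :: real assume s: "0 \<le> s"
    have "((\<lambda>r. \<Phi> r z) has_vector_derivative f (\<Phi> (t + s) z)) (at (t + s) within {0..})"
      using flow_on_trajectory[OF flow z] s t by (auto simp: trajectory_def)
    then have "((\<lambda>r. \<Phi> r z) has_vector_derivative f (\<Phi> (t + s) z)) (at (t + s) within (+) t ` {0..})"
      by (rule has_vector_derivative_within_subset) (use t in auto)
    then have "((\<lambda>r. \<Phi> r z) \<circ> (+) t has_vector_derivative 1 *\<^sub>R f (\<Phi> (t + s) z)) (at s within {0..})"
      by (intro vector_diff_chain_within) (auto intro!: derivative_eq_intros)
    then show "((\<lambda>s. \<Phi> (t + s) z) has_vector_derivative f (\<Phi> (t + s) z)) (at s within {0..})"
      by (simp add: o_def)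
  qed
  show "\<Phi> 0 (\<Phi> t z) = \<Phi> (t + 0) z" using flow t by (simp add: flow_on_def)
qed (use s in auto)

lemma flow_on_jointly_continuous:
  assumes f: "C1_on UNIV f" and flow: "flow_on f K \<Phi>"
  shows "continuous_on ({0..} \<times> K) (\<lambda>(t, z). \<Phi> t z)"
  unfolding continuous_on_iff
proof (intro ballI allI impI)
  fix p\<^sub>0 :: "real \<times> 'a" and e :: real assume "p\<^sub>0 \<in> {0..} \<times> K" and e: "0 < e"
  then obtain t z where p0: "p\<^sub>0 = (t, z)" and t: "0 \<le> t" and z: "z \<in> K" by auto
  note x = flow_on_trajectory[OF flow z]
  obtain R where R: "\<And>s. 0 \<le> s \<Longrightarrow> s \<le> t + 1 \<Longrightarrow> norm (\<Phi> s z) \<le> R"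
    using trajectory_bounded[OF x] by metis
  obtain L where L: "0 \<le> L"
    "\<And>u v. u \<in> cball 0 (R + 1) \<Longrightarrow> v \<in> cball 0 (R + 1) \<Longrightarrow> norm (f u - f v) \<le> L * norm (u - v)"
    using C1_lipschitz_on_cball[OF f] by metis
  obtain d where d: "0 < d" "\<And>s. 0 \<le> s \<Longrightarrow> dist s t < d \<Longrightarrow> dist (\<Phi> s z) (\<Phi> t z) < e / 2"
    using trajectory_continuous[OF x] t e unfolding continuous_on_iff
    by (metis atLeast_iff half_gt_zero)
  (* The first minimum keeps the time below t + 1 and handles the fixed trajectory; the second one
     makes the Gronwall bound at time t + 1 smaller than 1 and than e / 2. *)
  define \<delta> where "\<delta> = min (min d 1) (min 1 (e / 2) * exp (- (L * (t + 1))))"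
  show "\<exists>\<delta>>0. \<forall>p\<in>{0..} \<times> K. dist p p\<^sub>0 < \<delta> \<longrightarrow>
      dist (case p of (t, z) \<Rightarrow> \<Phi> t z) (case p\<^sub>0 of (t, z) \<Rightarrow> \<Phi> t z) < e"
  proof (intro exI conjI ballI impI)
    show "0 < \<delta>" using d e by (auto simp: \<delta>_def)
    fix p assume "p \<in> {0..} \<times> K" and p: "dist p p\<^sub>0 < \<delta>"
    then obtain s z' where p_eq: "p = (s, z')" and s: "0 \<le> s" and z': "z' \<in> K" by auto
    have "dist s t < \<delta>" "dist z' z < \<delta>"
      using p order_le_less_trans[OF dist_fst_le p] order_le_less_trans[OF dist_snd_le p] by (auto simp: p_eq p0)
    then have st: "dist s t < d" "s \<le> t + 1" and zz: "norm (z' - z) < min 1 (e / 2) * exp (- (L * (t + 1)))"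
      by (auto simp: \<delta>_def dist_norm)
    from zz have "norm (z' - z) * exp (L * (t + 1)) < min 1 (e / 2) * exp (- (L * (t + 1))) * exp (L * (t + 1))"
      by (intro mult_strict_right_mono) auto
    also have "\<dots> = min 1 (e / 2)" by (simp only: mult.assoc mult_exp_exp) simp
    finally have "norm (z' - z) * exp (L * (t + 1)) < min 1 (e / 2)" .
    then have c: "norm (\<Phi> 0 z' - \<Phi> 0 z) * exp (L * (t + 1)) < min 1 (e / 2)"
      using flow z z' by (simp add: flow_on_def)
    have "norm (\<Phi> s z' - \<Phi> s z) \<le> norm (\<Phi> 0 z' - \<Phi> 0 z) * exp (L * (t + 1))"
      by (rule trajectory_gap[OF x flow_on_trajectory[OF flow z'] s st(2) L(1) L(2) R]) (use c in auto)
    then have "dist (\<Phi> s z') (\<Phi> s z) < e / 2" using c by (simp add: dist_norm)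
    then show "dist (case p of (t, z) \<Rightarrow> \<Phi> t z) (case p\<^sub>0 of (t, z) \<Rightarrow> \<Phi> t z) < e"
      using d(2)[OF s st(1)] dist_triangle_half_l by (auto simp: p_eq p0 dist_commute dest: dist_triangle_half_r)
  qed
qed

section \<open>Taylor approximation from right derivatives\<close>

text \<open>A weak-* generator provides derivatives from the right only, so that the mean value theorem does
  not apply. Instead, take the last point \<open>s\<close> up to which the bound holds with slope \<open>K + \<epsilon>\<close>; the
  right derivative at \<open>s\<close> extends the bound a little beyond \<open>s\<close>.\<close>

lemma right_derivative_bound:
  fixes F :: "real \<Rightarrow> 'b::real_normed_vector"
  assumes ab: "a \<le> b" and cont: "continuous_on {a..b} F"
    and der: "\<And>t. a \<le> t \<Longrightarrow> t < b \<Longrightarrow> ((\<lambda>h. (F (t + h) - F t) /\<^sub>R h) \<longlongrightarrow> F' t) (at_right 0)"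
    and bound: "\<And>t. a \<le> t \<Longrightarrow> t < b \<Longrightarrow> norm (F' t) \<le> K"
  shows "norm (F b - F a) \<le> K * (b - a)"
proof -
  have eps: "norm (F b - F a) \<le> (K + \<epsilon>) * (b - a)" if \<epsilon>: "0 < \<epsilon>" for \<epsilon>
  proof (rule ccontr)
    assume neg: "\<not> ?thesis"
    (* The largest element of Z is the last point at which the bound with slope K + epsilon holds. *)
    define Z where "Z = {s \<in> {a..b}. norm (F s - F a) \<le> (K + \<epsilon>) * (s - a)}"
    have "closed Z"
      unfolding Z_def by (intro continuous_on_closed_Collect_le continuous_intros cont)
    then have "compact Z"
      by (auto simp: compact_eq_bounded_closed Z_def intro: bounded_subset[OF bounded_closed_interval])
    moreover have "a \<in> Z" using ab by (simp add: Z_def)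
    ultimately obtain s where s: "s \<in> Z" "\<And>r. r \<in> Z \<Longrightarrow> r \<le> s"
      using compact_attains_sup[of Z] by auto
    have "s \<noteq> b" using s(1) neg by (auto simp: Z_def)
    then have sb: "a \<le> s" "s < b" using s(1) by (auto simp: Z_def)
    have "eventually (\<lambda>h. norm ((F (s + h) - F s) /\<^sub>R h) < K + \<epsilon>) (at_right 0)"
      using bound[OF sb] \<epsilon> by (intro order_tendstoD(2)[OF tendsto_norm[OF der[OF sb]]]) simp
    moreover have "eventually (\<lambda>h. h \<in> {0<..<b - s}) (at_right 0)"
      using sb by (intro eventually_at_right_real) simp
    ultimately have "eventually (\<lambda>h. norm ((F (s + h) - F s) /\<^sub>R h) < K + \<epsilon> \<and> h \<in> {0<..<b - s}) (at_right 0)"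
      by (rule eventually_conj)
    then obtain h where h: "norm ((F (s + h) - F s) /\<^sub>R h) < K + \<epsilon>" "0 < h" "h < b - s"
      using eventually_happens'[OF trivial_limit_at_right_real] by (metis (no_types, lifting) greaterThanLessThan_iff)
    have "norm (F (s + h) - F s) \<le> (K + \<epsilon>) * h"
    proof -
      have "norm (F (s + h) - F s) / h < K + \<epsilon>"
        using h by (simp add: divide_inverse mult.commute)
      then show ?thesis using h(2) by (simp add: pos_divide_less_eq)
    qed
    moreover have "norm (F (s + h) - F a) \<le> norm (F (s + h) - F s) + norm (F s - F a)"
      by (metis norm_triangle_ineq diff_add_cancel add_diff_eq)
    ultimately have "norm (F (s + h) - F a) \<le> (K + \<epsilon>) * (s + h - a)"
      using s(1) by (auto simp: Z_def algebra_simps)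
    then have "s + h \<in> Z" using h sb by (auto simp: Z_def)
    then show False using s(2)[of "s + h"] h by simp
  qed
  show ?thesis
  proof (rule field_le_epsilon)
    fix e :: real assume e: "0 < e"
    have "norm (F b - F a) \<le> (K + e / (b - a + 1)) * (b - a)" using e ab by (intro eps) auto
    also have "\<dots> = K * (b - a) + e * ((b - a) / (b - a + 1))" by (simp add: algebra_simps)
    also have "\<dots> \<le> K * (b - a) + e * 1"
      using e ab by (intro add_left_mono mult_left_mono) auto
    finally show "norm (F b - F a) \<le> K * (b - a) + e" by simp
  qed
qed

lemma has_vector_derivative_right_quotient:
  fixes P :: "real \<Rightarrow> 'b::real_normed_vector"
  assumes "(P has_vector_derivative D) (at s)"
  shows "((\<lambda>h. (P (s + h) - P s) /\<^sub>R h) \<longlongrightarrow> D) (at_right 0)"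
proof -
  have "((\<lambda>h. norm (P (s + h) - P s - h *\<^sub>R D) / norm h) \<longlongrightarrow> 0) (at 0)"
    using assms by (simp add: has_vector_derivative_def has_derivative_at)
  then have "((\<lambda>h. norm (P (s + h) - P s - h *\<^sub>R D) / norm h) \<longlongrightarrow> 0) (at_right 0)"
    by (rule tendsto_mono[rotated]) (simp add: at_le)
  moreover have "eventually (\<lambda>h. norm (P (s + h) - P s - h *\<^sub>R D) / norm h = norm ((P (s + h) - P s) /\<^sub>R h - D)) (at_right 0)"
    unfolding eventually_at_right_field
  proof (intro exI[of _ 1] conjI allI impI)
    fix h :: real assume "0 < h"
    then have "(P (s + h) - P s) /\<^sub>R h - D = (P (s + h) - P s - h *\<^sub>R D) /\<^sub>R h"
      by (simp add: scaleR_diff_right)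
    then show "norm (P (s + h) - P s - h *\<^sub>R D) / norm h = norm ((P (s + h) - P s) /\<^sub>R h - D)"
      by (simp add: divide_inverse mult.commute)
  qed simp
  ultimately have "((\<lambda>h. norm ((P (s + h) - P s) /\<^sub>R h - D)) \<longlongrightarrow> 0) (at_right 0)"
    by (rule Lim_transform_eventually)
  then have "((\<lambda>h. (P (s + h) - P s) /\<^sub>R h - D) \<longlongrightarrow> 0) (at_right 0)"
    by (rule tendsto_norm_zero_cancel)
  then show ?thesis by (simp add: LIM_zero_iff)
qed

text \<open>The difference of \<open>F 0\<close> and its Taylor polynomial has as right derivative the corresponding
  difference for \<open>F 1\<close>, which the induction hypothesis bounds. Each step loses the factor
  \<open>1 / (n + 1)\<close> that integration would gain.\<close>

lemma right_taylor:
  fixes F :: "nat \<Rightarrow> real \<Rightarrow> 'b::real_normed_vector"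
  assumes "\<And>q. q < n \<Longrightarrow> continuous_on {a..} (F q)"
    and "\<And>q t. q < n \<Longrightarrow> a \<le> t \<Longrightarrow> ((\<lambda>h. (F q (t + h) - F q t) /\<^sub>R h) \<longlongrightarrow> F (Suc q) t) (at_right 0)"
    and "\<And>t. a \<le> t \<Longrightarrow> norm (F n t) \<le> K"
    and "a \<le> t"
  shows "norm (F 0 t - (\<Sum>q<n. ((t - a) ^ q / fact q) *\<^sub>R F q a)) \<le> K * (t - a) ^ n"
  using assms
proof (induction n arbitrary: F t)
  case 0
  then show ?case by simp
next
  case (Suc n)
  define P where "P s = (\<Sum>q<Suc n. ((s - a) ^ q / fact q) *\<^sub>R F q a)" for s
  define P' where "P' s = (\<Sum>q<n. ((s - a) ^ q / fact q) *\<^sub>R F (Suc q) a)" for s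
  define G where "G s = F 0 s - P s" for s
  have P: "P = (\<lambda>s. F 0 a + (\<Sum>q<n. ((s - a) ^ Suc q / fact (Suc q)) *\<^sub>R F (Suc q) a))"
    unfolding P_def sum.lessThan_Suc_shift by simp
  have monom: "((\<lambda>s. (s - a) ^ Suc q / fact (Suc q)) has_real_derivative ((s - a) ^ q / fact q)) (at s)" for q s
  proof -
    have "real (Suc q) * (s - a) ^ q / fact (Suc q) = (s - a) ^ q / fact q"
      by (simp add: fact_Suc del: of_nat_Suc)
    then show ?thesis by (auto intro!: derivative_eq_intros simp del: fact_Suc power_Suc of_nat_Suc)
  qed
  have dP: "(P has_vector_derivative P' s) (at s)" for s
  proof -
    have "((\<lambda>s. \<Sum>q<n. ((s - a) ^ Suc q / fact (Suc q)) *\<^sub>R F (Suc q) a) has_vector_derivative P' s) (at s)"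
      unfolding P'_def
    proof (rule has_vector_derivative_sum)
      fix q
      have "((\<lambda>s. ((s - a) ^ Suc q / fact (Suc q)) *\<^sub>R F (Suc q) a) has_vector_derivative
          ((s - a) ^ Suc q / fact (Suc q)) *\<^sub>R 0 + ((s - a) ^ q / fact q) *\<^sub>R F (Suc q) a) (at s)"
        by (rule has_vector_derivative_scaleR[OF monom has_vector_derivative_const])
      then show "((\<lambda>s. ((s - a) ^ Suc q / fact (Suc q)) *\<^sub>R F (Suc q) a) has_vector_derivative
          ((s - a) ^ q / fact q) *\<^sub>R F (Suc q) a) (at s)" by simp
    qed
    from has_vector_derivative_add[OF has_vector_derivative_const this] show ?thesis
      unfolding P by simp
  qed
  have contP: "continuous_on X P" for X
    using dP by (meson continuous_at_imp_continuous_on has_vector_derivative_continuous)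
  have "norm (G t - G a) \<le> (K * (t - a) ^ n) * (t - a)"
  proof (rule right_derivative_bound)
    show "a \<le> t" by fact
    show "continuous_on {a..t} G"
      unfolding G_def using Suc.prems(1)[of 0] contP
      by (intro continuous_intros) (auto elim: continuous_on_subset)
    fix s assume s: "a \<le> s" "s < t"
    have "((\<lambda>h. (F 0 (s + h) - F 0 s) /\<^sub>R h - (P (s + h) - P s) /\<^sub>R h) \<longlongrightarrow> F (Suc 0) s - P' s) (at_right 0)"
      using s by (intro tendsto_diff Suc.prems(2) has_vector_derivative_right_quotient dP) auto
    then show "((\<lambda>h. (G (s + h) - G s) /\<^sub>R h) \<longlongrightarrow> F (Suc 0) s - P' s) (at_right 0)"
      by (simp add: G_def algebra_simps)
    have "norm (F (Suc 0) s - P' s) \<le> K * (s - a) ^ n"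
      unfolding P'_def using s by (intro Suc.IH[of "\<lambda>q. F (Suc q)"] Suc.prems) auto
    also have "\<dots> \<le> K * (t - a) ^ n"
    proof -
      have "0 \<le> K" using Suc.prems(3)[of a] norm_ge_zero order_trans by blast
      then show ?thesis using s by (intro mult_left_mono power_mono) auto
    qed
    finally show "norm (F (Suc 0) s - P' s) \<le> K * (t - a) ^ n" .
  qed
  moreover have "G a = 0" by (simp add: G_def P)
  ultimately show ?case by (simp add: G_def P_def mult.commute mult.left_commute)
qed

text \<open>The piecewise polynomial of level \<open>b\<close>: the coefficients \<open>y j\<close> belong to the cell that starts at
  \<open>j / 2\<^sup>b\<close>. Cells of length \<open>2\<^sup>-\<^sup>b\<close> up to a time proportional to \<open>2\<^sup>b\<close> are \<open>O(4\<^sup>b)\<close> many;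
  the factor \<open>3\<close> is the number for which level \<open>b\<close> has exactly as many cells as there are integers
  from \<open>4\<^sup>b\<close> to \<open>4\<^sup>b\<^sup>+\<^sup>1 - 1\<close>.\<close>

definition pw_poly :: "nat \<Rightarrow> nat \<Rightarrow> (nat \<Rightarrow> nat \<Rightarrow> 'b::real_vector) \<Rightarrow> real \<Rightarrow> 'b" where
  "pw_poly m b y t = (if 0 \<le> t \<and> t < 3 * 2 ^ b
     then (\<Sum>q<m. (t - real (nat \<lfloor>t * 2 ^ b\<rfloor>) / 2 ^ b) ^ q *\<^sub>R y (nat \<lfloor>t * 2 ^ b\<rfloor>) q) else 0)"

lemma exp_ge_power_over_fact:
  assumes "0 \<le> (x::real)" shows "x ^ m / fact m \<le> exp x"
proof -
  have "x ^ m / fact m = (\<Sum>n\<in>{m}. x ^ n /\<^sub>R fact n)" by (simp add: divide_inverse mult.commute)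
  also have "\<dots> \<le> (\<Sum>n. x ^ n /\<^sub>R fact n)"
    using assms by (intro sum_le_suminf summable_exp_generic) auto
  finally show ?thesis by (simp add: exp_def)
qed

text \<open>An exponentially small quantity in \<open>2\<^sup>b\<close> is below every power of \<open>2\<^sup>-\<^sup>b\<close>. This controls the
  part of a signal that lies beyond the last cell.\<close>

lemma exp_neg_power_bound:
  assumes "(\<omega>::real) < 0"
  shows "exp (\<omega> * 2 ^ b) \<le> fact m / (- \<omega>) ^ m * (1 / 2) ^ (b * m)"
proof -
  define x :: real where "x = - \<omega> * 2 ^ b"
  have x: "0 < x" using assms by (simp add: x_def mult_neg_pos)
  have "exp (- x) \<le> fact m / x ^ m"
    using exp_ge_power_over_fact[of x m] x by (simp add: exp_minus field_simps)
  also have "\<dots> = fact m / (- \<omega>) ^ m * (1 / 2) ^ (b * m)"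
  proof -
    have "x ^ m = (- \<omega>) ^ m * 2 ^ (b * m)" unfolding x_def power_mult_distrib power_mult ..
    then show ?thesis by (simp add: power_one_over)
  qed
  finally show ?thesis by (simp add: x_def)
qed

text \<open>On the cells, Taylor's formula gives the factor \<open>2\<^sup>-\<^sup>b\<^sup>m\<close>, and the derivative of order \<open>m\<close> is
  exponentially small already at the start of the cell. After the last cell the approximation is
  zero, and one half of the exponential decay of the signal pays for the factor \<open>2\<^sup>-\<^sup>b\<^sup>m\<close>. The other
  half is kept, so that the error is square integrable in time.\<close>

lemma pw_poly_approximation:
  fixes F :: "nat \<Rightarrow> real \<Rightarrow> 'b::real_normed_vector"
  assumes \<omega>: "\<omega> < 0"
    and cont: "\<And>q. q < m \<Longrightarrow> continuous_on {0..} (F q)"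
    and der: "\<And>q t. q < m \<Longrightarrow> 0 \<le> t \<Longrightarrow> ((\<lambda>h. (F q (t + h) - F q t) /\<^sub>R h) \<longlongrightarrow> F (Suc q) t) (at_right 0)"
    and bound: "\<And>q t. q \<le> m \<Longrightarrow> 0 \<le> t \<Longrightarrow> norm (F q t) \<le> K * exp (\<omega> * t)"
    and t: "0 \<le> t"
  shows "norm (F 0 t - pw_poly m b (\<lambda>j q. F q (real j / 2 ^ b) /\<^sub>R fact q) t)
    \<le> (exp (- \<omega>) + fact m / (- \<omega>) ^ m) * K * (1 / 2) ^ (b * m) * exp (\<omega> / 2 * t)"
proof -
  define c where "c = K * (1 / 2) ^ (b * m) * exp (\<omega> / 2 * t)"
  have K: "0 \<le> K"
    using bound[of 0 0] order_trans[OF norm_ge_zero] by auto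
  then have c: "0 \<le> c" by (simp add: c_def)
  have half: "exp (\<omega> * t) \<le> exp (\<omega> / 2 * t)" using \<omega> t by (auto simp: mult_nonpos_nonneg)
  have pos: "0 \<le> fact m / (- \<omega>) ^ m" using \<omega> by simp
  have "norm (F 0 t - pw_poly m b (\<lambda>j q. F q (real j / 2 ^ b) /\<^sub>R fact q) t)
    \<le> (exp (- \<omega>) + fact m / (- \<omega>) ^ m) * c"
  proof (cases "t < 3 * 2 ^ b")
    case True
    define j where "j = nat \<lfloor>t * 2 ^ b\<rfloor>"
    define a where "a = real j / 2 ^ b"
    have j: "real j \<le> t * 2 ^ b" "t * 2 ^ b < real j + 1"
      using t by (auto simp: j_def)
    have a: "0 \<le> a" "a \<le> t" using j by (auto simp: a_def field_simps)
    have "t < (real j + 1) / 2 ^ b" using j(2) by (simp add: field_simps)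
    then have a': "t - a \<le> (1 / 2) ^ b" by (simp add: a_def add_divide_distrib power_one_over)
    (* The start of the cell is at most one unit of time before t, which costs the factor exp (- \<omega>). *)
    have a1: "t - 1 \<le> a" using a' power_le_one[of "1/2::real" b] by simp
    have eq: "pw_poly m b (\<lambda>j q. F q (real j / 2 ^ b) /\<^sub>R fact q) t = (\<Sum>q<m. ((t - a) ^ q / fact q) *\<^sub>R F q a)"
      using True t by (simp add: pw_poly_def j_def[symmetric] a_def divide_inverse)
    have "norm (F 0 t - (\<Sum>q<m. ((t - a) ^ q / fact q) *\<^sub>R F q a)) \<le> (K * exp (\<omega> * a)) * (t - a) ^ m"
    proof (rule right_taylor)
      fix s assume s: "a \<le> s"
      have "norm (F m s) \<le> K * exp (\<omega> * s)" using s a by (intro bound) auto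
      also have "\<dots> \<le> K * exp (\<omega> * a)"
      proof -
        have "\<omega> * s \<le> \<omega> * a" using s \<omega> by (intro mult_left_mono_neg) auto
        then show ?thesis using K by (simp add: mult_left_mono)
      qed
      finally show "norm (F m s) \<le> K * exp (\<omega> * a)" .
    qed (use a in \<open>auto intro!: der intro: continuous_on_subset[OF cont]\<close>)
    moreover have "(K * exp (\<omega> * a)) * (t - a) ^ m \<le> (K * (exp (- \<omega>) * exp (\<omega> / 2 * t))) * ((1 / 2) ^ b) ^ m"
    proof (intro mult_mono mult_left_mono power_mono)
      have "exp (\<omega> * a) \<le> exp (\<omega> * (t - 1))" using a1 \<omega> by auto
      also have "\<dots> = exp (- \<omega>) * exp (\<omega> * t)" by (simp add: exp_add[symmetric] algebra_simps)
      also have "\<dots> \<le> exp (- \<omega>) * exp (\<omega> / 2 * t)" using half by (intro mult_left_mono) auto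
      finally show "exp (\<omega> * a) \<le> exp (- \<omega>) * exp (\<omega> / 2 * t)" .
    qed (use K a a' in auto)
    moreover have "\<dots> = exp (- \<omega>) * c" by (simp add: c_def power_mult)
    moreover have "\<dots> \<le> (exp (- \<omega>) + fact m / (- \<omega>) ^ m) * c"
      using c pos by (intro mult_right_mono) auto
    ultimately show ?thesis unfolding eq by linarith
  next
    case False
    have "exp (\<omega> * t) = exp (\<omega> / 2 * t) * exp (\<omega> / 2 * t)" by (simp add: exp_add[symmetric])
    also have "\<dots> \<le> exp (\<omega> / 2 * t) * exp (\<omega> * 2 ^ b)"
    proof -
      have "2 ^ b \<le> t / 2" using False by (simp add: not_less) (smt (verit) zero_le_power)
      then have "\<omega> * (t / 2) \<le> \<omega> * 2 ^ b" using \<omega> by (intro mult_left_mono_neg) auto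
      then show ?thesis by (intro mult_left_mono) auto
    qed
    also have "\<dots> \<le> exp (\<omega> / 2 * t) * (fact m / (- \<omega>) ^ m * (1 / 2) ^ (b * m))"
      by (intro mult_left_mono exp_neg_power_bound \<omega>) auto
    finally have "K * exp (\<omega> * t) \<le> K * (exp (\<omega> / 2 * t) * (fact m / (- \<omega>) ^ m * (1 / 2) ^ (b * m)))"
      using K by (rule mult_left_mono)
    also have "\<dots> = fact m / (- \<omega>) ^ m * c" by (simp add: c_def)
    finally have "norm (F 0 t) \<le> fact m / (- \<omega>) ^ m * c"
      using bound[of 0 t] t by simp
    also have "\<dots> \<le> (exp (- \<omega>) + fact m / (- \<omega>) ^ m) * c"
      using c by (intro mult_right_mono) auto
    finally show ?thesis using False by (simp add: pw_poly_def)
  qed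
  then show ?thesis by (simp add: c_def mult.assoc)
qed

section \<open>Gram-Schmidt orthonormalisation of square integrable functions\<close>

text \<open>The space \<open>L\<^sup>2\<close> is represented by functions, not by classes of functions, because the same
  constructions are used for almost every orbit separately.\<close>

definition square_integrable :: "'a measure \<Rightarrow> ('a \<Rightarrow> 'b::euclidean_space) \<Rightarrow> bool" where
  "square_integrable M f \<longleftrightarrow> f \<in> borel_measurable M \<and> integrable M (\<lambda>t. (norm (f t))\<^sup>2)"

definition L2_inner :: "'a measure \<Rightarrow> ('a \<Rightarrow> 'b::euclidean_space) \<Rightarrow> ('a \<Rightarrow> 'b) \<Rightarrow> real" where
  "L2_inner M f g = (LINT t|M. f t \<bullet> g t)"

lemma square_integrable_measurable [measurable_dest]:
  "square_integrable M f \<Longrightarrow> f \<in> borel_measurable M"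
  by (simp add: square_integrable_def)

lemma integrable_L2_norm_mult:
  assumes f: "square_integrable M f" and g: "square_integrable M g"
  shows "integrable M (\<lambda>t. norm (f t) * norm (g t))"
proof (rule Bochner_Integration.integrable_bound)
  show "integrable M (\<lambda>t. (norm (f t))\<^sup>2 + (norm (g t))\<^sup>2)"
    using f g by (simp add: square_integrable_def)
  show "(\<lambda>t. norm (f t) * norm (g t)) \<in> borel_measurable M"
    using square_integrable_measurable[OF f] square_integrable_measurable[OF g] by measurable
  have "norm (norm (f t) * norm (g t)) \<le> norm ((norm (f t))\<^sup>2 + (norm (g t))\<^sup>2)" for t
  proof -
    have "2 * (norm (f t) * norm (g t)) \<le> (norm (f t))\<^sup>2 + (norm (g t))\<^sup>2"
      using sum_squares_bound[of "norm (f t)" "norm (g t)"] by simp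
    moreover have "0 \<le> norm (f t) * norm (g t)" by simp
    ultimately have "norm (f t) * norm (g t) \<le> (norm (f t))\<^sup>2 + (norm (g t))\<^sup>2" by linarith
    then show ?thesis by simp
  qed
  then show "AE t in M. norm (norm (f t) * norm (g t)) \<le> norm ((norm (f t))\<^sup>2 + (norm (g t))\<^sup>2)" by simp
qed

lemma integrable_L2_inner:
  assumes f: "square_integrable M f" and g: "square_integrable M g"
  shows "integrable M (\<lambda>t. f t \<bullet> g t)"
proof (rule Bochner_Integration.integrable_bound[OF integrable_L2_norm_mult[OF f g]])
  show "(\<lambda>t. f t \<bullet> g t) \<in> borel_measurable M"
    using square_integrable_measurable[OF f] square_integrable_measurable[OF g] by measurable
qed (simp add: Cauchy_Schwarz_ineq2)

lemma square_integrable_add: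
  assumes f: "square_integrable M f" and g: "square_integrable M g"
  shows "square_integrable M (\<lambda>t. f t + g t)"
  unfolding square_integrable_def
proof
  show "(\<lambda>t. f t + g t) \<in> borel_measurable M"
    using square_integrable_measurable[OF f] square_integrable_measurable[OF g] by measurable
  have "integrable M (\<lambda>t. f t \<bullet> f t + 2 * (f t \<bullet> g t) + g t \<bullet> g t)"
    by (intro Bochner_Integration.integrable_add integrable_mult_right integrable_L2_inner f g)
  then show "integrable M (\<lambda>t. (norm (f t + g t))\<^sup>2)"
    by (simp add: power2_norm_eq_inner inner_add_left inner_add_right inner_commute algebra_simps)
qed

lemma square_integrable_scaleR:
  assumes f: "square_integrable M f" shows "square_integrable M (\<lambda>t. c *\<^sub>R f t)"
  using f by (auto simp: square_integrable_def power_mult_distrib)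

lemma square_integrable_diff:
  assumes f: "square_integrable M f" and g: "square_integrable M g"
  shows "square_integrable M (\<lambda>t. f t - g t)"
  using square_integrable_add[OF f square_integrable_scaleR[OF g, of "-1"]] by simp

lemma square_integrable_sum:
  "(\<And>i. i \<in> I \<Longrightarrow> square_integrable M (f i)) \<Longrightarrow> square_integrable M (\<lambda>t. \<Sum>i\<in>I. f i t)"
proof (induction I rule: infinite_finite_induct)
  case (insert i I)
  then show ?case by (auto intro!: square_integrable_add)
qed (auto simp: square_integrable_def)

lemma L2_inner_commute: "L2_inner M f g = L2_inner M g f"
  by (simp add: L2_inner_def inner_commute)

lemma L2_inner_add_left:
  "square_integrable M f \<Longrightarrow> square_integrable M g \<Longrightarrow> square_integrable M h \<Longrightarrow>
    L2_inner M (\<lambda>t. f t + g t) h = L2_inner M f h + L2_inner M g h"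
  by (simp add: L2_inner_def inner_add_left integrable_L2_inner)

lemma L2_inner_diff_left:
  "square_integrable M f \<Longrightarrow> square_integrable M g \<Longrightarrow> square_integrable M h \<Longrightarrow>
    L2_inner M (\<lambda>t. f t - g t) h = L2_inner M f h - L2_inner M g h"
  by (simp add: L2_inner_def inner_diff_left integrable_L2_inner)

lemma L2_inner_scaleR_left: "L2_inner M (\<lambda>t. c *\<^sub>R f t) g = c * L2_inner M f g"
  by (simp add: L2_inner_def)

lemma L2_inner_sum_left:
  "(\<And>i. i \<in> I \<Longrightarrow> square_integrable M (f i)) \<Longrightarrow> square_integrable M g \<Longrightarrow>
    L2_inner M (\<lambda>t. \<Sum>i\<in>I. f i t) g = (\<Sum>i\<in>I. L2_inner M (f i) g)"
  by (simp add: L2_inner_def inner_sum_left integrable_L2_inner)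

lemma L2_inner_self_nonneg: "0 \<le> L2_inner M f f"
  by (simp add: L2_inner_def integral_nonneg)

lemma L2_inner_self_eq_0_iff:
  "square_integrable M f \<Longrightarrow> L2_inner M f f = 0 \<longleftrightarrow> (AE t in M. f t = 0)"
  unfolding L2_inner_def
  by (subst integral_nonneg_eq_0_iff_AE) (auto simp: integrable_L2_inner)

lemma L2_inner_cong_AE:
  assumes "square_integrable M f" "square_integrable M f'" "AE t in M. f t = f' t"
  shows "L2_inner M f f = L2_inner M f' f'"
  unfolding L2_inner_def
  using assms by (intro integral_cong_AE) (auto dest!: square_integrable_measurable)

text \<open>The vectors \<open>v\<close> may be linearly dependent; a vector that depends on its predecessors contributes
  the zero function.\<close>

fun gram_schmidt :: "'a measure \<Rightarrow> (nat \<Rightarrow> 'a \<Rightarrow> 'b::euclidean_space) \<Rightarrow> nat \<Rightarrow> 'a \<Rightarrow> 'b" where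
  "gram_schmidt M v n =
     (let r = (\<lambda>t. v n t - (\<Sum>k<n. L2_inner M (v n) (gram_schmidt M v k) *\<^sub>R gram_schmidt M v k t))
      in if L2_inner M r r = 0 then (\<lambda>_. 0) else (\<lambda>t. r t /\<^sub>R sqrt (L2_inner M r r)))"

declare gram_schmidt.simps [simp del]

definition orthogonal_residual ::
    "'a measure \<Rightarrow> (nat \<Rightarrow> 'a \<Rightarrow> 'b::euclidean_space) \<Rightarrow> nat \<Rightarrow> ('a \<Rightarrow> 'b) \<Rightarrow> 'a \<Rightarrow> 'b" where
  "orthogonal_residual M e N g = (\<lambda>t. g t - (\<Sum>k<N. L2_inner M g (e k) *\<^sub>R e k t))"

lemma gram_schmidt_eq:
  fixes M v n
  defines "r \<equiv> orthogonal_residual M (gram_schmidt M v) n (v n)"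
  shows "gram_schmidt M v n = (if L2_inner M r r = 0 then (\<lambda>_. 0) else (\<lambda>t. r t /\<^sub>R sqrt (L2_inner M r r)))"
  unfolding r_def orthogonal_residual_def by (subst gram_schmidt.simps) (simp add: Let_def)

text \<open>A finite family that is orthonormal, except that some vectors may be zero: zero vectors change
  neither projections nor sums of squared coefficients.\<close>

locale orthonormal_or_zero =
  fixes M :: "'a measure" and e :: "nat \<Rightarrow> 'a \<Rightarrow> 'b::euclidean_space" and N :: nat
  assumes square_integrable_e: "\<And>k. k < N \<Longrightarrow> square_integrable M (e k)"
    and orthogonal: "\<And>j k. j < N \<Longrightarrow> k < N \<Longrightarrow> j \<noteq> k \<Longrightarrow> L2_inner M (e j) (e k) = 0"
    and unit_or_zero: "\<And>k. k < N \<Longrightarrow> L2_inner M (e k) (e k) = 1 \<or> e k = (\<lambda>_. 0)"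
begin

abbreviation "res \<equiv> orthogonal_residual M e N"

lemma square_integrable_residual:
  "square_integrable M g \<Longrightarrow> square_integrable M (res g)"
  unfolding orthogonal_residual_def
  by (intro square_integrable_diff square_integrable_sum square_integrable_scaleR square_integrable_e) auto

lemma inner_self_absorb:
  "k < N \<Longrightarrow> L2_inner M g (e k) * L2_inner M (e k) (e k) = L2_inner M g (e k)"
  using unit_or_zero[of k] by (auto simp: L2_inner_def)

lemma L2_inner_residual_left:
  assumes g: "square_integrable M g" and h: "square_integrable M h"
  shows "L2_inner M (res g) h = L2_inner M g h - (\<Sum>k<N. L2_inner M g (e k) * L2_inner M (e k) h)"
proof -
  have s: "square_integrable M (\<lambda>t. L2_inner M g (e k) *\<^sub>R e k t)" if "k \<in> {..<N}" for k
    using that by (intro square_integrable_scaleR square_integrable_e) auto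
  show ?thesis
    unfolding orthogonal_residual_def
    by (subst L2_inner_diff_left[OF g square_integrable_sum[OF s] h], assumption,
        subst L2_inner_sum_left[OF s h]) (auto simp: L2_inner_scaleR_left)
qed

lemma residual_orthogonal:
  assumes g: "square_integrable M g" and k: "k < N"
  shows "L2_inner M (res g) (e k) = 0"
proof -
  have "(\<Sum>j<N. L2_inner M g (e j) * L2_inner M (e j) (e k))
      = (\<Sum>j<N. if j = k then L2_inner M g (e k) else 0)"
    using k orthogonal inner_self_absorb by (intro sum.cong) auto
  also have "\<dots> = L2_inner M g (e k)" using k by simp
  finally show ?thesis using L2_inner_residual_left[OF g square_integrable_e[OF k]] by simp
qed

lemma residual_inner_self:
  assumes g: "square_integrable M g"
  shows "L2_inner M (res g) g = L2_inner M g g - (\<Sum>k<N. (L2_inner M g (e k))\<^sup>2)"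
  using L2_inner_residual_left[OF g g] by (simp add: power2_eq_square L2_inner_commute[of M "e _" g])

lemma residual_norm:
  assumes g: "square_integrable M g"
  shows "L2_inner M (res g) (res g) = L2_inner M g g - (\<Sum>k<N. (L2_inner M g (e k))\<^sup>2)"
proof -
  note r = square_integrable_residual[OF g]
  have "L2_inner M (res g) (res g) = L2_inner M g (res g) - (\<Sum>k<N. L2_inner M g (e k) * L2_inner M (e k) (res g))"
    by (rule L2_inner_residual_left[OF g r])
  also have "(\<Sum>k<N. L2_inner M g (e k) * L2_inner M (e k) (res g)) = 0"
    using residual_orthogonal[OF g] by (intro sum.neutral) (auto simp: L2_inner_commute[of M "e _" "res g"])
  finally show ?thesis using residual_inner_self[OF g] by (simp add: L2_inner_commute)
qed

lemma bessel:
  assumes g: "square_integrable M g"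
  shows "(\<Sum>k<N. (L2_inner M g (e k))\<^sup>2) \<le> L2_inner M g g"
  using residual_norm[OF g] L2_inner_self_nonneg[of M "res g"] by simp

lemma residual_diff:
  assumes g: "square_integrable M g" and h: "square_integrable M h"
  shows "res (\<lambda>t. g t - h t) = (\<lambda>t. res g t - res h t)"
  unfolding orthogonal_residual_def using g h
  by (auto simp: fun_eq_iff L2_inner_diff_left square_integrable_e algebra_simps sum_subtractf)

lemma residual_scaleR:
  "res (\<lambda>t. c *\<^sub>R g t) = (\<lambda>t. c *\<^sub>R res g t)"
  unfolding orthogonal_residual_def
  by (simp add: L2_inner_scaleR_left scaleR_diff_right scaleR_sum_right)

lemma residual_sum:
  assumes "\<And>i. i \<in> I \<Longrightarrow> square_integrable M (g i)"
  shows "res (\<lambda>t. \<Sum>i\<in>I. g i t) = (\<lambda>t. \<Sum>i\<in>I. res (g i) t)"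
proof
  fix t
  have "(\<Sum>k<N. L2_inner M (\<lambda>t. \<Sum>i\<in>I. g i t) (e k) *\<^sub>R e k t)
      = (\<Sum>k<N. \<Sum>i\<in>I. L2_inner M (g i) (e k) *\<^sub>R e k t)"
    using assms by (intro sum.cong) (auto simp: L2_inner_sum_left square_integrable_e scaleR_sum_left)
  also have "\<dots> = (\<Sum>i\<in>I. \<Sum>k<N. L2_inner M (g i) (e k) *\<^sub>R e k t)" by (rule sum.swap)
  finally show "res (\<lambda>t. \<Sum>i\<in>I. g i t) t = (\<Sum>i\<in>I. res (g i) t)"
    by (simp add: orthogonal_residual_def sum_subtractf)
qed

text \<open>The reason why approximation rates become decay rates of coefficients. If \<open>u\<close> is in the span of
  the \<open>v k\<close>, then \<open>g\<close> and \<open>g - u\<close> have the same residual almost everywhere, so that the norm of the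
  residual of \<open>g\<close>, which is the defect in Bessel's inequality, is at most the norm of \<open>g - u\<close>.\<close>

lemma best_approximation:
  fixes a :: "nat \<Rightarrow> real"
  assumes v: "\<And>k. k < N \<Longrightarrow> square_integrable M (v k)"
    and null: "\<And>k. k < N \<Longrightarrow> AE t in M. res (v k) t = 0"
    and g: "square_integrable M g"
    and u_def: "u = (\<lambda>t. \<Sum>k<N. a k *\<^sub>R v k t)"
  shows "L2_inner M g g - (\<Sum>k<N. (L2_inner M g (e k))\<^sup>2) \<le> L2_inner M (\<lambda>t. g t - u t) (\<lambda>t. g t - u t)"
proof -
  have u: "square_integrable M u"
    unfolding u_def by (intro square_integrable_sum square_integrable_scaleR v) auto
  note gu = square_integrable_diff[OF g u]
  have "res u = (\<lambda>t. \<Sum>k<N. a k *\<^sub>R res (v k) t)"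
    unfolding u_def using v by (subst residual_sum) (auto simp: residual_scaleR square_integrable_scaleR)
  moreover have "AE t in M. \<forall>k\<in>{..<N}. res (v k) t = 0"
    using null by (intro AE_finite_allI) auto
  ultimately have "AE t in M. res u t = 0" by auto
  then have "AE t in M. res g t = res (\<lambda>t. g t - u t) t"
    by (simp add: residual_diff[OF g u])
  then have "L2_inner M (res g) (res g) = L2_inner M (res (\<lambda>t. g t - u t)) (res (\<lambda>t. g t - u t))"
    by (intro L2_inner_cong_AE square_integrable_residual g gu)
  also have "\<dots> \<le> L2_inner M (\<lambda>t. g t - u t) (\<lambda>t. g t - u t)"
    using residual_norm[OF gu] by (simp add: sum_nonneg)
  finally show ?thesis by (simp add: residual_norm[OF g])
qed

end

lemma orthonormal_or_zero_gram_schmidt: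
  assumes v: "\<And>k. square_integrable M (v k)"
  shows "orthonormal_or_zero M (gram_schmidt M v) N"
proof (induction N)
  case 0
  show ?case by unfold_locales auto
next
  case (Suc N)
  interpret orthonormal_or_zero M "gram_schmidt M v" N by fact
  let ?r = "res (v N)" and ?e = "gram_schmidt M v"
  have r: "square_integrable M ?r" by (rule square_integrable_residual[OF v])
  have eN: "?e N = (if L2_inner M ?r ?r = 0 then (\<lambda>_. 0) else (\<lambda>t. ?r t /\<^sub>R sqrt (L2_inner M ?r ?r)))"
    by (rule gram_schmidt_eq)
  have si: "square_integrable M (?e N)"
  proof (cases "L2_inner M ?r ?r = 0")
    case True
    then show ?thesis by (simp add: eN square_integrable_def)
  next
    case False
    then show ?thesis using square_integrable_scaleR[OF r] by (simp add: eN)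
  qed
  have orth: "L2_inner M (?e N) (?e k) = 0" if "k < N" for k
    unfolding eN using residual_orthogonal[OF v that] by (auto simp: L2_inner_scaleR_left) (simp add: L2_inner_def)
  have orth': "L2_inner M (?e k) (?e N) = 0" if "k < N" for k
    using orth[OF that] by (simp only: L2_inner_commute)
  have unit: "L2_inner M (?e N) (?e N) = 1 \<or> ?e N = (\<lambda>_. 0)"
  proof (cases "L2_inner M ?r ?r = 0")
    case False
    then have "L2_inner M (?e N) (?e N) = inverse (sqrt (L2_inner M ?r ?r)) * (inverse (sqrt (L2_inner M ?r ?r)) * L2_inner M ?r ?r)"
      unfolding eN by (simp add: L2_inner_def)
    also have "\<dots> = 1" using False L2_inner_self_nonneg[of M ?r] by (simp add: field_simps)
    finally show ?thesis by simp
  qed (simp add: eN)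
  show ?case
    using square_integrable_e orthogonal unit_or_zero si orth unit orth'
    by unfold_locales (auto simp: less_Suc_eq)
qed

text \<open>After step \<open>k\<close> the vector \<open>v k\<close> is exhausted by the system: the new vector takes up exactly
  the norm of the residual that the earlier ones left.\<close>

lemma gram_schmidt_residual_null:
  assumes v: "\<And>k. square_integrable M (v k)" and k: "k < N"
  shows "AE t in M. orthogonal_residual M (gram_schmidt M v) N (v k) t = 0"
proof -
  let ?e = "gram_schmidt M v"
  interpret k: orthonormal_or_zero M ?e k by (rule orthonormal_or_zero_gram_schmidt[OF v])
  interpret N: orthonormal_or_zero M ?e N by (rule orthonormal_or_zero_gram_schmidt[OF v])
  let ?r = "k.res (v k)"
  have r: "square_integrable M ?r" by (rule k.square_integrable_residual[OF v])
  have eq: "?e k = (if L2_inner M ?r ?r = 0 then (\<lambda>_. 0) else (\<lambda>t. ?r t /\<^sub>R sqrt (L2_inner M ?r ?r)))"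
    by (rule gram_schmidt_eq)
  have vr: "L2_inner M (v k) ?r = L2_inner M ?r ?r"
    using k.residual_norm[OF v, of k] k.residual_inner_self[OF v, of k] by (simp add: L2_inner_commute[of M "v k" ?r])
  have "(L2_inner M (v k) (?e k))\<^sup>2 = L2_inner M ?r ?r"
  proof (cases "L2_inner M ?r ?r = 0")
    case True then show ?thesis by (simp add: eq L2_inner_def)
  next
    case False
    then have "L2_inner M (v k) (?e k) = L2_inner M ?r ?r / sqrt (L2_inner M ?r ?r)"
      unfolding L2_inner_commute[of M "v k" "?e k"]
      by (simp add: eq L2_inner_scaleR_left L2_inner_commute[of M ?r "v k"] vr divide_inverse)
    then show ?thesis using False L2_inner_self_nonneg[of M ?r] by (simp add: power_divide power2_eq_square)
  qed
  then have 0: "L2_inner M (v k) (v k) - (\<Sum>j<Suc k. (L2_inner M (v k) (?e j))\<^sup>2) = 0"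
    using k.residual_norm[OF v, of k] by simp
  have "L2_inner M (N.res (v k)) (N.res (v k)) = L2_inner M (v k) (v k) - (\<Sum>j<N. (L2_inner M (v k) (?e j))\<^sup>2)"
    by (rule N.residual_norm[OF v])
  also have "\<dots> \<le> L2_inner M (v k) (v k) - (\<Sum>j<Suc k. (L2_inner M (v k) (?e j))\<^sup>2)"
    using k by (intro diff_left_mono sum_mono2) auto
  finally have "L2_inner M (N.res (v k)) (N.res (v k)) = 0"
    using 0 L2_inner_self_nonneg[of M "N.res (v k)"] by linarith
  then show ?thesis
    using L2_inner_self_eq_0_iff[OF N.square_integrable_residual[OF v]] by blast
qed

lemma adapted_orthonormal_system:
  fixes v :: "nat \<Rightarrow> 'a \<Rightarrow> 'b::euclidean_space"
  assumes v: "\<And>k. square_integrable M (v k)"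
  obtains e :: "nat \<Rightarrow> 'a \<Rightarrow> 'b"
  where "\<And>n. square_integrable M (e n)"
    and "\<And>g N. square_integrable M g \<Longrightarrow> (\<Sum>n<N. (L2_inner M g (e n))\<^sup>2) \<le> L2_inner M g g"
    and "\<And>g N a. square_integrable M g \<Longrightarrow>
      L2_inner M g g - (\<Sum>n<N. (L2_inner M g (e n))\<^sup>2)
      \<le> L2_inner M (\<lambda>t. g t - (\<Sum>k<N. a k *\<^sub>R v k t)) (\<lambda>t. g t - (\<Sum>k<N. a k *\<^sub>R v k t))"
proof
  note * = orthonormal_or_zero_gram_schmidt[OF v]
  show "square_integrable M (gram_schmidt M v n)" for n
    using orthonormal_or_zero.square_integrable_e[OF *, of n "Suc n"] by simp
  show "\<And>g N. square_integrable M g \<Longrightarrow> (\<Sum>n<N. (L2_inner M g (gram_schmidt M v n))\<^sup>2) \<le> L2_inner M g g"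
    by (rule orthonormal_or_zero.bessel[OF *])
  show "\<And>g N a. square_integrable M g \<Longrightarrow>
      L2_inner M g g - (\<Sum>n<N. (L2_inner M g (gram_schmidt M v n))\<^sup>2)
      \<le> L2_inner M (\<lambda>t. g t - (\<Sum>k<N. a k *\<^sub>R v k t)) (\<lambda>t. g t - (\<Sum>k<N. a k *\<^sub>R v k t))"
    by (rule orthonormal_or_zero.best_approximation[OF * v gram_schmidt_residual_null[OF v] _ refl])
qed

section \<open>A sequence that enumerates the piecewise polynomials of all levels\<close>

text \<open>The position \<open>l\<close> stands for the cell with number \<open>l - 4\<^sup>b\<close> of the level \<open>b\<close> with
  \<open>4\<^sup>b \<le> l < 4\<^sup>b\<^sup>+\<^sup>1\<close>. Hence the first \<open>4\<^sup>b\<^sup>+\<^sup>1\<close> positions contain all cells of level \<open>b\<close>.\<close>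

definition level :: "nat \<Rightarrow> nat" where
  "level l = (LEAST b. l < 4 ^ Suc b)"

lemma level_eq:
  assumes "4 ^ b \<le> l" "l < 4 ^ Suc b" shows "level l = b"
  unfolding level_def
proof (rule Least_equality[where P = "\<lambda>b. l < 4 ^ Suc b"])
  fix c assume "l < 4 ^ Suc c"
  then have "(4::nat) ^ b < 4 ^ Suc c" using assms(1) by linarith
  then have "b < Suc c" using power_less_imp_less_exp[of "4::nat" b "Suc c"] by (simp del: power_Suc)
  then show "b \<le> c" by simp
qed fact

definition atom :: "nat \<Rightarrow> nat \<Rightarrow> 'b::real_vector \<Rightarrow> real \<Rightarrow> 'b" where
  "atom l q \<beta> t =
     (let b = level l; s = real (l - 4 ^ b) / 2 ^ b
      in (indicator {s..<s + 1 / 2 ^ b} t * (t - s) ^ q) *\<^sub>R \<beta>)"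

lemma square_integrable_atom:
  fixes \<beta> :: "'b::euclidean_space"
  shows "square_integrable lborel (atom l q \<beta>)"
  unfolding square_integrable_def
proof
  define b where "b = level l"
  define s where "s = real (l - 4 ^ b) / 2 ^ b"
  have eq: "atom l q \<beta> = (\<lambda>t. (indicator {s..<s + 1 / 2 ^ b} t * (t - s) ^ q) *\<^sub>R \<beta>)"
    by (simp add: fun_eq_iff atom_def b_def[symmetric] s_def Let_def)
  show meas: "atom l q \<beta> \<in> borel_measurable lborel" unfolding eq by measurable
  show "integrable lborel (\<lambda>t. (norm (atom l q \<beta> t))\<^sup>2)"
  proof (rule Bochner_Integration.integrable_bound)
    show "integrable lborel (\<lambda>t. indicator {s..s + 1} t * (norm \<beta>)\<^sup>2)"
      by (intro integrable_mult_left integrable_real_indicator) auto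
    show "(\<lambda>t. (norm (atom l q \<beta> t))\<^sup>2) \<in> borel_measurable lborel" using meas by measurable
    have "norm (atom l q \<beta> t) \<le> indicator {s..s + 1} t * norm \<beta>" for t
    proof (cases "t \<in> {s..<s + 1 / 2 ^ b}")
      case True
      have "(1::real) / 2 ^ b \<le> 1" by simp
      moreover have "s \<le> t" "t < s + 1 / 2 ^ b" using True by auto
      ultimately have st: "s \<le> t" "t \<le> s + 1" by linarith+
      then have "\<bar>t - s\<bar> ^ q \<le> 1" "t \<in> {s..s + 1}" by (auto intro!: power_le_one)
      then show ?thesis using True by (auto simp: eq power_abs intro!: mult_left_le_one_le)
    qed (simp add: eq)
    then have "(norm (atom l q \<beta> t))\<^sup>2 \<le> (indicator {s..s + 1} t * norm \<beta>)\<^sup>2" for t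
      by (intro power_mono) auto
    moreover have "(indicator {s..s + 1} t * norm \<beta>)\<^sup>2 = indicator {s..s + 1} t * (norm \<beta>)\<^sup>2" for t
      by (simp add: indicator_def)
    ultimately show "AE t in lborel. norm ((norm (atom l q \<beta> t))\<^sup>2) \<le> norm (indicator {s..s + 1} t * (norm \<beta>)\<^sup>2)"
      by simp
  qed
qed

text \<open>At each time all cells of level \<open>b\<close> but one contribute zero, and on that cell the polynomial is
  written in the basis of the range.\<close>

lemma pw_poly_eq_atoms:
  fixes y :: "nat \<Rightarrow> nat \<Rightarrow> 'b::euclidean_space"
  shows "pw_poly m b y t =
    (\<Sum>l\<in>{4 ^ b..<4 ^ Suc b}. \<Sum>(q, \<beta>)\<in>{..<m} \<times> Basis. (y (l - 4 ^ b) q \<bullet> \<beta>) *\<^sub>R atom l q \<beta> t)"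
proof -
  define j where "j = nat \<lfloor>t * 2 ^ b\<rfloor>"
  have four: "(4::real) ^ b = 2 ^ b * 2 ^ b" by (simp flip: power_mult_distrib)
  (* Cells are closed on the left only, so that t belongs to the cell with the number floor (t * 2^b). *)
  have cell: "t \<in> {real i / 2 ^ b..<real i / 2 ^ b + 1 / 2 ^ b} \<longleftrightarrow> 0 \<le> t \<and> i = j" for i
  proof -
    have "t \<in> {real i / 2 ^ b..<real i / 2 ^ b + 1 / 2 ^ b} \<longleftrightarrow> real i \<le> t * 2 ^ b \<and> t * 2 ^ b < real i + 1"
      by (auto simp: field_simps simp flip: add_divide_distrib)
    also have "\<dots> \<longleftrightarrow> \<lfloor>t * 2 ^ b\<rfloor> = int i" by (simp add: floor_eq_iff)
    also have "\<dots> \<longleftrightarrow> 0 \<le> t \<and> i = j"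
    proof
      assume *: "\<lfloor>t * 2 ^ b\<rfloor> = int i"
      then have "0 \<le> t * 2 ^ b" by (metis of_nat_0_le_iff zero_le_floor)
      then have "0 \<le> t" using mult_neg_pos[of t "2 ^ b"] by force
      then show "0 \<le> t \<and> i = j" using * by (simp add: j_def)
    qed (simp add: j_def)
    finally show ?thesis .
  qed
  have atom: "atom l q \<beta> t = (if 0 \<le> t \<and> l = 4 ^ b + j then (t - real j / 2 ^ b) ^ q *\<^sub>R \<beta> else 0)"
    if "l \<in> {4 ^ b..<4 ^ Suc b}" for l q and \<beta> :: 'b
  proof -
    have "level l = b" using that by (intro level_eq) auto
    moreover have "l - 4 ^ b = j \<longleftrightarrow> l = 4 ^ b + j" using that by auto
    ultimately show ?thesis using cell[of "l - 4 ^ b"]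
      by (auto simp: atom_def Let_def)
  qed
  have poly: "(\<Sum>(q, \<beta>)\<in>{..<m} \<times> Basis. (z q \<bullet> \<beta>) *\<^sub>R (c q *\<^sub>R \<beta>)) = (\<Sum>q<m. c q *\<^sub>R z q)"
    for z :: "nat \<Rightarrow> 'b" and c :: "nat \<Rightarrow> real"
  proof -
    have "(\<Sum>\<beta>\<in>Basis. (z q \<bullet> \<beta>) *\<^sub>R (c q *\<^sub>R \<beta>)) = c q *\<^sub>R z q" for q
    proof -
      have "(\<Sum>\<beta>\<in>Basis. (z q \<bullet> \<beta>) *\<^sub>R (c q *\<^sub>R \<beta>)) = c q *\<^sub>R (\<Sum>\<beta>\<in>Basis. (z q \<bullet> \<beta>) *\<^sub>R \<beta>)"
        by (simp add: scaleR_sum_right mult.commute)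
      then show ?thesis by (simp add: euclidean_representation)
    qed
    then show ?thesis by (simp add: sum.cartesian_product[symmetric])
  qed
  have inside: "0 \<le> t \<and> 4 ^ b + j < 4 ^ Suc b \<longleftrightarrow> 0 \<le> t \<and> t < 3 * 2 ^ b"
  proof (cases "0 \<le> t")
    case True
    have "4 ^ b + j < 4 ^ Suc b \<longleftrightarrow> j < 3 * 4 ^ b" by auto
    also have "\<dots> \<longleftrightarrow> \<lfloor>t * 2 ^ b\<rfloor> < int (3 * 4 ^ b)" using True by (auto simp: j_def nat_less_iff)
    also have "\<dots> \<longleftrightarrow> t * 2 ^ b < 3 * 4 ^ b" by (simp add: floor_less_iff)
    also have "\<dots> \<longleftrightarrow> t < 3 * 2 ^ b" by (simp add: four)
    finally show ?thesis using True by simp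
  qed simp
  have "(\<Sum>l\<in>{4 ^ b..<4 ^ Suc b}. \<Sum>(q, \<beta>)\<in>{..<m} \<times> Basis. (y (l - 4 ^ b) q \<bullet> \<beta>) *\<^sub>R atom l q \<beta> t)
    = (\<Sum>l\<in>{4 ^ b..<4 ^ Suc b}. if l = 4 ^ b + j then
         (if 0 \<le> t then \<Sum>(q, \<beta>)\<in>{..<m} \<times> Basis. (y j q \<bullet> \<beta>) *\<^sub>R ((t - real j / 2 ^ b) ^ q *\<^sub>R \<beta>) else 0) else 0)"
    by (intro sum.cong refl) (auto simp: atom intro!: sum.neutral)
  also have "\<dots> = (if 0 \<le> t \<and> 4 ^ b + j < 4 ^ Suc b
      then \<Sum>(q, \<beta>)\<in>{..<m} \<times> Basis. (y j q \<bullet> \<beta>) *\<^sub>R ((t - real j / 2 ^ b) ^ q *\<^sub>R \<beta>) else 0)"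
    by (subst sum.delta) auto
  also have "\<dots> = pw_poly m b y t"
    unfolding inside poly by (simp only: pw_poly_def j_def)
  finally show ?thesis ..
qed

text \<open>Every position \<open>l\<close> carries a block of \<open>K\<close> vectors, one for each power less than \<open>m\<close> and each
  basis vector. Atoms of lower levels in the initial segment get the coefficient zero.\<close>

lemma pw_poly_sequence:
  assumes m: "0 < m"
  obtains v :: "nat \<Rightarrow> real \<Rightarrow> 'b::euclidean_space" and K :: nat
  where "0 < K" "\<And>k. square_integrable lborel (v k)"
    "\<And>b y. \<exists>a. \<forall>t. pw_poly m b y t = (\<Sum>k<K * 4 ^ Suc b. a k *\<^sub>R v k t)"
proof -
  let ?J = "{..<m} \<times> (Basis :: 'b set)"
  define K where "K = card ?J"
  have K: "0 < K" unfolding K_def using m by (auto simp: card_gt_0_iff)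
  obtain h where h: "bij_betw h {0..<K} ?J"
    unfolding K_def using ex_bij_betw_nat_finite[of ?J] by auto
  define v where "v k = (case h (k mod K) of (q, \<beta>) \<Rightarrow> atom (k div K) q \<beta>)" for k
  show ?thesis
  proof
    show "square_integrable lborel (v k)" for k
      by (simp add: v_def square_integrable_atom split: prod.split)
    fix b and y :: "nat \<Rightarrow> nat \<Rightarrow> 'b"
    define a where "a k = (if 4 ^ b \<le> k div K
        then (case h (k mod K) of (q, \<beta>) \<Rightarrow> y (k div K - 4 ^ b) q \<bullet> \<beta>) else 0)" for k
    have "pw_poly m b y t = (\<Sum>k<K * 4 ^ Suc b. a k *\<^sub>R v k t)" for t
    proof -
      have "(\<Sum>k<K * 4 ^ Suc b. a k *\<^sub>R v k t) = (\<Sum>l<4 ^ Suc b. \<Sum>k\<in>{l * K..<l * K + K}. a k *\<^sub>R v k t)"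
        by (subst sum.nat_group) (simp add: mult.commute)
      also have "\<dots> = (\<Sum>l<4 ^ Suc b. \<Sum>r\<in>{0..<K}. a (r + l * K) *\<^sub>R v (r + l * K) t)"
      proof (rule sum.cong[OF refl])
        fix l show "(\<Sum>k\<in>{l * K..<l * K + K}. a k *\<^sub>R v k t) = (\<Sum>r\<in>{0..<K}. a (r + l * K) *\<^sub>R v (r + l * K) t)"
          using sum.shift_bounds_nat_ivl[of "\<lambda>k. a k *\<^sub>R v k t" 0 "l * K" K] by (simp add: add.commute)
      qed
      also have "\<dots> = (\<Sum>l<4 ^ Suc b. if 4 ^ b \<le> l then
          (\<Sum>r\<in>{0..<K}. case h r of (q, \<beta>) \<Rightarrow> (y (l - 4 ^ b) q \<bullet> \<beta>) *\<^sub>R atom l q \<beta> t) else 0)"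
      proof (rule sum.cong[OF refl])
        fix l
        have "a (r + l * K) *\<^sub>R v (r + l * K) t = (if 4 ^ b \<le> l then
            (case h r of (q, \<beta>) \<Rightarrow> (y (l - 4 ^ b) q \<bullet> \<beta>) *\<^sub>R atom l q \<beta> t) else 0)" if "r < K" for r
          using that by (simp add: a_def v_def split: prod.split)
        then show "(\<Sum>r\<in>{0..<K}. a (r + l * K) *\<^sub>R v (r + l * K) t) = (if 4 ^ b \<le> l then
          (\<Sum>r\<in>{0..<K}. case h r of (q, \<beta>) \<Rightarrow> (y (l - 4 ^ b) q \<bullet> \<beta>) *\<^sub>R atom l q \<beta> t) else 0)"
          by simp
      qed
      also have "\<dots> = (\<Sum>l<4 ^ Suc b. if 4 ^ b \<le> l then
          (\<Sum>(q, \<beta>)\<in>?J. (y (l - 4 ^ b) q \<bullet> \<beta>) *\<^sub>R atom l q \<beta> t) else 0)"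
      proof (rule sum.cong[OF refl], rule if_cong[OF refl _ refl])
        fix l
        show "(\<Sum>r\<in>{0..<K}. case h r of (q, \<beta>) \<Rightarrow> (y (l - 4 ^ b) q \<bullet> \<beta>) *\<^sub>R atom l q \<beta> t)
          = (\<Sum>(q, \<beta>)\<in>?J. (y (l - 4 ^ b) q \<bullet> \<beta>) *\<^sub>R atom l q \<beta> t)"
          by (rule sum.reindex_bij_betw[OF h])
      qed
      also have "\<dots> = (\<Sum>l\<in>{4 ^ b..<4 ^ Suc b}. \<Sum>(q, \<beta>)\<in>?J. (y (l - 4 ^ b) q \<bullet> \<beta>) *\<^sub>R atom l q \<beta> t)"
        by (rule sum.mono_neutral_cong_right) auto
      finally show ?thesis by (simp only: pw_poly_eq_atoms)
    qed
    then show "\<exists>a. \<forall>t. pw_poly m b y t = (\<Sum>k<K * 4 ^ Suc b. a k *\<^sub>R v k t)" by blast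
  qed (rule K)
qed

text \<open>The inequality is about initial segments that contain level \<open>b\<close>; longer segments only decrease
  the defect.\<close>

lemma pw_poly_adapted_system:
  assumes m: "0 < m"
  obtains e :: "nat \<Rightarrow> real \<Rightarrow> 'b::euclidean_space" and K :: nat
  where "0 < K" "\<And>n. square_integrable lborel (e n)"
    and "\<And>g N. square_integrable lborel g \<Longrightarrow> (\<Sum>n<N. (L2_inner lborel g (e n))\<^sup>2) \<le> L2_inner lborel g g"
    and "\<And>g b y N. square_integrable lborel g \<Longrightarrow> K * 4 ^ Suc b \<le> N \<Longrightarrow>
      L2_inner lborel g g - (\<Sum>n<N. (L2_inner lborel g (e n))\<^sup>2)
      \<le> L2_inner lborel (\<lambda>t. g t - pw_poly m b y t) (\<lambda>t. g t - pw_poly m b y t)"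
proof -
  obtain v :: "nat \<Rightarrow> real \<Rightarrow> 'b" and K where K: "0 < K" and v: "\<And>k. square_integrable lborel (v k)"
    and span: "\<And>b y. \<exists>a. \<forall>t. pw_poly m b y t = (\<Sum>k<K * 4 ^ Suc b. a k *\<^sub>R v k t)"
    using pw_poly_sequence[OF m] by metis
  obtain e :: "nat \<Rightarrow> real \<Rightarrow> 'b" where e: "\<And>n. square_integrable lborel (e n)"
    and bessel: "\<And>g N. square_integrable lborel g \<Longrightarrow> (\<Sum>n<N. (L2_inner lborel g (e n))\<^sup>2) \<le> L2_inner lborel g g"
    and best: "\<And>g N a. square_integrable lborel g \<Longrightarrow>
      L2_inner lborel g g - (\<Sum>n<N. (L2_inner lborel g (e n))\<^sup>2)
      \<le> L2_inner lborel (\<lambda>t. g t - (\<Sum>k<N. a k *\<^sub>R v k t)) (\<lambda>t. g t - (\<Sum>k<N. a k *\<^sub>R v k t))"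
    by (rule adapted_orthonormal_system[of lborel v, OF v]) (rule that)
  show ?thesis
  proof (rule that[OF K e bessel])
    fix g :: "real \<Rightarrow> 'b" and b N y assume g: "square_integrable lborel g" and N: "K * 4 ^ Suc b \<le> N"
    obtain a where a: "\<And>t. pw_poly m b y t = (\<Sum>k<K * 4 ^ Suc b. a k *\<^sub>R v k t)" using span[of b y] by blast
    have "L2_inner lborel g g - (\<Sum>n<N. (L2_inner lborel g (e n))\<^sup>2)
      \<le> L2_inner lborel g g - (\<Sum>n<K * 4 ^ Suc b. (L2_inner lborel g (e n))\<^sup>2)"
      using N by (intro diff_left_mono sum_mono2) auto
    also have "\<dots> \<le> L2_inner lborel (\<lambda>t. g t - pw_poly m b y t) (\<lambda>t. g t - pw_poly m b y t)"
      unfolding a by (rule best[OF g])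
    finally show "L2_inner lborel g g - (\<Sum>n<N. (L2_inner lborel g (e n))\<^sup>2)
      \<le> L2_inner lborel (\<lambda>t. g t - pw_poly m b y t) (\<lambda>t. g t - pw_poly m b y t)" .
  qed
qed

section \<open>Duality of the weighted spaces\<close>

locale weighted_domain =
  fixes \<Omega> :: "'a::euclidean_space set" and w :: "'a \<Rightarrow> real"
  assumes open_domain: "open \<Omega>" and bounded_domain: "bounded \<Omega>"
    and w_measurable [measurable]: "w \<in> borel_measurable (lebesgue_on \<Omega>)"
    and w_nonneg: "\<And>x. x \<in> \<Omega> \<Longrightarrow> 0 \<le> w x"
    and w_pos: "AE x in lebesgue_on \<Omega>. 0 < w x"
begin

abbreviation M where "M \<equiv> lebesgue_on \<Omega>"

lemma domain_sets: "\<Omega> \<in> sets lebesgue"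
  using open_domain by (simp add: borel_open)

lemma space_M [simp]: "space M = \<Omega>"
  using domain_sets by (simp add: space_restrict_space)

lemma finite_measure_M: "finite_measure M"
  using bounded_domain open_domain by (intro finite_measure_lebesgue_on lmeasurable_open)

sublocale finite_measure M by (rule finite_measure_M)

abbreviation L1 where "L1 \<equiv> Lp 1 \<Omega> w"
abbreviation N1 where "N1 \<equiv> Lp_norm 1 \<Omega> w"

lemma L1_iff: "\<rho> \<in> L1 \<longleftrightarrow> \<rho> \<in> borel_measurable M \<and> integrable M (\<lambda>x. \<bar>\<rho> x\<bar> * w x)"
  by (simp add: Lp_def)

lemma L1_measurable [measurable_dest]: "\<rho> \<in> L1 \<Longrightarrow> \<rho> \<in> borel_measurable M"
  by (simp add: Lp_def)

lemma N1_eq: "N1 \<rho> = (LINT x|M. \<bar>\<rho> x\<bar> * w x)"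
proof -
  have "0 \<le> (LINT x|M. \<bar>\<rho> x\<bar> * w x)"
    using w_nonneg by (intro integral_nonneg_AE AE_I2) auto
  then show ?thesis by (simp add: Lp_norm_def)
qed

lemma N1_nonneg: "0 \<le> N1 \<rho>"
  by (simp add: Lp_norm_def)

lemma Linf_iff:
  "\<psi> \<in> Linf \<Omega> w \<longleftrightarrow> \<psi> \<in> borel_measurable M \<and> (\<exists>K\<ge>0. AE x in M. \<bar>\<psi> x * w x\<bar> \<le> K)"
proof safe
  assume \<psi>: "\<psi> \<in> Linf \<Omega> w"
  then show "\<psi> \<in> borel_measurable M" by (simp add: Linf_def)
  let ?E = "esssup M (\<lambda>x. ereal \<bar>\<psi> x * w x\<bar>)"
  have "?E < \<infinity>" using \<psi> by (simp add: Linf_def)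
  then have "?E \<le> ereal (max 0 (real_of_ereal ?E))"
    by (cases ?E) auto
  then have "AE x in M. ereal \<bar>\<psi> x * w x\<bar> \<le> ereal (max 0 (real_of_ereal ?E))"
    using esssup_AE[of "\<lambda>x. ereal \<bar>\<psi> x * w x\<bar>" M] by (auto elim!: eventually_mono order_trans)
  then show "\<exists>K\<ge>0. AE x in M. \<bar>\<psi> x * w x\<bar> \<le> K"
    by (intro exI[of _ "max 0 (real_of_ereal ?E)"]) (simp only: ereal_less_eq max.cobounded1 simp_thms)
next
  fix K assume \<psi> [measurable]: "\<psi> \<in> borel_measurable M" and K: "AE x in M. \<bar>\<psi> x * w x\<bar> \<le> K"
  have "esssup M (\<lambda>x. ereal \<bar>\<psi> x * w x\<bar>) \<le> ereal K"
    using K by (intro esssup_I) auto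
  then show "\<psi> \<in> Linf \<Omega> w"
    using \<psi> by (auto simp: Linf_def elim: order_le_less_trans)
qed

lemma Linf_measurable: "\<psi> \<in> Linf \<Omega> w \<Longrightarrow> \<psi> \<in> borel_measurable M"
  by (simp add: Linf_iff)

lemma pairing_integrand_bound:
  assumes \<rho>: "\<rho> \<in> L1" and \<psi> [measurable]: "\<psi> \<in> borel_measurable M" and K: "AE x in M. \<bar>\<psi> x * w x\<bar> \<le> K"
  shows "integrable M (\<lambda>x. \<rho> x * \<psi> x * (w x)\<^sup>2)"
    and "(LINT x|M. \<bar>\<rho> x * \<psi> x * (w x)\<^sup>2\<bar>) \<le> K * N1 \<rho>"
    and "\<bar>pairing \<Omega> w \<rho> \<psi>\<bar> \<le> K * N1 \<rho>"
proof -
  note [measurable] = L1_measurable[OF \<rho>]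
  have i: "integrable M (\<lambda>x. K * (\<bar>\<rho> x\<bar> * w x))" using \<rho> by (simp add: L1_iff)
  have b: "AE x in M. \<bar>\<rho> x * \<psi> x * (w x)\<^sup>2\<bar> \<le> K * (\<bar>\<rho> x\<bar> * w x)"
    using K AE_space
  proof eventually_elim
    case (elim x)
    have "\<bar>\<rho> x * \<psi> x * (w x)\<^sup>2\<bar> = \<bar>\<psi> x * w x\<bar> * (\<bar>\<rho> x\<bar> * w x)"
      using elim w_nonneg[of x] by (simp add: abs_mult power2_eq_square)
    also have "\<dots> \<le> K * (\<bar>\<rho> x\<bar> * w x)"
      using elim w_nonneg[of x] by (intro mult_right_mono) auto
    finally show ?case .
  qed
  show int: "integrable M (\<lambda>x. \<rho> x * \<psi> x * (w x)\<^sup>2)"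
  proof (rule Bochner_Integration.integrable_bound[OF i])
    show "AE x in M. norm (\<rho> x * \<psi> x * (w x)\<^sup>2) \<le> norm (K * (\<bar>\<rho> x\<bar> * w x))"
      using b by eventually_elim (simp add: order_trans)
  qed measurable
  have "(LINT x|M. \<bar>\<rho> x * \<psi> x * (w x)\<^sup>2\<bar>) \<le> (LINT x|M. K * (\<bar>\<rho> x\<bar> * w x))"
    using int i b by (intro integral_mono_AE) auto
  then show *: "(LINT x|M. \<bar>\<rho> x * \<psi> x * (w x)\<^sup>2\<bar>) \<le> K * N1 \<rho>" by (simp add: N1_eq)
  show "\<bar>pairing \<Omega> w \<rho> \<psi>\<bar> \<le> K * N1 \<rho>"
    unfolding pairing_def using integral_abs_bound[of M] * by (rule order_trans)
qed

lemma pairing_cong_AE: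
  assumes "AE x in M. \<psi> x = \<psi>' x"
    and [measurable]: "\<rho> \<in> borel_measurable M" "\<psi> \<in> borel_measurable M" "\<psi>' \<in> borel_measurable M"
  shows "pairing \<Omega> w \<rho> \<psi> = pairing \<Omega> w \<rho> \<psi>'"
  unfolding pairing_def using assms(1) by (intro integral_cong_AE) auto

lemma L1_lincomb:
  assumes "\<rho> \<in> L1" "\<sigma> \<in> L1"
  shows "(\<lambda>x. a * \<rho> x + b * \<sigma> x) \<in> L1" "N1 (\<lambda>x. a * \<rho> x + b * \<sigma> x) \<le> \<bar>a\<bar> * N1 \<rho> + \<bar>b\<bar> * N1 \<sigma>"
proof -
  note [measurable] = assms[THEN L1_measurable]
  have i: "integrable M (\<lambda>x. \<bar>a\<bar> * (\<bar>\<rho> x\<bar> * w x) + \<bar>b\<bar> * (\<bar>\<sigma> x\<bar> * w x))"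
    using assms by (simp add: L1_iff)
  have b: "\<bar>a * \<rho> x + b * \<sigma> x\<bar> * w x \<le> \<bar>a\<bar> * (\<bar>\<rho> x\<bar> * w x) + \<bar>b\<bar> * (\<bar>\<sigma> x\<bar> * w x)" if "x \<in> \<Omega>" for x
  proof -
    have "\<bar>a * \<rho> x + b * \<sigma> x\<bar> * w x \<le> (\<bar>a\<bar> * \<bar>\<rho> x\<bar> + \<bar>b\<bar> * \<bar>\<sigma> x\<bar>) * w x"
      using w_nonneg[OF that] by (intro mult_right_mono) (auto simp flip: abs_mult)
    then show ?thesis by (simp add: algebra_simps)
  qed
  have int: "integrable M (\<lambda>x. \<bar>a * \<rho> x + b * \<sigma> x\<bar> * w x)"
    by (rule Bochner_Integration.integrable_bound[OF i]) (use b w_nonneg in \<open>auto intro!: AE_I2\<close>)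
  then show "(\<lambda>x. a * \<rho> x + b * \<sigma> x) \<in> L1" by (simp add: L1_iff)
  have "N1 (\<lambda>x. a * \<rho> x + b * \<sigma> x) \<le> (LINT x|M. \<bar>a\<bar> * (\<bar>\<rho> x\<bar> * w x) + \<bar>b\<bar> * (\<bar>\<sigma> x\<bar> * w x))"
    unfolding N1_eq using int i b by (intro integral_mono) auto
  also have "\<dots> = \<bar>a\<bar> * N1 \<rho> + \<bar>b\<bar> * N1 \<sigma>"
    using assms by (simp add: N1_eq L1_iff)
  finally show "N1 (\<lambda>x. a * \<rho> x + b * \<sigma> x) \<le> \<bar>a\<bar> * N1 \<rho> + \<bar>b\<bar> * N1 \<sigma>" .
qed

lemma pairing_lincomb:
  assumes \<rho>: "\<rho> \<in> L1" and \<sigma>: "\<sigma> \<in> L1" and \<psi>: "\<psi> \<in> Linf \<Omega> w"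
  shows "pairing \<Omega> w (\<lambda>x. a * \<rho> x + b * \<sigma> x) \<psi> = a * pairing \<Omega> w \<rho> \<psi> + b * pairing \<Omega> w \<sigma> \<psi>"
proof -
  obtain K where K: "AE x in M. \<bar>\<psi> x * w x\<bar> \<le> K" using \<psi> by (auto simp: Linf_iff)
  note i = pairing_integrand_bound(1)[OF _ Linf_measurable[OF \<psi>] K]
  have "pairing \<Omega> w (\<lambda>x. a * \<rho> x + b * \<sigma> x) \<psi>
      = (LINT x|M. a * (\<rho> x * \<psi> x * (w x)\<^sup>2) + b * (\<sigma> x * \<psi> x * (w x)\<^sup>2))"
    unfolding pairing_def by (intro Bochner_Integration.integral_cong) (auto simp: algebra_simps)
  then show ?thesis using i[OF \<rho>] i[OF \<sigma>] by (simp add: pairing_def)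
qed

text \<open>The density that sees \<open>\<psi>\<close> on \<open>A\<close>: the sign of \<open>\<psi>\<close> makes the pairing an integral of \<open>\<bar>\<psi> w\<bar>\<close>,
  and the division by \<open>w\<close> makes the norm the measure of \<open>A\<close>. The bound \<open>c\<close> keeps the integrals finite.\<close>

lemma sign_test_function:
  assumes \<psi> [measurable]: "\<psi> \<in> borel_measurable M" and A: "A \<in> sets M"
    and supp: "\<And>x. x \<in> A \<Longrightarrow> \<psi> x \<noteq> 0 \<and> 0 < w x \<and> \<bar>\<psi> x * w x\<bar> \<le> c"
  defines "\<eta> \<equiv> (\<lambda>x. indicator A x * sgn (\<psi> x) / w x)"
  shows "\<eta> \<in> L1" "N1 \<eta> = measure M A"
    "integrable M (\<lambda>x. indicator A x * \<bar>\<psi> x * w x\<bar>)"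
    "pairing \<Omega> w \<eta> \<psi> = (LINT x|M. indicator A x * \<bar>\<psi> x * w x\<bar>)"
proof -
  note [measurable] = A
  have \<eta> [measurable]: "\<eta> \<in> borel_measurable M" unfolding \<eta>_def by measurable
  have *: "\<bar>\<eta> x\<bar> * w x = indicator A x" for x
    using supp[of x] by (cases "x \<in> A") (auto simp: \<eta>_def abs_sgn_eq)
  show "\<eta> \<in> L1" unfolding L1_iff * using \<eta> integrable_real_indicator[OF A] by (simp add: emeasure_finite less_top[symmetric])
  show "N1 \<eta> = measure M A" unfolding N1_eq * using A sets.sets_into_space[OF A] by (simp add: Int_absorb2)
  show "integrable M (\<lambda>x. indicator A x * \<bar>\<psi> x * w x\<bar>)"
  proof (rule integrable_const_bound[where B = "\<bar>c\<bar>"])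
    show "AE x in M. norm (indicator A x * \<bar>\<psi> x * w x\<bar>) \<le> \<bar>c\<bar>"
    proof (rule AE_I2)
      fix x show "norm (indicator A x * \<bar>\<psi> x * w x\<bar>) \<le> \<bar>c\<bar>"
        using supp[of x] by (cases "x \<in> A") auto
    qed
  qed measurable
  show "pairing \<Omega> w \<eta> \<psi> = (LINT x|M. indicator A x * \<bar>\<psi> x * w x\<bar>)"
    unfolding pairing_def
  proof (rule Bochner_Integration.integral_cong[OF refl])
    fix x
    show "\<eta> x * \<psi> x * (w x)\<^sup>2 = indicator A x * \<bar>\<psi> x * w x\<bar>"
    proof (cases "x \<in> A")
      case True
      then have "\<eta> x * \<psi> x * (w x)\<^sup>2 = (\<psi> x * sgn (\<psi> x)) * w x"
        using supp[of x] by (simp add: \<eta>_def power2_eq_square)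
      also have "\<dots> = \<bar>\<psi> x * w x\<bar>"
        using supp[OF True] by (simp only: abs_sgn[symmetric] abs_mult) simp
      finally show ?thesis using True by simp
    qed (simp add: \<eta>_def)
  qed
qed

text \<open>Test with the sets on which \<open>\<bar>\<psi> w\<bar>\<close> lies between \<open>K + 1 / (n + 1)\<close> and \<open>n\<close>: the hypothesis
  forces their measure to vanish. The truncation at \<open>n\<close> matters, since \<open>\<psi>\<close> is not assumed to be in the
  dual space; in this way the lemma also proves membership.\<close>

lemma AE_bound_by_duality:
  assumes \<psi> [measurable]: "\<psi> \<in> borel_measurable M" and K: "0 \<le> K"
    and dual: "\<And>\<rho>. \<rho> \<in> L1 \<Longrightarrow> \<bar>pairing \<Omega> w \<rho> \<psi>\<bar> \<le> K * N1 \<rho>"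
  shows "AE x in M. \<bar>\<psi> x * w x\<bar> \<le> K"
proof -
  define A where "A n = {x \<in> space M. 0 < w x \<and> K + 1 / real (Suc n) \<le> \<bar>\<psi> x * w x\<bar> \<and> \<bar>\<psi> x * w x\<bar> \<le> real n}" for n :: nat
  have A [measurable]: "A n \<in> sets M" for n unfolding A_def by measurable
  have null: "AE x in M. x \<notin> A n" for n
  proof -
    let ?\<eta> = "\<lambda>x. indicator (A n) x * sgn (\<psi> x) / w x"
    have pos: "0 < K + 1 / real (Suc n)" using K by (intro add_nonneg_pos) auto
    have supp: "\<psi> x \<noteq> 0 \<and> 0 < w x \<and> \<bar>\<psi> x * w x\<bar> \<le> real n" if "x \<in> A n" for x
      using that pos by (auto simp: A_def)
    note \<eta> = sign_test_function[OF \<psi> A[of n] supp]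
    have "(K + 1 / real (Suc n)) * measure M (A n) = (LINT x|M. indicator (A n) x * (K + 1 / real (Suc n)))"
      using sets.sets_into_space[OF A[of n]] by (simp add: Int_absorb2)
    also have "\<dots> \<le> (LINT x|M. indicator (A n) x * \<bar>\<psi> x * w x\<bar>)"
    proof (rule integral_mono[OF _ \<eta>(3)])
      show "integrable M (\<lambda>x. indicator (A n) x * (K + 1 / real (Suc n)))"
        by (intro integrable_mult_left integrable_real_indicator A) (simp add: emeasure_finite less_top[symmetric])
      show "indicator (A n) x * (K + 1 / real (Suc n)) \<le> indicator (A n) x * \<bar>\<psi> x * w x\<bar>" for x
        by (auto simp: A_def indicator_def)
    qed
    also have "\<dots> \<le> K * measure M (A n)"
    proof -
      have "\<bar>pairing \<Omega> w ?\<eta> \<psi>\<bar> \<le> K * N1 ?\<eta>" by (rule dual[OF \<eta>(1)])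
      moreover have "N1 ?\<eta> = measure M (A n)" by (rule \<eta>(2))
      moreover have "pairing \<Omega> w ?\<eta> \<psi> = (LINT x|M. indicator (A n) x * \<bar>\<psi> x * w x\<bar>)" by (rule \<eta>(4))
      ultimately show ?thesis by simp
    qed
    finally have "measure M (A n) \<le> 0"
      by (simp add: distrib_right mult_le_0_iff divide_le_0_iff)
    then have "measure M (A n) = 0" by (simp add: measure_le_0_iff)
    then have "emeasure M (A n) = 0" by (simp add: emeasure_eq_measure)
    then show ?thesis by (intro AE_not_in) (simp add: null_sets_def)
  qed
  then have "AE x in M. \<forall>n. x \<notin> A n" by (simp add: AE_all_countable)
  then show ?thesis using w_pos AE_space
  proof eventually_elim
    case (elim x)
    show ?case
    proof (rule ccontr)
      assume "\<not> \<bar>\<psi> x * w x\<bar> \<le> K"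
      then obtain i where i: "inverse (real (Suc i)) < \<bar>\<psi> x * w x\<bar> - K"
        using reals_Archimedean[of "\<bar>\<psi> x * w x\<bar> - K"] by auto
      obtain j where j: "\<bar>\<psi> x * w x\<bar> \<le> real j" using real_arch_simple by blast
      (* A larger index weakens both inequalities that define A. *)
      define n where "n = max i j"
      have "1 / real (Suc n) \<le> 1 / real (Suc i)" by (intro divide_left_mono) (auto simp: n_def)
      then have "K + 1 / real (Suc n) \<le> \<bar>\<psi> x * w x\<bar>" using i by (simp add: inverse_eq_divide)
      moreover have "\<bar>\<psi> x * w x\<bar> \<le> real n" using j by (simp add: n_def)
      ultimately have "x \<in> A n" using elim by (simp add: A_def)
      then show False using elim by blast
    qed
  qed
qed

text \<open>The number \<open>\<Lambda>\<close> plays the role of the norm of \<open>\<psi>\<close> up to a factor two. Halving some essential bound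
  until it fails for the first time produces such a number.\<close>

lemma norming_test_function:
  assumes \<psi>: "\<psi> \<in> Linf \<Omega> w" and L: "0 < L" and big: "\<not> (AE x in M. \<bar>\<psi> x * w x\<bar> \<le> L)"
  obtains \<Lambda> \<eta> where "L \<le> \<Lambda>" "AE x in M. \<bar>\<psi> x * w x\<bar> \<le> \<Lambda>" "\<eta> \<in> L1" "N1 \<eta> = 1" "\<Lambda> / 2 \<le> pairing \<Omega> w \<eta> \<psi>"
proof -
  note [measurable] = Linf_measurable[OF \<psi>]
  obtain K where K: "AE x in M. \<bar>\<psi> x * w x\<bar> \<le> K" using \<psi> by (auto simp: Linf_iff)
  have "\<exists>i. \<not> (AE x in M. \<bar>\<psi> x * w x\<bar> \<le> K / 2 ^ Suc i)"
  proof -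
    have "(\<lambda>i. K * (1 / 2) ^ i) \<longlonglongrightarrow> K * 0" by (intro tendsto_mult LIMSEQ_power_zero tendsto_const) auto
    then have "eventually (\<lambda>i. K * (1 / 2) ^ i < L) sequentially" using L by (intro order_tendstoD(2)) auto
    then obtain i where "K * (1 / 2) ^ Suc i < L" unfolding eventually_sequentially by (meson le_SucI order_refl)
    then have "K / 2 ^ Suc i < L" by (simp add: power_one_over)
    have "\<not> (AE x in M. \<bar>\<psi> x * w x\<bar> \<le> K / 2 ^ Suc i)"
    proof
      assume "AE x in M. \<bar>\<psi> x * w x\<bar> \<le> K / 2 ^ Suc i"
      then have "AE x in M. \<bar>\<psi> x * w x\<bar> \<le> L"
        by eventually_elim (use \<open>K / 2 ^ Suc i < L\<close> in linarith)
      then show False using big by contradiction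
    qed
    then show ?thesis ..
  qed
  define i where "i = (LEAST i. \<not> (AE x in M. \<bar>\<psi> x * w x\<bar> \<le> K / 2 ^ Suc i))"
  define \<Lambda> where "\<Lambda> = K / 2 ^ i"
  have half: "\<not> (AE x in M. \<bar>\<psi> x * w x\<bar> \<le> \<Lambda> / 2)"
    using LeastI_ex[OF \<open>\<exists>i. _ i\<close>] by (simp add: i_def \<Lambda>_def mult.commute)
  have \<Lambda>: "AE x in M. \<bar>\<psi> x * w x\<bar> \<le> \<Lambda>"
  proof (cases i)
    case 0 then show ?thesis using K by (simp add: \<Lambda>_def)
  next
    case (Suc k) then show ?thesis using not_less_Least[of k "\<lambda>i. \<not> (AE x in M. \<bar>\<psi> x * w x\<bar> \<le> K / 2 ^ Suc i)"]
      by (simp add: \<Lambda>_def i_def[symmetric] del: power_Suc)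
  qed
  have L\<Lambda>: "L \<le> \<Lambda>" 
  proof (rule ccontr)
    assume "\<not> L \<le> \<Lambda>"
    then have "AE x in M. \<bar>\<psi> x * w x\<bar> \<le> L" using \<Lambda> by (auto elim!: eventually_mono)
    then show False using big by contradiction
  qed
  define A where "A = {x \<in> space M. 0 < w x \<and> \<Lambda> / 2 < \<bar>\<psi> x * w x\<bar> \<and> \<bar>\<psi> x * w x\<bar> \<le> \<Lambda>}"
  have A [measurable]: "A \<in> sets M" unfolding A_def by measurable
  have supp: "\<psi> x \<noteq> 0 \<and> 0 < w x \<and> \<bar>\<psi> x * w x\<bar> \<le> \<Lambda>" if "x \<in> A" for x
    using that L L\<Lambda> by (auto simp: A_def)
  note \<eta> = sign_test_function[OF Linf_measurable[OF \<psi>] A supp]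
  let ?\<eta> = "\<lambda>x. indicator A x * sgn (\<psi> x) / w x"
  have "measure M A \<noteq> 0"
  proof
    assume "measure M A = 0"
    then have "AE x in M. x \<notin> A" by (intro AE_not_in) (simp add: null_sets_def emeasure_eq_measure)
    then have "AE x in M. \<bar>\<psi> x * w x\<bar> \<le> \<Lambda> / 2"
      using \<Lambda> w_pos AE_space by eventually_elim (auto simp: A_def)
    then show False using half by contradiction
  qed
  then have mA: "0 < measure M A" by (simp add: zero_less_measure_iff)
  have "\<Lambda> / 2 * measure M A = (LINT x|M. indicator A x * (\<Lambda> / 2))"
    using sets.sets_into_space[OF A] by (simp add: Int_absorb2)
  also have "\<dots> \<le> (LINT x|M. indicator A x * \<bar>\<psi> x * w x\<bar>)"
  proof (rule integral_mono[OF _ \<eta>(3)])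
    show "integrable M (\<lambda>x. indicator A x * (\<Lambda> / 2))"
      by (intro integrable_mult_left integrable_real_indicator A) (simp add: emeasure_finite less_top[symmetric])
    show "indicator A x * (\<Lambda> / 2) \<le> indicator A x * \<bar>\<psi> x * w x\<bar>" for x
      by (auto simp: A_def indicator_def)
  qed
  finally have big': "\<Lambda> / 2 * measure M A \<le> pairing \<Omega> w ?\<eta> \<psi>" by (simp only: \<eta>(4))
  let ?\<theta> = "\<lambda>x. (1 / measure M A) * ?\<eta> x + 0 * ?\<eta> x"
  show ?thesis
  proof (rule that[OF L\<Lambda> \<Lambda>, of ?\<theta>])
    show "?\<theta> \<in> L1" by (rule L1_lincomb(1)[OF \<eta>(1) \<eta>(1)])
    have "N1 ?\<theta> = (LINT x|M. (1 / measure M A) * (\<bar>?\<eta> x\<bar> * w x))"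
      unfolding N1_eq using mA by (intro Bochner_Integration.integral_cong) (auto simp: abs_mult)
    also have "\<dots> = (1 / measure M A) * N1 ?\<eta>" by (simp only: N1_eq integral_mult_right_zero)
    finally show "N1 ?\<theta> = 1" using mA by (simp only: \<eta>(2)) simp
    have "pairing \<Omega> w ?\<theta> \<psi> = (1 / measure M A) * pairing \<Omega> w ?\<eta> \<psi> + 0 * pairing \<Omega> w ?\<eta> \<psi>"
      by (rule pairing_lincomb[OF \<eta>(1) \<eta>(1) \<psi>])
    also have "\<dots> = (1 / measure M A) * pairing \<Omega> w ?\<eta> \<psi>" by (simp only: mult_zero_left add_0_right)
    finally have "pairing \<Omega> w ?\<theta> \<psi> = (1 / measure M A) * pairing \<Omega> w ?\<eta> \<psi>" .
    moreover have "\<Lambda> / 2 \<le> (1 / measure M A) * pairing \<Omega> w ?\<eta> \<psi>"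
      using big' mA by (simp only: pos_le_divide_eq[OF mA] mult_1_left times_divide_eq_left)
    ultimately show "\<Lambda> / 2 \<le> pairing \<Omega> w ?\<theta> \<psi>"
      by simp
  qed
qed

text \<open>The uniform boundedness principle for \<open>L\<^sup>1\<close> and its dual, by a gliding hump. If it fails, there are
  members \<open>h k\<close> of the sequence of norm at least \<open>8\<^sup>k\<close>, with densities \<open>\<eta> k\<close> of norm \<open>1\<close> that see
  half of it. Consider the density \<open>\<Sum>k. \<plusminus> 4\<^sup>-\<^sup>k \<eta> k\<close>, where each sign is chosen so that
  the new term does not cancel what the partial sum already contributes against \<open>h k\<close>. The partial
  sum up to \<open>k\<close> contributes at least \<open>4\<^sup>-\<^sup>k \<Lambda> k / 2\<close>, the remaining terms at most a third of
  \<open>4\<^sup>-\<^sup>k \<Lambda> k\<close>, so the pairings with the \<open>h k\<close> are unbounded.\<close>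

lemma weak_star_bounded_imp_uniformly_bounded:
  assumes g: "\<And>n. g n \<in> Linf \<Omega> w"
    and bounded: "\<And>\<rho>. \<rho> \<in> L1 \<Longrightarrow> \<exists>B. \<forall>n. \<bar>pairing \<Omega> w \<rho> (g n)\<bar> \<le> B"
  shows "\<exists>K. \<forall>n::nat. AE x in M. \<bar>g n x * w x\<bar> \<le> K"
proof (rule ccontr)
  assume "\<not> ?thesis"
  then have "\<forall>K. \<exists>n. \<not> (AE x in M. \<bar>g n x * w x\<bar> \<le> K)" by blast
  then have "\<exists>n. \<not> (AE x in M. \<bar>g n x * w x\<bar> \<le> 8 ^ k)" for k :: nat by blast
  then obtain n where n: "\<not> (AE x in M. \<bar>g (n k) x * w x\<bar> \<le> 8 ^ k)" for k :: nat by metis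
  define h where "h k = g (n k)" for k
  have h: "h k \<in> Linf \<Omega> w" for k by (simp add: h_def g)
  have "\<forall>k. \<exists>\<Lambda> \<eta>. 8 ^ k \<le> \<Lambda> \<and> (AE x in M. \<bar>h k x * w x\<bar> \<le> \<Lambda>) \<and> \<eta> \<in> L1 \<and> N1 \<eta> = 1 \<and> \<Lambda> / 2 \<le> pairing \<Omega> w \<eta> (h k)"
  proof
    fix k
    have big: "\<not> (AE x in M. \<bar>h k x * w x\<bar> \<le> 8 ^ k)" using n[of k] by (simp add: h_def)
    show "\<exists>\<Lambda> \<eta>. 8 ^ k \<le> \<Lambda> \<and> (AE x in M. \<bar>h k x * w x\<bar> \<le> \<Lambda>) \<and> \<eta> \<in> L1 \<and> N1 \<eta> = 1 \<and> \<Lambda> / 2 \<le> pairing \<Omega> w \<eta> (h k)"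
      by (rule norming_test_function[OF h[of k] _ big]) (simp, blast)
  qed
  from choice[OF this] obtain \<Lambda> where "\<forall>k. \<exists>\<eta>. 8 ^ k \<le> \<Lambda> k \<and> (AE x in M. \<bar>h k x * w x\<bar> \<le> \<Lambda> k) \<and> \<eta> \<in> L1 \<and> N1 \<eta> = 1 \<and> \<Lambda> k / 2 \<le> pairing \<Omega> w \<eta> (h k)" ..
  from choice[OF this] obtain \<eta> where \<Lambda>\<eta>: "\<forall>k. 8 ^ k \<le> \<Lambda> k \<and> (AE x in M. \<bar>h k x * w x\<bar> \<le> \<Lambda> k) \<and> (\<eta> k) \<in> L1 \<and> N1 (\<eta> k) = 1 \<and> \<Lambda> k / 2 \<le> pairing \<Omega> w (\<eta> k) (h k)" ..
  then have \<Lambda>: "\<And>k. 8 ^ k \<le> \<Lambda> k" "\<And>k. AE x in M. \<bar>h k x * w x\<bar> \<le> \<Lambda> k"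
    and \<eta>: "\<And>k. \<eta> k \<in> L1" "\<And>k. N1 (\<eta> k) = 1" "\<And>k. \<Lambda> k / 2 \<le> pairing \<Omega> w (\<eta> k) (h k)"
    by blast+
  have \<Lambda>0: "0 \<le> \<Lambda> k" for k using order_trans[OF _ \<Lambda>(1)[of k], of 0] by simp
  define \<sigma> :: "('a \<Rightarrow> real) \<Rightarrow> nat \<Rightarrow> real"
    where "\<sigma> p k = (if 0 \<le> pairing \<Omega> w p (h k) then 1 else -1)" for p k
  (* P k is the partial sum of the terms with index below k; the trivial factor 1 brings the
     recursion into the form of the lemmas on linear combinations. *)
  define P where "P = rec_nat (\<lambda>_. 0) (\<lambda>k p x. 1 * p x + (\<sigma> p k * (1 / 4) ^ k) * \<eta> k x)"
  have P0: "P 0 = (\<lambda>_. 0)" and PS: "P (Suc k) = (\<lambda>x. 1 * P k x + (\<sigma> (P k) k * (1 / 4) ^ k) * \<eta> k x)" for k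
    by (simp_all add: P_def)
  have PL: "P k \<in> L1" for k
    by (induction k) (auto simp only: PS intro!: L1_lincomb \<eta>, simp add: P0 L1_iff)
  have Pbig: "(1 / 4) ^ k * (\<Lambda> k / 2) \<le> \<bar>pairing \<Omega> w (P (Suc k)) (h k)\<bar>" for k
  proof -
    have "pairing \<Omega> w (P (Suc k)) (h k)
        = 1 * pairing \<Omega> w (P k) (h k) + (\<sigma> (P k) k * (1 / 4) ^ k) * pairing \<Omega> w (\<eta> k) (h k)"
      unfolding PS by (rule pairing_lincomb[OF PL \<eta>(1) h])
    moreover have "0 \<le> (1 / 4) ^ k * pairing \<Omega> w (\<eta> k) (h k)"
      using \<eta>(3)[of k] \<Lambda>0[of k] by (intro mult_nonneg_nonneg) auto
    ultimately have "(1 / 4) ^ k * pairing \<Omega> w (\<eta> k) (h k) \<le> \<bar>pairing \<Omega> w (P (Suc k)) (h k)\<bar>"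
      by (auto simp: \<sigma>_def)
    moreover have "(1 / 4) ^ k * (\<Lambda> k / 2) \<le> (1 / 4) ^ k * pairing \<Omega> w (\<eta> k) (h k)"
      by (intro mult_left_mono \<eta>(3)) simp
    ultimately show ?thesis by linarith
  qed
  define d where "d k x = (\<sigma> (P k) k * (1 / 4) ^ k) * \<eta> k x" for k x
  define f where "f k x = \<bar>d k x\<bar> * w x" for k x
  note [measurable] = \<eta>(1)[THEN L1_measurable]
  have d_meas [measurable]: "d k \<in> borel_measurable M" for k unfolding d_def by measurable
  have Psum: "P k x = (\<Sum>i<k. d i x)" for k x
    by (induction k) (simp_all add: P0 PS d_def)
  have f_eq: "f k x = (1 / 4) ^ k * (\<bar>\<eta> k x\<bar> * w x)" for k x
    by (simp add: f_def d_def \<sigma>_def abs_mult)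
  have f_int: "integrable M (f k)" and f_val: "(LINT x|M. f k x) = (1 / 4) ^ k" for k
    using \<eta>(1,2)[of k] unfolding f_eq by (simp_all add: L1_iff N1_eq)
  have f_nonneg: "0 \<le> f k x" if "x \<in> \<Omega>" for k x
    using w_nonneg[OF that] by (simp add: f_def)
  have geo: "summable (\<lambda>k. (1 / 4 :: real) ^ k)" by (rule summable_geometric) simp
  have f_summable: "AE x in M. summable (\<lambda>k. f k x)"
  proof -
    have "(\<integral>\<^sup>+x. (\<Sum>k. ennreal (f k x)) \<partial>M) = (\<Sum>k. \<integral>\<^sup>+x. ennreal (f k x) \<partial>M)"
      using f_int by (intro nn_integral_suminf) auto
    also have "\<dots> = (\<Sum>k. ennreal ((1 / 4) ^ k))"
      using f_int f_nonneg f_val by (intro suminf_cong, subst nn_integral_eq_integral) (auto intro!: AE_I2)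
    also have "\<dots> < \<infinity>" using geo by (simp add: suminf_ennreal2 less_top[symmetric] ennreal_suminf_neq_top)
    finally have "AE x in M. (\<Sum>k. ennreal (f k x)) \<noteq> \<infinity>"
      using f_int by (intro nn_integral_noteq_infinite) auto
    then show ?thesis using AE_space
      by eventually_elim (auto intro!: summable_suminf_not_top f_nonneg)
  qed
  define \<rho> where "\<rho> x = (\<Sum>k. d k x)" for x
  have \<rho>_meas [measurable]: "\<rho> \<in> borel_measurable M" unfolding \<rho>_def by measurable
  have tail: "(\<lambda>x. 1 * \<rho> x + (-1) * P k x) \<in> L1 \<and> N1 (\<lambda>x. 1 * \<rho> x + (-1) * P k x) \<le> (4 / 3) * (1 / 4) ^ k" for k
  proof -
    have S: "AE x in M. summable (\<lambda>i. norm (f (i + k) x))"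
      using f_summable AE_space
      by eventually_elim (simp add: f_nonneg summable_iff_shift[of "\<lambda>i. f i _"])
    have norm_val: "(LINT x|M. norm (f (i + k) x)) = (1 / 4) ^ (i + k)" for i
    proof -
      have "(LINT x|M. norm (f (i + k) x)) = (LINT x|M. f (i + k) x)"
        using f_nonneg by (intro Bochner_Integration.integral_cong) auto
      then show ?thesis by (simp only: f_val)
    qed
    have I: "summable (\<lambda>i. LINT x|M. norm (f (i + k) x))"
      unfolding norm_val using geo by (simp add: summable_iff_shift[of "\<lambda>i. (1 / 4) ^ i"])
    note int = integrable_suminf[OF f_int S I] and val = integral_suminf[OF f_int S I]
    have bound: "AE x in M. \<bar>\<rho> x - P k x\<bar> * w x \<le> (\<Sum>i. f (i + k) x)"
      using f_summable w_pos AE_space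
    proof eventually_elim
      case (elim x)
      have sd: "summable (\<lambda>i. \<bar>d i x\<bar>)"
        using summable_mult2[OF elim(1), of "1 / w x"] elim(2) by (simp add: f_def)
      then have sd': "summable (\<lambda>i. \<bar>d (i + k) x\<bar>)" by (simp add: summable_iff_shift[of "\<lambda>i. \<bar>d i x\<bar>"])
      have "\<rho> x - P k x = (\<Sum>i. d (i + k) x)"
        unfolding \<rho>_def Psum using suminf_split_initial_segment[OF summable_rabs_cancel[OF sd], of k] by simp
      then have "\<bar>\<rho> x - P k x\<bar> \<le> (\<Sum>i. \<bar>d (i + k) x\<bar>)" using summable_rabs[OF sd'] by simp
      then have "\<bar>\<rho> x - P k x\<bar> * w x \<le> (\<Sum>i. \<bar>d (i + k) x\<bar>) * w x"
        using elim by (intro mult_right_mono) auto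
      also have "\<dots> = (\<Sum>i. f (i + k) x)" unfolding f_def by (rule suminf_mult2[OF sd'])
      finally show ?case .
    qed
    have Pm [measurable]: "P k \<in> borel_measurable M" using PL by (rule L1_measurable)
    have int': "integrable M (\<lambda>x. \<bar>\<rho> x - P k x\<bar> * w x)"
    proof (rule Bochner_Integration.integrable_bound[OF int])
      show "AE x in M. norm (\<bar>\<rho> x - P k x\<bar> * w x) \<le> norm (\<Sum>i. f (i + k) x)"
        using bound AE_space by eventually_elim (use w_nonneg in \<open>auto simp: abs_mult\<close>)
    qed measurable
    have "N1 (\<lambda>x. 1 * \<rho> x + (-1) * P k x) \<le> (LINT x|M. (\<Sum>i. f (i + k) x))"
      unfolding N1_eq using int int' bound by (intro integral_mono_AE) auto
    also have "\<dots> = (\<Sum>i. (1 / 4) ^ (i + k))" unfolding val f_val ..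
    also have "\<dots> = (4 / 3) * (1 / 4) ^ k"
      using suminf_mult2[OF geo, of "(1 / 4) ^ k", symmetric] suminf_geometric[of "1/4::real"] by (simp add: power_add)
    finally show ?thesis using int' by (simp add: L1_iff)
  qed
  have \<rho>: "\<rho> \<in> L1" using tail[of 0] by (simp add: P0)
  have big: "2 ^ k / 6 \<le> \<bar>pairing \<Omega> w \<rho> (h k)\<bar>" for k
  proof -
    let ?r = "\<lambda>x. 1 * \<rho> x + (-1) * P (Suc k) x"
    have "pairing \<Omega> w ?r (h k) = 1 * pairing \<Omega> w \<rho> (h k) + (-1) * pairing \<Omega> w (P (Suc k)) (h k)"
      by (rule pairing_lincomb[OF \<rho> PL h])
    moreover have "\<bar>pairing \<Omega> w ?r (h k)\<bar> \<le> \<Lambda> k * N1 ?r"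
      using tail[of "Suc k"] by (intro pairing_integrand_bound(3) Linf_measurable h \<Lambda>(2)) auto
    moreover have "\<Lambda> k * N1 ?r \<le> \<Lambda> k * ((4 / 3) * (1 / 4) ^ Suc k)"
      using tail[of "Suc k"] by (intro mult_left_mono \<Lambda>0) auto
    ultimately have "(1 / 4) ^ k * (\<Lambda> k / 2) - \<Lambda> k * ((4 / 3) * (1 / 4) ^ Suc k) \<le> \<bar>pairing \<Omega> w \<rho> (h k)\<bar>"
      using Pbig[of k] by linarith
    moreover have "(1 / 4) ^ k * (\<Lambda> k / 2) - \<Lambda> k * ((4 / 3) * (1 / 4) ^ Suc k) = (1 / 4) ^ k * \<Lambda> k / 6"
      by simp
    moreover have "(2::real) ^ k / 6 \<le> (1 / 4) ^ k * \<Lambda> k / 6"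
    proof -
      have "(2::real) ^ k = (1 / 4) ^ k * 8 ^ k" by (simp flip: power_mult_distrib)
      also have "\<dots> \<le> (1 / 4) ^ k * \<Lambda> k" by (intro mult_left_mono \<Lambda>) simp
      finally show ?thesis by simp
    qed
    ultimately show ?thesis by linarith
  qed
  obtain B where B: "\<And>n. \<bar>pairing \<Omega> w \<rho> (g n)\<bar> \<le> B" using bounded[OF \<rho>] by blast
  obtain k where "6 * B < 2 ^ k" using real_arch_pow[of 2 "6 * B"] by auto
  then show False using big[of k] B[of "n k"] by (simp add: h_def)
qed

end

context weighted_domain
begin

lemma borel_measurable_M_iff:
  fixes f :: "'a \<Rightarrow> real"
  shows "f \<in> borel_measurable M \<longleftrightarrow> (\<lambda>x. indicator \<Omega> x * f x) \<in> borel_measurable lebesgue"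
  using borel_measurable_restrict_space_iff[of \<Omega> lebesgue f] domain_sets by simp

lemma borel_imp_measurable_M: "f \<in> borel_measurable borel \<Longrightarrow> f \<in> borel_measurable M"
  by (intro measurable_restrict_space1 measurable_completion) simp

lemma borel_measurable_M_AE:
  fixes f g :: "'a \<Rightarrow> real"
  assumes f: "f \<in> borel_measurable M" and eq: "AE x in M. f x = g x"
  shows "g \<in> borel_measurable M"
  unfolding borel_measurable_M_iff
proof (rule borel_measurable_AE)
  show "(\<lambda>x. indicator \<Omega> x * f x) \<in> borel_measurable lebesgue" using f by (simp add: borel_measurable_M_iff)
  show "AE x in lebesgue. indicator \<Omega> x * f x = indicator \<Omega> x * g x"
    using eq domain_sets by (subst (asm) AE_restrict_space_iff) (auto simp: indicator_def elim!: eventually_mono)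
qed

text \<open>The exceptional set is a Borel set, so that its preimage under the flow is measurable.\<close>

lemma borel_version:
  fixes \<psi> :: "'a \<Rightarrow> real"
  assumes "\<psi> \<in> borel_measurable M"
  obtains \<psi>' N where "\<psi>' \<in> borel_measurable borel" "N \<in> sets borel" "AE x in M. x \<notin> N"
    "\<And>x. x \<in> \<Omega> \<Longrightarrow> x \<notin> N \<Longrightarrow> \<psi> x = \<psi>' x"
proof -
  obtain \<psi>' where \<psi>': "\<psi>' \<in> borel_measurable lborel" "AE x in lborel. indicator \<Omega> x * \<psi> x = \<psi>' x"
    using assms completion_ex_borel_measurable_real[of "\<lambda>x. indicator \<Omega> x * \<psi> x" lborel]
    unfolding borel_measurable_M_iff by blast
  obtain N where N: "{x \<in> space lborel. \<not> indicator \<Omega> x * \<psi> x = \<psi>' x} \<subseteq> N" "emeasure lborel N = 0" "N \<in> sets lborel"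
    using AE_E[OF \<psi>'(2)] by blast
  then have "AE x in lborel. x \<notin> N" by (intro AE_not_in) (simp add: null_sets_def)
  then have "AE x in lebesgue. x \<notin> N" by (rule AE_completion)
  then have "AE x in M. x \<notin> N"
    using domain_sets by (subst AE_restrict_space_iff) (auto elim!: eventually_mono)
  moreover have "\<psi> x = \<psi>' x" if "x \<in> \<Omega>" "x \<notin> N" for x
  proof (rule ccontr)
    assume "\<psi> x \<noteq> \<psi>' x"
    then have "x \<in> {x \<in> space lborel. \<not> indicator \<Omega> x * \<psi> x = \<psi>' x}" using that by simp
    then show False using N(1) that by blast
  qed
  ultimately show ?thesis using \<psi>'(1) N(3) by (intro that[of \<psi>' N]) auto
qed

lemma Linf_lincomb:
  assumes "\<psi> \<in> Linf \<Omega> w" "\<xi> \<in> Linf \<Omega> w"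
  shows "(\<lambda>x. a * \<psi> x + b * \<xi> x) \<in> Linf \<Omega> w"
proof -
  note [measurable] = assms[THEN Linf_measurable]
  obtain K L where K: "0 \<le> K" "AE x in M. \<bar>\<psi> x * w x\<bar> \<le> K" and L: "0 \<le> L" "AE x in M. \<bar>\<xi> x * w x\<bar> \<le> L"
    using assms by (auto simp: Linf_iff)
  have "AE x in M. \<bar>(a * \<psi> x + b * \<xi> x) * w x\<bar> \<le> \<bar>a\<bar> * K + \<bar>b\<bar> * L"
    using K(2) L(2)
  proof eventually_elim
    case (elim x)
    have "\<bar>(a * \<psi> x + b * \<xi> x) * w x\<bar> = \<bar>a * (\<psi> x * w x) + b * (\<xi> x * w x)\<bar>" by (simp add: algebra_simps)
    also have "\<dots> \<le> \<bar>a\<bar> * \<bar>\<psi> x * w x\<bar> + \<bar>b\<bar> * \<bar>\<xi> x * w x\<bar>" by (metis abs_triangle_ineq abs_mult)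
    also have "\<dots> \<le> \<bar>a\<bar> * K + \<bar>b\<bar> * L" using elim by (intro add_mono mult_left_mono) auto
    finally show ?case .
  qed
  moreover have "0 \<le> \<bar>a\<bar> * K + \<bar>b\<bar> * L" using K L by simp
  moreover have "(\<lambda>x. a * \<psi> x + b * \<xi> x) \<in> borel_measurable M" by measurable
  ultimately show ?thesis unfolding Linf_iff by blast
qed

lemma Linf_sum:
  assumes "finite I" "\<And>i. i \<in> I \<Longrightarrow> \<psi> i \<in> Linf \<Omega> w"
  shows "(\<lambda>x. \<Sum>i\<in>I. a i * \<psi> i x) \<in> Linf \<Omega> w"
  using assms
proof (induction I rule: finite_induct)
  case empty
  show ?case by (auto simp: Linf_iff)
next
  case (insert i I)
  then show ?case using Linf_lincomb[of "\<psi> i" "\<lambda>x. \<Sum>i\<in>I. a i * \<psi> i x" "a i" 1] by simp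
qed

lemma pairing_integrable:
  assumes "\<rho> \<in> L1" "\<psi> \<in> Linf \<Omega> w"
  shows "integrable M (\<lambda>x. \<rho> x * \<psi> x * (w x)\<^sup>2)"
proof -
  obtain K where "AE x in M. \<bar>\<psi> x * w x\<bar> \<le> K" using assms(2) by (auto simp: Linf_iff)
  then show ?thesis by (rule pairing_integrand_bound(1)[OF assms(1) Linf_measurable[OF assms(2)]])
qed

lemma pairing_sum_right:
  assumes \<rho>: "\<rho> \<in> L1" and "\<And>i. i \<in> I \<Longrightarrow> \<psi> i \<in> Linf \<Omega> w"
  shows "pairing \<Omega> w \<rho> (\<lambda>x. \<Sum>i\<in>I. a i * \<psi> i x) = (\<Sum>i\<in>I. a i * pairing \<Omega> w \<rho> (\<psi> i))"
proof -
  have "pairing \<Omega> w \<rho> (\<lambda>x. \<Sum>i\<in>I. a i * \<psi> i x) = (LINT x|M. (\<Sum>i\<in>I. a i * (\<rho> x * \<psi> i x * (w x)\<^sup>2)))"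
    unfolding pairing_def
    by (intro Bochner_Integration.integral_cong refl) (simp add: sum_distrib_left sum_distrib_right mult_ac)
  also have "\<dots> = (\<Sum>i\<in>I. a i * pairing \<Omega> w \<rho> (\<psi> i))"
    using assms by (subst Bochner_Integration.integral_sum) (auto simp: pairing_def pairing_integrable)
  finally show ?thesis .
qed

lemma pairing_diff_right:
  assumes "\<rho> \<in> L1" "\<psi> \<in> Linf \<Omega> w" "\<xi> \<in> Linf \<Omega> w"
  shows "pairing \<Omega> w \<rho> (\<lambda>x. \<psi> x - \<xi> x) = pairing \<Omega> w \<rho> \<psi> - pairing \<Omega> w \<rho> \<xi>"
  using pairing_integrable[OF assms(1,2)] pairing_integrable[OF assms(1,3)]
  by (simp add: pairing_def algebra_simps)

lemma pairing_divide_right: "pairing \<Omega> w \<rho> (\<lambda>x. \<psi> x / h) = pairing \<Omega> w \<rho> \<psi> / h"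
  by (simp add: pairing_def)

end

section \<open>The composition semigroup and its generator\<close>

locale composition_semigroup = weighted_domain +
  fixes \<Phi> :: "real \<Rightarrow> 'a \<Rightarrow> 'a" and S :: "real \<Rightarrow> ('a \<Rightarrow> real) \<Rightarrow> 'a \<Rightarrow> real" and \<omega> :: real
  assumes flow_continuous: "continuous_on ({0..} \<times> \<Omega>) (\<lambda>(t, x). \<Phi> t x)"
    and flow_add: "\<And>s t x. 0 \<le> s \<Longrightarrow> 0 \<le> t \<Longrightarrow> x \<in> \<Omega> \<Longrightarrow> \<Phi> t x \<in> \<Omega> \<Longrightarrow> \<Phi> s (\<Phi> t x) = \<Phi> (t + s) x"
    and preadjoint: "preadjoint_semigroup \<Omega> w \<Phi> S"
    and stable: "exponentially_stable \<Omega> w S \<omega>"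
begin

lemma rate_neg: "\<omega> < 0" using stable by (simp add: exponentially_stable_def)

definition stability_const where
  "stability_const = (SOME C. 1 \<le> C \<and> (\<forall>t\<ge>0. \<forall>\<rho>\<in>L1. N1 (S t \<rho>) \<le> C * exp (\<omega> * t) * N1 \<rho>))"

lemma stability_const: "1 \<le> stability_const" "\<And>t \<rho>. 0 \<le> t \<Longrightarrow> \<rho> \<in> L1 \<Longrightarrow> N1 (S t \<rho>) \<le> stability_const * exp (\<omega> * t) * N1 \<rho>"
proof -
  have "\<exists>C. 1 \<le> C \<and> (\<forall>t\<ge>0. \<forall>\<rho>\<in>L1. N1 (S t \<rho>) \<le> C * exp (\<omega> * t) * N1 \<rho>)"
    using stable by (auto simp: exponentially_stable_def)
  from someI_ex[OF this] show "1 \<le> stability_const"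
    "\<And>t \<rho>. 0 \<le> t \<Longrightarrow> \<rho> \<in> L1 \<Longrightarrow> N1 (S t \<rho>) \<le> stability_const * exp (\<omega> * t) * N1 \<rho>"
    unfolding stability_const_def by auto
qed

lemma S_L1: "0 \<le> t \<Longrightarrow> \<rho> \<in> L1 \<Longrightarrow> S t \<rho> \<in> L1"
  using preadjoint by (simp add: preadjoint_semigroup_def bounded_operator_L1_def)

lemma N1_S_le: "0 \<le> t \<Longrightarrow> \<rho> \<in> L1 \<Longrightarrow> N1 (S t \<rho>) \<le> stability_const * N1 \<rho>"
proof -
  assume t: "0 \<le> t" and \<rho>: "\<rho> \<in> L1"
  have "exp (\<omega> * t) \<le> 1" using t rate_neg by (simp add: mult_nonpos_nonneg)
  then have "stability_const * exp (\<omega> * t) * N1 \<rho> \<le> stability_const * 1 * N1 \<rho>"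
    using stability_const(1) N1_nonneg by (intro mult_right_mono mult_left_mono) auto
  then show ?thesis using stability_const(2)[OF t \<rho>] by simp
qed

lemma pairing_S: "0 \<le> t \<Longrightarrow> \<rho> \<in> L1 \<Longrightarrow> \<psi> \<in> Linf \<Omega> w \<Longrightarrow>
    pairing \<Omega> w (S t \<rho>) \<psi> = pairing \<Omega> w \<rho> (\<lambda>x. \<psi> (\<Phi> t x))"
  using preadjoint by (simp add: preadjoint_semigroup_def comp_semigroup_def o_def)

lemma flow_measurable [measurable]:
  assumes t: "0 \<le> t" shows "\<Phi> t \<in> M \<rightarrow>\<^sub>M borel"
proof -
  have "continuous_on \<Omega> ((\<lambda>(t, x). \<Phi> t x) \<circ> (\<lambda>x. (t, x)))"
    using t by (intro continuous_on_compose continuous_intros continuous_on_subset[OF flow_continuous]) auto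
  then have "continuous_on \<Omega> (\<Phi> t)" by (simp add: o_def)
  then have "(\<lambda>x. indicator \<Omega> x *\<^sub>R \<Phi> t x) \<in> borel_measurable M"
    using open_domain by (intro borel_imp_measurable_M borel_measurable_continuous_on_indicator) (auto simp: borel_open)
  then show ?thesis by (subst measurable_cong[of M _ "\<lambda>x. indicator \<Omega> x *\<^sub>R \<Phi> t x"]) auto
qed

text \<open>The indicator function of \<open>N\<close> is zero in the dual space, hence so is its composition with the
  flow: the left side of the preadjoint identity does not see \<open>N\<close>. For \<open>N\<close> the complement of
  \<open>\<Omega>\<close>, this says that almost no point leaves \<open>\<Omega>\<close>.\<close>

lemma flow_avoids_null:
  assumes N: "N \<in> sets borel" "AE x in M. x \<notin> N" and t: "0 \<le> t"
  shows "AE x in M. \<Phi> t x \<notin> N"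
proof -
  note [measurable] = N(1) flow_measurable[OF t]
  have ind: "(indicator N :: 'a \<Rightarrow> real) \<in> borel_measurable M"
    using N(1) by (intro borel_imp_measurable_M borel_measurable_indicator)
  have "AE x in M. \<bar>indicator N x * w x\<bar> \<le> 0" using N(2) by eventually_elim simp
  then have Linf: "indicator N \<in> Linf \<Omega> w" using ind by (auto simp: Linf_iff)
  have "AE x in M. \<bar>indicator N (\<Phi> t x) * w x\<bar> \<le> (0::real)"
  proof (rule AE_bound_by_duality)
    show "(\<lambda>x. indicator N (\<Phi> t x) :: real) \<in> borel_measurable M" by measurable
    fix \<rho> assume \<rho>: "\<rho> \<in> L1"
    have "pairing \<Omega> w \<rho> (\<lambda>x. indicator N (\<Phi> t x)) = pairing \<Omega> w (S t \<rho>) (indicator N)"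
      using pairing_S[OF t \<rho> Linf] by simp
    also have "\<dots> = 0"
      unfolding pairing_def using N(2) by (intro integral_eq_zero_AE) (auto elim!: eventually_mono)
    finally show "\<bar>pairing \<Omega> w \<rho> (\<lambda>x. indicator N (\<Phi> t x))\<bar> \<le> 0 * N1 \<rho>" by simp
  qed simp
  then show ?thesis using w_pos by eventually_elim (auto simp: indicator_def split: if_splits)
qed

lemma flow_stays: "0 \<le> t \<Longrightarrow> AE x in M. \<Phi> t x \<in> \<Omega>"
  using flow_avoids_null[of "- \<Omega>" t] open_domain AE_space[of M] by (auto simp: borel_open borel_comp)

lemma comp_flow_AE_eq:
  assumes N: "N \<in> sets borel" "AE x in M. x \<notin> N" and eq: "\<And>x. x \<in> \<Omega> \<Longrightarrow> x \<notin> N \<Longrightarrow> \<psi> x = \<psi>' x" and t: "0 \<le> t"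
  shows "AE x in M. \<psi> (\<Phi> t x) = \<psi>' (\<Phi> t x)"
  using flow_avoids_null[OF N t] flow_stays[OF t] by eventually_elim (simp add: eq)

text \<open>The composition of a Lebesgue measurable function with a continuous map need not be measurable;
  here it is, because the flow avoids the null set on which \<open>\<psi>\<close> differs from a Borel function.\<close>

lemma comp_flow_measurable:
  fixes \<psi> :: "'a \<Rightarrow> real"
  assumes \<psi>: "\<psi> \<in> borel_measurable M" and t: "0 \<le> t"
  shows "(\<lambda>x. \<psi> (\<Phi> t x)) \<in> borel_measurable M"
proof -
  obtain \<psi>' N where \<psi>' [measurable]: "\<psi>' \<in> borel_measurable borel" and N: "N \<in> sets borel" "AE x in M. x \<notin> N"
    "\<And>x. x \<in> \<Omega> \<Longrightarrow> x \<notin> N \<Longrightarrow> \<psi> x = \<psi>' x"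
    by (rule borel_version[OF \<psi>]) (rule that)
  note [measurable] = flow_measurable[OF t]
  have "AE x in M. \<psi> (\<Phi> t x) = \<psi>' (\<Phi> t x)"
    by (rule comp_flow_AE_eq[OF N(1,2) _ t]) (rule N(3))
  then have "AE x in M. \<psi>' (\<Phi> t x) = \<psi> (\<Phi> t x)" by eventually_elim simp
  then show ?thesis by (rule borel_measurable_M_AE[rotated]) measurable
qed

text \<open>The stability of the preadjoint on \<open>L\<^sup>1\<close> becomes a pointwise bound along the flow by duality.\<close>

lemma comp_flow_bound:
  assumes \<psi>: "\<psi> \<in> borel_measurable M" and K: "0 \<le> K" "AE x in M. \<bar>\<psi> x * w x\<bar> \<le> K" and t: "0 \<le> t"
  shows "AE x in M. \<bar>\<psi> (\<Phi> t x) * w x\<bar> \<le> K * (stability_const * exp (\<omega> * t))"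
proof (rule AE_bound_by_duality[OF comp_flow_measurable[OF \<psi> t]])
  show "0 \<le> K * (stability_const * exp (\<omega> * t))" using K stability_const(1) by simp
  fix \<rho> assume \<rho>: "\<rho> \<in> L1"
  have Linf: "\<psi> \<in> Linf \<Omega> w" using \<psi> K by (auto simp: Linf_iff)
  have "\<bar>pairing \<Omega> w \<rho> (\<lambda>x. \<psi> (\<Phi> t x))\<bar> = \<bar>pairing \<Omega> w (S t \<rho>) \<psi>\<bar>"
    using pairing_S[OF t \<rho> Linf] by simp
  also have "\<dots> \<le> K * N1 (S t \<rho>)" by (rule pairing_integrand_bound(3)[OF S_L1[OF t \<rho>] \<psi> K(2)])
  also have "\<dots> \<le> K * (stability_const * exp (\<omega> * t) * N1 \<rho>)"
    using stability_const(2)[OF t \<rho>] K by (intro mult_left_mono)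
  finally show "\<bar>pairing \<Omega> w \<rho> (\<lambda>x. \<psi> (\<Phi> t x))\<bar> \<le> K * (stability_const * exp (\<omega> * t)) * N1 \<rho>" by (simp add: mult.assoc)
qed

lemma comp_flow_Linf:
  assumes "\<psi> \<in> Linf \<Omega> w" and t: "0 \<le> t"
  shows "(\<lambda>x. \<psi> (\<Phi> t x)) \<in> Linf \<Omega> w"
proof -
  obtain K where K: "0 \<le> K" "AE x in M. \<bar>\<psi> x * w x\<bar> \<le> K" using assms(1) by (auto simp: Linf_iff)
  have "0 \<le> K * (stability_const * exp (\<omega> * t))" using K stability_const(1) by simp
  then show ?thesis
    using comp_flow_bound[OF Linf_measurable[OF assms(1)] K t] comp_flow_measurable[OF Linf_measurable[OF assms(1)] t]
    unfolding Linf_iff by blast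
qed

lemma pairing_flow_bound:
  assumes \<rho>: "\<rho> \<in> L1" and \<psi>: "\<psi> \<in> borel_measurable M" and K: "0 \<le> K" "AE x in M. \<bar>\<psi> x * w x\<bar> \<le> K" and t: "0 \<le> t"
  shows "\<bar>pairing \<Omega> w \<rho> (\<lambda>x. \<psi> (\<Phi> t x))\<bar> \<le> K * stability_const * exp (\<omega> * t) * N1 \<rho>"
  using pairing_integrand_bound(3)[OF \<rho> comp_flow_measurable[OF \<psi> t] comp_flow_bound[OF \<psi> K t]]
  by (simp add: mult.assoc)

lemma pairing_flow_add:
  assumes \<rho>: "\<rho> \<in> L1" and \<psi>: "\<psi> \<in> Linf \<Omega> w" and t: "0 \<le> t" and s: "0 \<le> s"
  shows "pairing \<Omega> w \<rho> (\<lambda>x. \<psi> (\<Phi> (t + s) x)) = pairing \<Omega> w (S t \<rho>) (\<lambda>x. \<psi> (\<Phi> s x))"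
proof -
  have "pairing \<Omega> w (S t \<rho>) (\<lambda>x. \<psi> (\<Phi> s x)) = pairing \<Omega> w \<rho> (\<lambda>x. \<psi> (\<Phi> s (\<Phi> t x)))"
    by (rule pairing_S[OF t \<rho> comp_flow_Linf[OF \<psi> s]])
  also have "\<dots> = pairing \<Omega> w \<rho> (\<lambda>x. \<psi> (\<Phi> (t + s) x))"
  proof (rule pairing_cong_AE)
    show "AE x in M. \<psi> (\<Phi> s (\<Phi> t x)) = \<psi> (\<Phi> (t + s) x)"
      using flow_stays[OF t] AE_space by eventually_elim (use s t in \<open>simp add: flow_add\<close>)
    show "(\<lambda>x. \<psi> (\<Phi> s (\<Phi> t x))) \<in> borel_measurable M"
      by (rule comp_flow_measurable[OF comp_flow_measurable[OF Linf_measurable[OF \<psi>] s] t])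
    show "(\<lambda>x. \<psi> (\<Phi> (t + s) x)) \<in> borel_measurable M"
      using s t by (intro comp_flow_measurable Linf_measurable \<psi>) auto
  qed (rule L1_measurable[OF \<rho>])
  finally show ?thesis ..
qed

lemma pairing_flow_increment:
  assumes \<rho>: "\<rho> \<in> L1" and \<psi>: "\<psi> \<in> Linf \<Omega> w" and t: "0 \<le> t" and h: "0 \<le> h"
  shows "(pairing \<Omega> w \<rho> (\<lambda>x. \<psi> (\<Phi> (t + h) x)) - pairing \<Omega> w \<rho> (\<lambda>x. \<psi> (\<Phi> t x))) / h
    = pairing \<Omega> w (S t \<rho>) (\<lambda>x. (\<psi> (\<Phi> h x) - \<psi> x) / h)"
  using \<psi> t h
  by (simp add: pairing_divide_right pairing_diff_right S_L1[OF t \<rho>] comp_flow_Linf pairing_flow_add[OF \<rho>] pairing_S[OF t \<rho>, symmetric])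

lemma generator_right_derivative:
  assumes gen: "weak_star_generator \<Omega> w \<Phi> \<psi> \<xi>" and \<rho>: "\<rho> \<in> L1" and t: "0 \<le> t"
  shows "((\<lambda>h. (pairing \<Omega> w \<rho> (\<lambda>x. \<psi> (\<Phi> (t + h) x)) - pairing \<Omega> w \<rho> (\<lambda>x. \<psi> (\<Phi> t x))) / h)
    \<longlongrightarrow> pairing \<Omega> w \<rho> (\<lambda>x. \<xi> (\<Phi> t x))) (at_right 0)"
proof -
  have \<psi>: "\<psi> \<in> Linf \<Omega> w" and \<xi>: "\<xi> \<in> Linf \<Omega> w" using gen by (simp_all add: weak_star_generator_def)
  have "((\<lambda>h. pairing \<Omega> w (S t \<rho>) (\<lambda>x. (\<psi> (\<Phi> h x) - \<psi> x) / h)) \<longlongrightarrow> pairing \<Omega> w (S t \<rho>) \<xi>) (at_right 0)"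
    using gen S_L1[OF t \<rho>] by (simp add: weak_star_generator_def comp_semigroup_def)
  moreover have "eventually (\<lambda>h. pairing \<Omega> w (S t \<rho>) (\<lambda>x. (\<psi> (\<Phi> h x) - \<psi> x) / h)
      = (pairing \<Omega> w \<rho> (\<lambda>x. \<psi> (\<Phi> (t + h) x)) - pairing \<Omega> w \<rho> (\<lambda>x. \<psi> (\<Phi> t x))) / h) (at_right 0)"
    using eventually_at_right_less[of 0] by eventually_elim (simp add: pairing_flow_increment[OF \<rho> \<psi> t])
  ultimately have "((\<lambda>h. (pairing \<Omega> w \<rho> (\<lambda>x. \<psi> (\<Phi> (t + h) x)) - pairing \<Omega> w \<rho> (\<lambda>x. \<psi> (\<Phi> t x))) / h)
    \<longlongrightarrow> pairing \<Omega> w (S t \<rho>) \<xi>) (at_right 0)"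
    by (rule Lim_transform_eventually)
  then show ?thesis using pairing_S[OF t \<rho> \<xi>] by simp
qed

text \<open>Otherwise there would be a sequence of times tending to zero along which the quotients are
  unbounded, although they converge weak-*.\<close>

lemma generator_quotients_bounded:
  assumes gen: "weak_star_generator \<Omega> w \<Phi> \<psi> \<xi>"
  obtains \<delta> K where "0 < \<delta>" "0 \<le> K"
    "\<And>h. 0 < h \<Longrightarrow> h < \<delta> \<Longrightarrow> AE x in M. \<bar>(\<psi> (\<Phi> h x) - \<psi> x) / h * w x\<bar> \<le> K"
proof (rule ccontr)
  assume neg: "\<not> thesis"
  have \<psi>: "\<psi> \<in> Linf \<Omega> w" using gen by (simp add: weak_star_generator_def)
  have "\<exists>h. 0 < h \<and> h < 1 / real (Suc n) \<and> \<not> (AE x in M. \<bar>(\<psi> (\<Phi> h x) - \<psi> x) / h * w x\<bar> \<le> real n)" for n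
  proof (rule ccontr)
    assume "\<not> ?thesis"
    then have "AE x in M. \<bar>(\<psi> (\<Phi> h x) - \<psi> x) / h * w x\<bar> \<le> real n" if "0 < h" "h < 1 / real (Suc n)" for h
      using that by blast
    then have thesis by (intro that[of "1 / real (Suc n)" "real n"]) auto
    then show False using neg by contradiction
  qed
  then have "\<forall>n. \<exists>h. 0 < h \<and> h < 1 / real (Suc n) \<and> \<not> (AE x in M. \<bar>(\<psi> (\<Phi> h x) - \<psi> x) / h * w x\<bar> \<le> real n)"
    ..
  from choice[OF this] obtain h where "\<forall>n. 0 < h n \<and> h n < 1 / real (Suc n) \<and>
      \<not> (AE x in M. \<bar>(\<psi> (\<Phi> (h n) x) - \<psi> x) / h n * w x\<bar> \<le> real n)" ..
  then have h: "\<And>n. 0 < h n" "\<And>n. h n < 1 / real (Suc n)"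
    "\<And>n. \<not> (AE x in M. \<bar>(\<psi> (\<Phi> (h n) x) - \<psi> x) / h n * w x\<bar> \<le> real n)"
    by blast+
  define g where "g n x = (\<psi> (\<Phi> (h n) x) - \<psi> x) / h n" for n x
  have "\<exists>K. \<forall>n. AE x in M. \<bar>g n x * w x\<bar> \<le> K"
  proof (rule weak_star_bounded_imp_uniformly_bounded)
    fix n
    have "g n = (\<lambda>x. (1 / h n) * \<psi> (\<Phi> (h n) x) + (- 1 / h n) * \<psi> x)"
      by (simp add: g_def fun_eq_iff diff_divide_distrib)
    then show "g n \<in> Linf \<Omega> w"
      using h(1)[of n] by (simp only:) (intro Linf_lincomb comp_flow_Linf \<psi>, simp)
  next
    fix \<rho> assume \<rho>: "\<rho> \<in> L1"
    have "h \<longlonglongrightarrow> 0"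
    proof (rule tendsto_sandwich[of "\<lambda>_. 0" _ _ "\<lambda>n. 1 / real (Suc n)"])
      show "(\<lambda>n. 1 / real (Suc n)) \<longlonglongrightarrow> 0" by (rule LIMSEQ_Suc[OF lim_1_over_n])
    qed (intro always_eventually allI less_imp_le h tendsto_const)+
    then have "filterlim h (at_right 0) sequentially"
      using h(1) by (auto simp: filterlim_at less_imp_neq[THEN not_sym] intro!: always_eventually)
    moreover have "((\<lambda>h. pairing \<Omega> w \<rho> (\<lambda>x. (\<psi> (\<Phi> h x) - \<psi> x) / h)) \<longlongrightarrow> pairing \<Omega> w \<rho> \<xi>) (at_right 0)"
      using gen \<rho> by (simp add: weak_star_generator_def comp_semigroup_def)
    ultimately have "(\<lambda>n. pairing \<Omega> w \<rho> (g n)) \<longlonglongrightarrow> pairing \<Omega> w \<rho> \<xi>"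
      unfolding g_def by (rule filterlim_compose[rotated])
    then have "Bseq (\<lambda>n. pairing \<Omega> w \<rho> (g n))" by (intro convergent_imp_Bseq convergentI)
    then show "\<exists>B. \<forall>n. \<bar>pairing \<Omega> w \<rho> (g n)\<bar> \<le> B" by (auto simp: Bseq_def)
  qed
  then obtain K where K: "\<And>n. AE x in M. \<bar>g n x * w x\<bar> \<le> K" by blast
  obtain n where "K \<le> real n" using real_arch_simple by blast
  then have "AE x in M. \<bar>g n x * w x\<bar> \<le> real n" using K[of n] by (auto elim!: eventually_mono)
  then show False using h(3)[of n] by (simp add: g_def)
qed

text \<open>The bound on the quotients is uniform in the density, and \<open>S t\<close> is uniformly bounded. So increments
  over a step \<open>h\<close> are \<open>O(h)\<close> at every starting time, which gives continuity from both sides.\<close>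

lemma generator_continuous:
  assumes gen: "weak_star_generator \<Omega> w \<Phi> \<psi> \<xi>" and \<rho>: "\<rho> \<in> L1"
  shows "continuous_on {0..} (\<lambda>t. pairing \<Omega> w \<rho> (\<lambda>x. \<psi> (\<Phi> t x)))" (is "continuous_on _ ?F")
proof -
  have \<psi>: "\<psi> \<in> Linf \<Omega> w" using gen by (simp add: weak_star_generator_def)
  obtain \<delta> K where \<delta>: "0 < \<delta>" and K: "0 \<le> K"
    "\<And>h. 0 < h \<Longrightarrow> h < \<delta> \<Longrightarrow> AE x in M. \<bar>(\<psi> (\<Phi> h x) - \<psi> x) / h * w x\<bar> \<le> K"
    by (rule generator_quotients_bounded[OF gen]) (rule that)
  define L where "L = K * (stability_const * N1 \<rho>)"
  have L: "0 \<le> L" using K stability_const(1) N1_nonneg by (simp add: L_def)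
  have step: "\<bar>?F (t + h) - ?F t\<bar> \<le> L * h" if t: "0 \<le> t" and h: "0 < h" "h < \<delta>" for t h
  proof -
    have m: "(\<lambda>x. (\<psi> (\<Phi> h x) - \<psi> x) / h) \<in> borel_measurable M"
      using comp_flow_measurable[OF Linf_measurable[OF \<psi>]] Linf_measurable[OF \<psi>] h by simp
    have "\<bar>(?F (t + h) - ?F t) / h\<bar> \<le> K * N1 (S t \<rho>)"
      unfolding pairing_flow_increment[OF \<rho> \<psi> t less_imp_le[OF h(1)]]
      by (rule pairing_integrand_bound(3)[OF S_L1[OF t \<rho>] m K(2)[OF h]])
    also have "\<dots> \<le> L" unfolding L_def using N1_S_le[OF t \<rho>] K(1) by (rule mult_left_mono)
    finally show ?thesis using h by (simp add: abs_divide pos_divide_le_eq)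
  qed
  have lip: "\<bar>?F s - ?F t\<bar> \<le> L * \<bar>s - t\<bar>" if "0 \<le> s" "0 \<le> t" "\<bar>s - t\<bar> < \<delta>" for s t
  proof -
    consider "s = t" | "s < t" | "t < s" by linarith
    then show ?thesis
    proof cases
      case 2 then show ?thesis using step[of s "t - s"] that by (simp add: abs_minus_commute)
    next
      case 3 then show ?thesis using step[of t "s - t"] that by simp
    qed simp
  qed
  show ?thesis unfolding continuous_on_iff
  proof safe
    fix t e :: real assume t: "0 \<le> t" and e: "0 < e"
    show "\<exists>d>0. \<forall>s\<in>{0..}. dist s t < d \<longrightarrow> dist (?F s) (?F t) < e"
    proof (intro exI conjI ballI impI)
      show "0 < min \<delta> (e / (L + 1))" using \<delta> e L by simp
      fix s assume s: "s \<in> {0..}" "dist s t < min \<delta> (e / (L + 1))"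
      then have "\<bar>?F s - ?F t\<bar> \<le> L * \<bar>s - t\<bar>" using t by (intro lip) (auto simp: dist_real_def)
      also have "\<dots> \<le> (L + 1) * \<bar>s - t\<bar>" by (intro mult_right_mono) auto
      also have "\<dots> < e" using s L by (simp add: dist_real_def pos_less_divide_eq mult.commute)
      finally show "dist (?F s) (?F t) < e" by (simp add: dist_real_def)
    qed
  qed
qed

end

section \<open>Rates of convergence\<close>

lemma integrable_exp_decay:
  assumes "(a::real) < 0"
  shows "integrable lborel (\<lambda>t. indicator {0..} t * exp (a * t))"
proof -
  have "set_integrable lebesgue {0..} (\<lambda>t. exp (a * t))"
    using integrable_on_exp_minus_to_infinity[of "- a" 0] assms
    by (intro nonnegative_absolutely_integrable_1) auto
  then show ?thesis
    by (simp add: set_integrable_def integrable_completion)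
qed

text \<open>This turns Bessel's inequality together with a bound on its defect into Parseval's identity.\<close>

lemma sums_of_vanishing_defect:
  fixes a :: "nat \<Rightarrow> real"
  assumes upper: "\<And>N. (\<Sum>n<N. a n) \<le> L"
    and lower: "\<And>b N. K * 4 ^ Suc b \<le> N \<Longrightarrow> L - (\<Sum>n<N. a n) \<le> B * (1 / 4) ^ (b * m)"
    and m: "0 < m"
  shows "a sums L"
  unfolding sums_def
proof (rule LIMSEQ_I)
  fix e :: real assume e: "0 < e"
  have "(\<lambda>b. B * ((1 / 4) ^ m) ^ b) \<longlonglongrightarrow> B * 0"
    using m by (intro tendsto_mult tendsto_const LIMSEQ_power_zero) (auto simp: power_one_over power_less_one_iff divide_less_eq)
  then have "eventually (\<lambda>b. B * ((1 / 4) ^ m) ^ b < e) sequentially"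
    using e by (intro order_tendstoD(2)) auto
  then obtain b where "B * ((1 / 4) ^ m) ^ b < e" unfolding eventually_sequentially by blast
  then have b: "B * (1 / 4) ^ (b * m) < e" by (simp add: power_mult[symmetric] mult.commute)
  show "\<exists>N. \<forall>n\<ge>N. norm ((\<Sum>i<n. a i) - L) < e"
  proof (intro exI allI impI)
    fix N assume "K * 4 ^ Suc b \<le> N"
    then show "norm ((\<Sum>i<N. a i) - L) < e" using lower[of b N] upper[of N] b by simp
  qed
qed

text \<open>A bound for the initial segments of length \<open>K 4\<^sup>b\<^sup>+\<^sup>1\<close> gives a rate in \<open>N\<close>, since every large \<open>N\<close>
  lies within a factor four of such a length.\<close>

lemma bigo_from_levels:
  fixes T :: "nat \<Rightarrow> real"
  assumes K: "0 < K" and nonneg: "\<And>N. 0 \<le> T N"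
    and level: "\<And>b N. K * 4 ^ Suc b \<le> N \<Longrightarrow> T N \<le> B * (1 / 4) ^ (b * m)"
  shows "T \<in> O(\<lambda>N. real N powr (- real m))"
proof (rule bigoI[where c = "B * (16 * real K) ^ m"])
  have "T N \<le> B * (16 * real K) ^ m * real N powr (- real m)" if N: "4 * K \<le> N" for N
  proof -
    have "4 \<le> N div K" using div_le_mono[OF N, of K] K by simp
    then obtain n where n: "4 ^ n \<le> N div K" "N div K < 4 ^ (n + 1)"
      using ex_power_ivl1[of 4 "N div K"] by auto
    have "n \<noteq> 0" using n(2) \<open>4 \<le> N div K\<close> by (cases n) auto
    then obtain b where b: "n = Suc b" by (cases n) auto
    have low: "K * 4 ^ Suc b \<le> N"
      using n(1) K unfolding b by (metis less_eq_div_iff_mult_less_eq mult.commute)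
    have "N < 4 ^ (n + 1) * K" using n(2) K by (metis less_mult_imp_div_less div_less_iff_less_mult)
    then have "real N < real (4 ^ (n + 1) * K)" by (simp only: of_nat_less_iff)
    then have high: "real N < 16 * real K * 4 ^ b" by (simp add: b mult_ac)
    have N0: "0 < real N" using N K by simp
    have "0 \<le> B"
    proof -
      have "0 \<le> B * (1 / 4) ^ (b * m)" using nonneg[of N] level[OF low] by linarith
      then show ?thesis using mult_neg_pos[of B "(1 / 4) ^ (b * m)"] by force
    qed
    have "real N ^ m \<le> (16 * real K * 4 ^ b) ^ m" using high by (intro power_mono) auto
    then have "real N ^ m \<le> (16 * real K) ^ m * 4 ^ (b * m)" by (simp only: power_mult_distrib power_mult)
    then have "(1 / 4) ^ (b * m) * real N ^ m \<le> (1 / 4) ^ (b * m) * ((16 * real K) ^ m * 4 ^ (b * m))"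
      by (intro mult_left_mono) auto
    also have "\<dots> = (16 * real K) ^ m * ((1 / 4) * 4) ^ (b * m)" by (simp only: power_mult_distrib mult_ac)
    finally have "(1 / 4) ^ (b * m) * real N ^ m \<le> (16 * real K) ^ m" by simp
    then have "(1 / 4) ^ (b * m) \<le> (16 * real K) ^ m / real N ^ m"
      using N0 by (subst pos_le_divide_eq) auto
    then have "B * (1 / 4) ^ (b * m) \<le> B * ((16 * real K) ^ m / real N ^ m)"
      using \<open>0 \<le> B\<close> by (rule mult_left_mono)
    moreover have "real N powr (- real m) = 1 / real N ^ m"
      using N0 by (simp add: powr_minus powr_realpow inverse_eq_divide)
    ultimately show ?thesis using level[OF low] by simp
  qed
  then show "eventually (\<lambda>N. norm (T N) \<le> B * (16 * real K) ^ m * norm (real N powr (- real m))) sequentially"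
    unfolding eventually_sequentially using nonneg by (intro exI[of _ "4 * K"]) auto
qed

lemma borel_measurable_vec_lambda:
  fixes f :: "'i::finite \<Rightarrow> 'a \<Rightarrow> real"
  assumes "\<And>i. f i \<in> borel_measurable N"
  shows "(\<lambda>x. \<chi> i. f i x) \<in> borel_measurable N"
  using assms by (subst borel_measurable_euclidean_space) (auto simp: Basis_vec_def inner_axis)

lemma pw_poly_scaleR:
  "c *\<^sub>R pw_poly m b y t = pw_poly m b (\<lambda>j q. c *\<^sub>R y j q) t"
  by (simp add: pw_poly_def scaleR_sum_right mult.commute)

context composition_semigroup
begin

text \<open>Joint measurability in time and space is needed for Fubini's theorem. A Borel function composed
  with the jointly continuous flow has it, a representative that is only Lebesgue measurable in
  general does not. One Borel function serves for all times, because the flow avoids its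
  exceptional set at each time.\<close>

definition borel_rep :: "('a \<Rightarrow> real) \<Rightarrow> 'a \<Rightarrow> real" where
  "borel_rep \<psi> = (SOME \<psi>'. \<psi>' \<in> borel_measurable borel \<and>
     (\<forall>t\<ge>0. AE x in M. \<psi> (\<Phi> t x) = \<psi>' (\<Phi> t x)))"

lemma borel_rep:
  assumes "\<psi> \<in> borel_measurable M"
  shows "borel_rep \<psi> \<in> borel_measurable borel" "\<And>t. 0 \<le> t \<Longrightarrow> AE x in M. \<psi> (\<Phi> t x) = borel_rep \<psi> (\<Phi> t x)"
proof -
  have "\<exists>\<psi>'. \<psi>' \<in> borel_measurable borel \<and> (\<forall>t\<ge>0. AE x in M. \<psi> (\<Phi> t x) = \<psi>' (\<Phi> t x))"
  proof (rule borel_version[OF assms])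
    fix \<psi>' N assume *: "\<psi>' \<in> borel_measurable borel" "N \<in> sets borel" "AE x in M. x \<notin> N"
      "\<And>x. x \<in> \<Omega> \<Longrightarrow> x \<notin> N \<Longrightarrow> \<psi> x = \<psi>' x"
    then have "\<forall>t\<ge>0. AE x in M. \<psi> (\<Phi> t x) = \<psi>' (\<Phi> t x)"
      by (intro allI impI comp_flow_AE_eq[of N \<psi> \<psi>']) auto
    then show ?thesis using * by blast
  qed
  from someI_ex[OF this] show "borel_rep \<psi> \<in> borel_measurable borel"
    "\<And>t. 0 \<le> t \<Longrightarrow> AE x in M. \<psi> (\<Phi> t x) = borel_rep \<psi> (\<Phi> t x)"
    unfolding borel_rep_def by auto
qed

definition orbit_value :: "('a \<Rightarrow> real) \<Rightarrow> real \<Rightarrow> 'a \<Rightarrow> real" where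
  "orbit_value \<psi> t x = (if 0 \<le> t \<and> x \<in> \<Omega> then borel_rep \<psi> (\<Phi> t x) else 0)"

lemma orbit_value_measurable_pair:
  assumes "\<psi> \<in> borel_measurable M"
  shows "(\<lambda>(t, x). orbit_value \<psi> t x) \<in> borel_measurable (lborel \<Otimes>\<^sub>M M)"
proof -
  note [measurable] = borel_rep(1)[OF assms]
  have D [measurable]: "{0::real..} \<times> \<Omega> \<in> sets borel"
    using open_domain by (intro borel_Times) (auto simp: borel_open)
  have "(\<lambda>p. indicator ({0..} \<times> \<Omega>) p *\<^sub>R (case p of (t, x) \<Rightarrow> \<Phi> t x)) \<in> borel_measurable borel"
    by (rule borel_measurable_continuous_on_indicator[OF D flow_continuous])
  then have [measurable]: "(\<lambda>p. indicator ({0..} \<times> \<Omega>) p *\<^sub>R (case p of (t, x) \<Rightarrow> \<Phi> t x)) \<in> borel_measurable (borel \<Otimes>\<^sub>M borel)"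
    unfolding borel_prod .
  have [measurable]: "(\<lambda>x. x) \<in> M \<rightarrow>\<^sub>M borel"
    by (intro borel_imp_measurable_M) simp
  have id: "(\<lambda>p. (fst p, snd p)) \<in> lborel \<Otimes>\<^sub>M M \<rightarrow>\<^sub>M borel \<Otimes>\<^sub>M borel"
  proof (rule measurable_Pair)
    show "fst \<in> lborel \<Otimes>\<^sub>M M \<rightarrow>\<^sub>M borel" by measurable
    show "snd \<in> lborel \<Otimes>\<^sub>M M \<rightarrow>\<^sub>M borel"
      using measurable_compose[OF measurable_snd[of lborel M], of "\<lambda>x. x" borel] by simp
  qed
  have D': "{0::real..} \<times> \<Omega> \<in> sets (borel \<Otimes>\<^sub>M borel)" using D unfolding borel_prod .
  have "(\<lambda>p. indicator ({0..} \<times> \<Omega>) p * borel_rep \<psi> (indicator ({0..} \<times> \<Omega>) p *\<^sub>R (case p of (t, x) \<Rightarrow> \<Phi> t x)))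
    \<in> borel_measurable (borel \<Otimes>\<^sub>M borel)"
    using D' by measurable
  from measurable_compose[OF id this] show ?thesis
    by (rule back_subst[of "\<lambda>f. f \<in> _"]) (auto simp: orbit_value_def fun_eq_iff indicator_def)
qed

lemma orbit_value_eq:
  assumes "\<psi> \<in> borel_measurable M" "0 \<le> t"
  shows "AE x in M. orbit_value \<psi> t x = \<psi> (\<Phi> t x)"
  using borel_rep(2)[OF assms] AE_space by eventually_elim (simp add: orbit_value_def assms(2))

lemma orbit_value_measurable: "\<psi> \<in> borel_measurable M \<Longrightarrow> orbit_value \<psi> t \<in> borel_measurable M"
  using measurable_compose[OF measurable_Pair1'[of t lborel M] orbit_value_measurable_pair] by simp

lemma orbit_value_Linf:
  assumes "\<psi> \<in> Linf \<Omega> w" shows "orbit_value \<psi> t \<in> Linf \<Omega> w"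
proof (cases "0 \<le> t")
  case True
  have "\<psi> \<in> borel_measurable M" by (rule Linf_measurable[OF assms])
  note eq = orbit_value_eq[OF this True]
  obtain K where "0 \<le> K" "AE x in M. \<bar>\<psi> (\<Phi> t x) * w x\<bar> \<le> K"
    using comp_flow_Linf[OF assms True] by (auto simp: Linf_iff)
  moreover from this(2) eq have "AE x in M. \<bar>orbit_value \<psi> t x * w x\<bar> \<le> K"
    by eventually_elim simp
  ultimately have "0 \<le> K" "AE x in M. \<bar>orbit_value \<psi> t x * w x\<bar> \<le> K" by auto
  then show ?thesis using orbit_value_measurable[OF Linf_measurable[OF assms]] by (auto simp: Linf_iff)
next
  case False
  then have "orbit_value \<psi> t = (\<lambda>_. 0)" by (simp add: orbit_value_def fun_eq_iff)
  then show ?thesis by (auto simp: Linf_iff)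
qed

lemma pairing_orbit_value:
  assumes "\<psi> \<in> Linf \<Omega> w" "\<rho> \<in> L1" "0 \<le> t"
  shows "pairing \<Omega> w \<rho> (orbit_value \<psi> t) = pairing \<Omega> w \<rho> (\<lambda>x. \<psi> (\<Phi> t x))"
  using orbit_value_eq[OF Linf_measurable[OF assms(1)] assms(3)] L1_measurable[OF assms(2)]
    orbit_value_measurable[OF Linf_measurable[OF assms(1)]] comp_flow_measurable[OF Linf_measurable[OF assms(1)] assms(3)]
  by (rule pairing_cong_AE)

end

section \<open>Smooth observations along the orbits\<close>

text \<open>The functions \<open>\<Psi> i q\<close> are the images of \<open>c i\<close> under the powers of the generator.\<close>

locale observed_semigroup = composition_semigroup +
  fixes c :: "'r::finite \<Rightarrow> 'a \<Rightarrow> real" and \<Psi> :: "'r \<Rightarrow> nat \<Rightarrow> 'a \<Rightarrow> real" and m :: nat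
  assumes m_pos: "0 < m"
    and chain_0: "\<And>i. \<Psi> i 0 = c i"
    and chain: "\<And>i q. q < m \<Longrightarrow> weak_star_generator \<Omega> w \<Phi> (\<Psi> i q) (\<Psi> i (Suc q))"
begin

lemma chain_Linf: "q \<le> m \<Longrightarrow> \<Psi> i q \<in> Linf \<Omega> w"
proof (cases "q < m")
  case True then show ?thesis using chain by (auto simp: weak_star_generator_def)
next
  case False assume "q \<le> m"
  then show ?thesis using False m_pos chain[of "m - 1" i] by (auto simp: weak_star_generator_def)
qed

definition observed :: "('a \<Rightarrow> real) \<Rightarrow> nat \<Rightarrow> real \<Rightarrow> real ^ 'r" where
  "observed \<rho> q t = (\<chi> i. pairing \<Omega> w \<rho> (\<lambda>x. \<Psi> i q (\<Phi> t x)))"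

lemma observed_continuous: "\<rho> \<in> L1 \<Longrightarrow> q < m \<Longrightarrow> continuous_on {0..} (observed \<rho> q)"
  unfolding observed_def by (intro continuous_on_vec_lambda generator_continuous[OF chain])

lemma observed_right_derivative:
  assumes "\<rho> \<in> L1" "q < m" "0 \<le> t"
  shows "((\<lambda>h. (observed \<rho> q (t + h) - observed \<rho> q t) /\<^sub>R h) \<longlongrightarrow> observed \<rho> (Suc q) t) (at_right 0)"
proof (rule vec_tendstoI)
  fix i
  show "((\<lambda>h. ((observed \<rho> q (t + h) - observed \<rho> q t) /\<^sub>R h) $ i) \<longlongrightarrow> observed \<rho> (Suc q) t $ i) (at_right 0)"
    using generator_right_derivative[OF chain[OF assms(2), of i] assms(1,3)]
    by (simp add: observed_def divide_inverse mult.commute)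
qed

definition obs_bound :: real where
  "obs_bound = (SOME K. 0 \<le> K \<and> (\<forall>i. \<forall>q\<le>m. AE x in M. \<bar>\<Psi> i q x * w x\<bar> \<le> K))"

lemma obs_bound: "0 \<le> obs_bound" "\<And>i q. q \<le> m \<Longrightarrow> AE x in M. \<bar>\<Psi> i q x * w x\<bar> \<le> obs_bound"
proof -
  have "\<forall>p. \<exists>K. snd p \<le> m \<longrightarrow> 0 \<le> K \<and> (AE x in M. \<bar>\<Psi> (fst p) (snd p) x * w x\<bar> \<le> K)"
    using chain_Linf by (auto simp: Linf_iff)
  from choice[OF this] obtain k
    where k: "\<And>i q. q \<le> m \<Longrightarrow> 0 \<le> k (i, q) \<and> (AE x in M. \<bar>\<Psi> i q x * w x\<bar> \<le> k (i, q))" by auto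
  define K where "K = (\<Sum>p\<in>UNIV \<times> {..m}. k p)"
  have "0 \<le> K" unfolding K_def using k by (intro sum_nonneg) auto
  moreover have "AE x in M. \<bar>\<Psi> i q x * w x\<bar> \<le> K" if q: "q \<le> m" for i q
  proof -
    have "k (i, q) \<le> K" unfolding K_def using k q by (intro member_le_sum) auto
    then show ?thesis using k[OF q, of i] by (auto elim!: eventually_mono)
  qed
  ultimately have "\<exists>K. 0 \<le> K \<and> (\<forall>i. \<forall>q\<le>m. AE x in M. \<bar>\<Psi> i q x * w x\<bar> \<le> K)" by blast
  from someI_ex[OF this] show "0 \<le> obs_bound" "\<And>i q. q \<le> m \<Longrightarrow> AE x in M. \<bar>\<Psi> i q x * w x\<bar> \<le> obs_bound"
    unfolding obs_bound_def by auto
qed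

definition decay_const :: real where
  "decay_const = real CARD('r) * (obs_bound * stability_const)"

lemma decay_const_nonneg: "0 \<le> decay_const"
  using obs_bound(1) stability_const(1) by (simp add: decay_const_def)

lemma observed_bound:
  assumes \<rho>: "\<rho> \<in> L1" and q: "q \<le> m" and t: "0 \<le> t"
  shows "norm (observed \<rho> q t) \<le> (decay_const * N1 \<rho>) * exp (\<omega> * t)"
proof -
  have "norm (observed \<rho> q t) \<le> (\<Sum>i\<in>UNIV. \<bar>observed \<rho> q t $ i\<bar>)" by (rule norm_le_l1_cart)
  also have "\<dots> \<le> (\<Sum>i\<in>(UNIV::'r set). obs_bound * stability_const * exp (\<omega> * t) * N1 \<rho>)"
  proof (rule sum_mono)
    fix i
    show "\<bar>observed \<rho> q t $ i\<bar> \<le> obs_bound * stability_const * exp (\<omega> * t) * N1 \<rho>"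
      using pairing_flow_bound[OF \<rho> Linf_measurable[OF chain_Linf[OF q]] obs_bound(1) obs_bound(2)[OF q] t, of i]
      by (simp add: observed_def)
  qed
  finally show ?thesis by (simp add: decay_const_def mult_ac)
qed

definition approx_const :: real where
  "approx_const = (exp (- \<omega>) + fact m / (- \<omega>) ^ m) * decay_const"

lemma approx_const_nonneg: "0 \<le> approx_const"
  using decay_const_nonneg rate_neg by (simp add: approx_const_def)

abbreviation taylor :: "nat \<Rightarrow> (nat \<Rightarrow> real \<Rightarrow> real ^ 'r) \<Rightarrow> real \<Rightarrow> real ^ 'r" where
  "taylor b F \<equiv> pw_poly m b (\<lambda>j q. F q (real j / 2 ^ b) /\<^sub>R fact q)"

text \<open>The norm of \<open>\<rho>\<close> enters linearly, which is what duality needs.\<close>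

lemma observed_approximation:
  assumes \<rho>: "\<rho> \<in> L1" and t: "0 \<le> t"
  shows "norm (observed \<rho> 0 t - taylor b (observed \<rho>) t)
    \<le> approx_const * (1 / 2) ^ (b * m) * exp (\<omega> / 2 * t) * N1 \<rho>"
  using pw_poly_approximation[OF rate_neg, of m "observed \<rho>" "decay_const * N1 \<rho>" t b]
    observed_continuous[OF \<rho>] observed_right_derivative[OF \<rho>] observed_bound[OF \<rho>] t
  by (simp add: approx_const_def mult_ac)

definition orbit :: "nat \<Rightarrow> real \<Rightarrow> 'a \<Rightarrow> real ^ 'r" where
  "orbit q t x = (\<chi> i. orbit_value (\<Psi> i q) t x)"

text \<open>The Taylor polynomials are built from the values of the iterated generator along the orbit. No
  orbit is differentiated: the error is estimated by duality from the paired functions.\<close>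

definition orbit_error :: "nat \<Rightarrow> real \<Rightarrow> 'a \<Rightarrow> real ^ 'r" where
  "orbit_error b t x = orbit 0 t x - taylor b (\<lambda>q s. orbit q s x) t"

lemma orbit_measurable_pair:
  assumes "q \<le> m"
  shows "(\<lambda>(t, x). orbit q t x) \<in> borel_measurable (lborel \<Otimes>\<^sub>M M)"
  using orbit_value_measurable_pair[OF Linf_measurable[OF chain_Linf[OF assms]]]
  by (simp add: orbit_def case_prod_beta' borel_measurable_vec_lambda)

lemma orbit_error_measurable_pair:
  "(\<lambda>(t, x). orbit_error b t x) \<in> borel_measurable (lborel \<Otimes>\<^sub>M M)"
proof -
  have o: "(\<lambda>p :: real \<times> 'a. orbit q (real (nat \<lfloor>fst p * 2 ^ b\<rfloor>) / 2 ^ b) (snd p)) \<in> borel_measurable (lborel \<Otimes>\<^sub>M M)" if q: "q \<le> m" for q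
  proof -
    have "(\<lambda>p :: real \<times> 'a. (real (nat \<lfloor>fst p * 2 ^ b\<rfloor>) / 2 ^ b, snd p)) \<in> lborel \<Otimes>\<^sub>M M \<rightarrow>\<^sub>M lborel \<Otimes>\<^sub>M M"
    proof (rule measurable_Pair)
      have "(\<lambda>p :: real \<times> 'a. real (nat \<lfloor>fst p * 2 ^ b\<rfloor>) / 2 ^ b) \<in> lborel \<Otimes>\<^sub>M M \<rightarrow>\<^sub>M borel"
        by measurable
      then show "(\<lambda>p :: real \<times> 'a. real (nat \<lfloor>fst p * 2 ^ b\<rfloor>) / 2 ^ b) \<in> lborel \<Otimes>\<^sub>M M \<rightarrow>\<^sub>M lborel"
        by simp
    qed (rule measurable_snd)
    from measurable_compose[OF this orbit_measurable_pair[OF q]] show ?thesis by simp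
  qed
  have o0: "(\<lambda>p :: real \<times> 'a. orbit 0 (fst p) (snd p)) \<in> borel_measurable (lborel \<Otimes>\<^sub>M M)"
    using orbit_measurable_pair[of 0] by (simp add: case_prod_beta')
  have s: "(\<lambda>p :: real \<times> 'a. \<Sum>q<m. (fst p - real (nat \<lfloor>fst p * 2 ^ b\<rfloor>) / 2 ^ b) ^ q *\<^sub>R (orbit q (real (nat \<lfloor>fst p * 2 ^ b\<rfloor>) / 2 ^ b) (snd p) /\<^sub>R fact q))
     \<in> borel_measurable (lborel \<Otimes>\<^sub>M M)"
  proof (rule borel_measurable_sum)
    fix q assume "q \<in> {..<m}"
    then have [measurable]: "(\<lambda>p :: real \<times> 'a. orbit q (real (nat \<lfloor>fst p * 2 ^ b\<rfloor>) / 2 ^ b) (snd p)) \<in> borel_measurable (lborel \<Otimes>\<^sub>M M)"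
      by (intro o) auto
    show "(\<lambda>p :: real \<times> 'a. (fst p - real (nat \<lfloor>fst p * 2 ^ b\<rfloor>) / 2 ^ b) ^ q *\<^sub>R (orbit q (real (nat \<lfloor>fst p * 2 ^ b\<rfloor>) / 2 ^ b) (snd p) /\<^sub>R fact q))
     \<in> borel_measurable (lborel \<Otimes>\<^sub>M M)"
      by measurable
  qed
  note [measurable] = s o0
  show ?thesis unfolding orbit_error_def pw_poly_def case_prod_beta' by measurable
qed

lemma pairing_orbit:
  "q \<le> m \<Longrightarrow> \<rho> \<in> L1 \<Longrightarrow> 0 \<le> t \<Longrightarrow> pairing \<Omega> w \<rho> (\<lambda>x. orbit q t x $ i) = observed \<rho> q t $ i"
  using pairing_orbit_value[OF chain_Linf[of q i]] by (simp add: orbit_def observed_def)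

lemma orbit_Linf: "q \<le> m \<Longrightarrow> (\<lambda>x. orbit q t x $ i) \<in> Linf \<Omega> w"
  using orbit_value_Linf[OF chain_Linf[of q i]] by (simp add: orbit_def)

text \<open>Pairing with \<open>\<rho>\<close> commutes with the approximation, because it is a finite sum in which only
  the values along the orbit depend on the point.\<close>

lemma pw_orbit:
  fixes b t i
  defines "P \<equiv> (\<lambda>x. taylor b (\<lambda>q s. orbit q s x) t $ i)"
  shows "P \<in> Linf \<Omega> w" "\<rho> \<in> L1 \<Longrightarrow> pairing \<Omega> w \<rho> P = taylor b (observed \<rho>) t $ i"
proof -
  let ?a = "real (nat \<lfloor>t * 2 ^ b\<rfloor>) / 2 ^ b"
  have P: "P = (if 0 \<le> t \<and> t < 3 * 2 ^ b then (\<lambda>x. \<Sum>q<m. ((t - ?a) ^ q / fact q) * orbit q ?a x $ i) else (\<lambda>_. 0))"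
    by (auto simp: P_def pw_poly_def fun_eq_iff divide_inverse mult_ac)
  have Z: "(\<lambda>_. 0) \<in> Linf \<Omega> w" by (auto simp: Linf_iff)
  have "(\<lambda>x. \<Sum>q<m. ((t - ?a) ^ q / fact q) * orbit q ?a x $ i) \<in> Linf \<Omega> w"
    by (intro Linf_sum orbit_Linf) auto
  then show "P \<in> Linf \<Omega> w" using Z
    by (cases "0 \<le> t \<and> t < 3 * 2 ^ b") (simp_all only: P if_True if_False simp_thms)
  assume \<rho>: "\<rho> \<in> L1"
  have "pairing \<Omega> w \<rho> (\<lambda>x. \<Sum>q<m. ((t - ?a) ^ q / fact q) * orbit q ?a x $ i) = (\<Sum>q<m. ((t - ?a) ^ q / fact q) * observed \<rho> q ?a $ i)"
    by (subst pairing_sum_right[OF \<rho>]) (auto intro!: orbit_Linf sum.cong simp: pairing_orbit[OF _ \<rho>])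
  then show "pairing \<Omega> w \<rho> P = taylor b (observed \<rho>) t $ i"
    by (auto simp: P pw_poly_def pairing_def divide_inverse mult_ac)
qed

lemma orbit_error_bound_component:
  assumes t: "0 \<le> t"
  shows "AE x in M. \<bar>orbit_error b t x $ i * w x\<bar> \<le> approx_const * (1 / 2) ^ (b * m) * exp (\<omega> / 2 * t)"
proof (rule AE_bound_by_duality)
  let ?P = "\<lambda>x. taylor b (\<lambda>q s. orbit q s x) t $ i"
  have L: "(\<lambda>x. orbit 0 t x $ i) \<in> Linf \<Omega> w" "?P \<in> Linf \<Omega> w" by (auto intro: orbit_Linf pw_orbit)
  have eq: "(\<lambda>x. orbit_error b t x $ i) = (\<lambda>x. orbit 0 t x $ i - ?P x)" by (simp add: orbit_error_def)
  show "(\<lambda>x. orbit_error b t x $ i) \<in> borel_measurable M"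
    unfolding eq using L[THEN Linf_measurable] by measurable
  show "0 \<le> approx_const * (1 / 2) ^ (b * m) * exp (\<omega> / 2 * t)" using approx_const_nonneg by simp
  fix \<rho> assume \<rho>: "\<rho> \<in> L1"
  have p: "pairing \<Omega> w \<rho> (\<lambda>x. orbit_error b t x $ i)
      = (observed \<rho> 0 t - taylor b (observed \<rho>) t) $ i"
    unfolding eq by (subst pairing_diff_right[OF \<rho> L]) (simp add: pairing_orbit[OF _ \<rho> t] pw_orbit(2)[OF \<rho>])
  have "\<bar>pairing \<Omega> w \<rho> (\<lambda>x. orbit_error b t x $ i)\<bar>
      \<le> norm (observed \<rho> 0 t - taylor b (observed \<rho>) t)"
    unfolding p by (rule component_le_norm_cart)
  also have "\<dots> \<le> approx_const * (1 / 2) ^ (b * m) * exp (\<omega> / 2 * t) * N1 \<rho>"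
    by (rule observed_approximation[OF \<rho> t])
  finally show "\<bar>pairing \<Omega> w \<rho> (\<lambda>x. orbit_error b t x $ i)\<bar> \<le> approx_const * (1 / 2) ^ (b * m) * exp (\<omega> / 2 * t) * N1 \<rho>" .
qed

lemma norm_vec_AE_bound:
  fixes v :: "'a \<Rightarrow> real ^ 'r"
  assumes "\<And>i. AE x in M. \<bar>v x $ i * w x\<bar> \<le> K"
  shows "AE x in M. norm (v x) * w x \<le> real CARD('r) * K"
proof -
  have "AE x in M. \<forall>i\<in>UNIV. \<bar>v x $ i * w x\<bar> \<le> K"
    by (intro AE_finite_allI assms) auto
  then show ?thesis using AE_space
  proof eventually_elim
    case (elim x)
    have "norm (v x) * w x \<le> (\<Sum>i\<in>UNIV. \<bar>v x $ i\<bar>) * w x"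
      using elim w_nonneg by (intro mult_right_mono norm_le_l1_cart) auto
    also have "\<dots> = (\<Sum>i\<in>UNIV. \<bar>v x $ i * w x\<bar>)"
      using elim w_nonneg by (simp add: sum_distrib_right abs_mult)
    also have "\<dots> \<le> (\<Sum>i\<in>(UNIV::'r set). K)" using elim by (intro sum_mono) auto
    finally show ?case by simp
  qed
qed

text \<open>The rate is halved, as in the approximation error; the orbits themselves decay even faster.\<close>

definition envelope :: "real \<Rightarrow> real" where
  "envelope t = indicator {0..} t * exp (\<omega> / 2 * t)"

definition error_const :: real where
  "error_const = real CARD('r) * approx_const"

lemma orbit_error_bound:
  "AE x in M. norm (orbit_error b t x) * w x \<le> error_const * (1 / 2) ^ (b * m) * envelope t"
proof (cases "0 \<le> t")
  case True
  then show ?thesis using norm_vec_AE_bound[OF orbit_error_bound_component[OF True]]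
    by (simp add: error_const_def envelope_def mult_ac)
next
  case False
  then have "orbit_error b t x = 0" for x
    by (simp add: orbit_error_def orbit_def orbit_value_def pw_poly_def vec_eq_iff)
  then show ?thesis using False by (simp add: envelope_def)
qed

lemma orbit_bound:
  "AE x in M. norm (orbit 0 t x) * w x \<le> decay_const * envelope t"
proof (cases "0 \<le> t")
  case True
  have "AE x in M. \<bar>orbit 0 t x $ i * w x\<bar> \<le> obs_bound * (stability_const * exp (\<omega> * t))" for i
  proof -
    have \<Psi>: "\<Psi> i 0 \<in> borel_measurable M" by (rule Linf_measurable[OF chain_Linf]) simp
    have "AE x in M. \<bar>\<Psi> i 0 x * w x\<bar> \<le> obs_bound" by (rule obs_bound(2)) simp
    from comp_flow_bound[OF \<Psi> obs_bound(1) this True] orbit_value_eq[OF \<Psi> True]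
    show ?thesis by eventually_elim (simp add: orbit_def)
  qed
  from norm_vec_AE_bound[OF this]
  have "AE x in M. norm (orbit 0 t x) * w x \<le> decay_const * exp (\<omega> * t)"
    by (simp add: decay_const_def mult_ac)
  moreover have "decay_const * exp (\<omega> * t) \<le> decay_const * envelope t"
    using True rate_neg decay_const_nonneg by (simp add: envelope_def mult_left_mono mult_nonpos_nonneg)
  ultimately show ?thesis by (auto elim!: eventually_mono)
next
  case False
  then have "orbit 0 t x = 0" for x by (simp add: orbit_def orbit_value_def vec_eq_iff)
  then show ?thesis using False by (simp add: envelope_def)
qed

sublocale T: pair_sigma_finite lborel M ..

text \<open>The bounds hold for every time outside a null set that depends on the time. For almost every
  point they hold at almost all times.\<close>

lemma AE_swap_bound:
  fixes v :: "real \<Rightarrow> 'a \<Rightarrow> real ^ 'r"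
  assumes v: "(\<lambda>(t, x). v t x) \<in> borel_measurable (lborel \<Otimes>\<^sub>M M)"
    and b: "b \<in> borel_measurable borel" and bound: "\<And>t. AE x in M. norm (v t x) * w x \<le> b t"
  shows "AE x in M. AE t in lborel. norm (v t x) * w x \<le> b t"
proof (subst T.AE_commute[symmetric])
  have v' [measurable]: "(\<lambda>p. v (fst p) (snd p)) \<in> borel_measurable (lborel \<Otimes>\<^sub>M M)"
    using v by (simp add: case_prod_beta')
  have [measurable]: "(\<lambda>p. w (snd p)) \<in> borel_measurable (lborel \<Otimes>\<^sub>M M)"
    by (rule measurable_compose[OF measurable_snd w_measurable])
  have [measurable]: "(\<lambda>p. b (fst p)) \<in> borel_measurable (lborel \<Otimes>\<^sub>M M)"
    using b by (intro measurable_compose[OF measurable_fst[of lborel M]]) simp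
  show "{p \<in> space (lborel \<Otimes>\<^sub>M M). norm (v (fst p) (snd p)) * w (snd p) \<le> b (fst p)} \<in> sets (lborel \<Otimes>\<^sub>M M)"
    by (intro borel_measurable_le) measurable
  show "AE t in lborel. AE x in M. norm (v t x) * w x \<le> b t" using bound by simp
qed

end

context observed_semigroup
begin

lemma envelope_measurable [measurable]: "envelope \<in> borel_measurable borel"
  unfolding envelope_def by measurable

lemma envelope_nonneg: "0 \<le> envelope t" by (simp add: envelope_def)

lemma envelope_square_integrable: "integrable lborel (\<lambda>t. (envelope t)\<^sup>2)"
proof -
  have "(envelope t)\<^sup>2 = indicator {0..} t * exp (\<omega> * t)" for t
    by (simp add: envelope_def power_mult_distrib exp_double[symmetric] indicator_def)
  then show ?thesis using integrable_exp_decay[OF rate_neg] by simp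
qed

definition energy where "energy = (LINT t|lborel. (envelope t)\<^sup>2)"

lemma energy_nonneg: "0 \<le> energy" by (simp add: energy_def integral_nonneg)

lemma L2_of_envelope:
  fixes g :: "real \<Rightarrow> real ^ 'r"
  assumes g: "g \<in> borel_measurable borel" and bound: "AE t in lborel. norm (g t) \<le> C * envelope t"
  shows "square_integrable lborel g" "L2_inner lborel g g \<le> C\<^sup>2 * energy"
proof -
  have b: "AE t in lborel. (norm (g t))\<^sup>2 \<le> C\<^sup>2 * (envelope t)\<^sup>2"
    using bound
  proof eventually_elim
    case (elim t)
    then have "(norm (g t))\<^sup>2 \<le> (C * envelope t)\<^sup>2" by (intro power_mono) auto
    then show ?case by (simp add: power_mult_distrib)
  qed
  have i: "integrable lborel (\<lambda>t. C\<^sup>2 * (envelope t)\<^sup>2)" using envelope_square_integrable by simp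
  have "integrable lborel (\<lambda>t. (norm (g t))\<^sup>2)"
  proof (rule Bochner_Integration.integrable_bound[OF i])
    show "(\<lambda>t. (norm (g t))\<^sup>2) \<in> borel_measurable lborel" using g by measurable
    show "AE t in lborel. norm ((norm (g t))\<^sup>2) \<le> norm (C\<^sup>2 * (envelope t)\<^sup>2)"
      using b by eventually_elim simp
  qed
  then show s: "square_integrable lborel g" using g by (simp add: square_integrable_def)
  have "L2_inner lborel g g = (LINT t|lborel. (norm (g t))\<^sup>2)" by (simp add: L2_inner_def power2_norm_eq_inner)
  also have "\<dots> \<le> (LINT t|lborel. C\<^sup>2 * (envelope t)\<^sup>2)"
    using s i b by (intro integral_mono_AE) (auto simp: square_integrable_def)
  finally show "L2_inner lborel g g \<le> C\<^sup>2 * energy" by (simp add: energy_def)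
qed

section \<open>Expansion of the value form\<close>

definition signal :: "('a \<Rightarrow> real) \<Rightarrow> real \<Rightarrow> real ^ 'r" where
  "signal \<rho> t = indicator {0..} t *\<^sub>R observed \<rho> 0 t"

lemma signal_measurable: "\<rho> \<in> L1 \<Longrightarrow> signal \<rho> \<in> borel_measurable borel"
  unfolding signal_def
  by (intro borel_measurable_continuous_on_indicator observed_continuous m_pos) auto

lemma signal_square_integrable:
  assumes \<rho>: "\<rho> \<in> L1" shows "square_integrable lborel (signal \<rho>)"
proof (rule L2_of_envelope[OF signal_measurable[OF \<rho>]])
  have "norm (signal \<rho> t) \<le> (decay_const * N1 \<rho>) * envelope t" for t
  proof (cases "0 \<le> t")
    case True
    have "norm (signal \<rho> t) \<le> (decay_const * N1 \<rho>) * exp (\<omega> * t)"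
      using observed_bound[OF \<rho> _ True, of 0] True by (simp add: signal_def)
    also have "\<dots> \<le> (decay_const * N1 \<rho>) * envelope t"
      using True rate_neg decay_const_nonneg N1_nonneg[of \<rho>]
      by (intro mult_left_mono) (auto simp: envelope_def mult_nonpos_nonneg)
    finally show ?thesis .
  qed (simp add: signal_def envelope_def)
  then show "AE t in lborel. norm (signal \<rho> t) \<le> (decay_const * N1 \<rho>) * envelope t" by simp
qed

lemma pw_poly_measurable:
  fixes y :: "nat \<Rightarrow> nat \<Rightarrow> real ^ 'r"
  shows "pw_poly m b y \<in> borel_measurable borel"
proof -
  have "(\<lambda>t::real. y (nat \<lfloor>t * 2 ^ b\<rfloor>) q) \<in> borel_measurable borel" for q
  proof -
    have "(\<lambda>t::real. nat \<lfloor>t * 2 ^ b\<rfloor>) \<in> borel \<rightarrow>\<^sub>M count_space UNIV" by measurable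
    from measurable_compose[OF this, of "\<lambda>j. y j q" borel] show ?thesis by simp
  qed
  note [measurable] = this
  show ?thesis unfolding pw_poly_def[abs_def] by measurable
qed

lemma signal_approximation:
  fixes b :: nat
  assumes \<rho>: "\<rho> \<in> L1"
  defines "P \<equiv> taylor b (observed \<rho>)"
  shows "L2_inner lborel (\<lambda>t. signal \<rho> t - P t) (\<lambda>t. signal \<rho> t - P t)
    \<le> ((approx_const * N1 \<rho>)\<^sup>2 * energy) * (1 / 4) ^ (b * m)"
proof -
  have "norm (signal \<rho> t - P t) \<le> (approx_const * N1 \<rho> * (1 / 2) ^ (b * m)) * envelope t" for t
  proof (cases "0 \<le> t")
    case True
    then show ?thesis using observed_approximation[OF \<rho> True, of b]
      by (simp add: signal_def envelope_def P_def mult_ac)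
  qed (simp add: signal_def envelope_def P_def pw_poly_def)
  then have "L2_inner lborel (\<lambda>t. signal \<rho> t - P t) (\<lambda>t. signal \<rho> t - P t)
      \<le> (approx_const * N1 \<rho> * (1 / 2) ^ (b * m))\<^sup>2 * energy"
    using signal_measurable[OF \<rho>] pw_poly_measurable by (intro L2_of_envelope(2)) (auto simp: P_def)
  also have "(approx_const * N1 \<rho> * (1 / 2) ^ (b * m))\<^sup>2 = (approx_const * N1 \<rho>)\<^sup>2 * (1 / 4) ^ (b * m)"
    by (simp add: power_mult_distrib power2_eq_square flip: power_mult_distrib[of "1/2" "1/2" "b * m"])
  finally show ?thesis by (simp add: mult_ac)
qed

lemma signal_lincomb:
  assumes "\<rho> \<in> L1" "\<sigma> \<in> L1"
  shows "signal (\<lambda>x. a * \<rho> x + b * \<sigma> x) t = a *\<^sub>R signal \<rho> t + b *\<^sub>R signal \<sigma> t"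
proof (cases "0 \<le> t")
  case True
  then show ?thesis
    using pairing_lincomb[OF assms comp_flow_Linf[OF chain_Linf True]]
    by (simp add: signal_def observed_def vec_eq_iff)
qed (simp add: signal_def)

lemma orbit_slice_measurable: "q \<le> m \<Longrightarrow> x \<in> \<Omega> \<Longrightarrow> (\<lambda>t. orbit q t x) \<in> borel_measurable borel"
  using measurable_compose[OF measurable_Pair2'[of x M lborel] orbit_measurable_pair[of q]] by simp

definition coefficient :: "(nat \<Rightarrow> real \<Rightarrow> real ^ 'r) \<Rightarrow> nat \<Rightarrow> 'a \<Rightarrow> real" where
  "coefficient e n x = (LINT t|lborel. orbit 0 t x \<bullet> e n t)"

lemma coefficient_measurable:
  assumes "square_integrable lborel (e n)" shows "coefficient e n \<in> borel_measurable M"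
proof -
  note [measurable] = square_integrable_measurable[OF assms]
  have o: "(\<lambda>p. orbit 0 (fst p) (snd p)) \<in> borel_measurable (lborel \<Otimes>\<^sub>M M)"
    using orbit_measurable_pair[of 0] by (simp add: case_prod_beta')
  have sw: "(\<lambda>p. (snd p, fst p)) \<in> M \<Otimes>\<^sub>M lborel \<rightarrow>\<^sub>M lborel \<Otimes>\<^sub>M M"
    by (intro measurable_Pair measurable_fst measurable_snd)
  have o' [measurable]: "(\<lambda>p. orbit 0 (snd p) (fst p)) \<in> borel_measurable (M \<Otimes>\<^sub>M lborel)"
    using measurable_compose[OF sw o] by simp
  have e' [measurable]: "(\<lambda>p. e n (snd p)) \<in> borel_measurable (M \<Otimes>\<^sub>M lborel)"
    by (rule measurable_compose[OF measurable_snd square_integrable_measurable[OF assms]])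
  have "(\<lambda>(x, t). orbit 0 t x \<bullet> e n t) \<in> borel_measurable (M \<Otimes>\<^sub>M lborel)"
    unfolding case_prod_beta' by measurable
  then show ?thesis unfolding coefficient_def[abs_def]
    by (rule lborel.borel_measurable_lebesgue_integral)
qed

abbreviation weighted_taylor :: "nat \<Rightarrow> 'a \<Rightarrow> real \<Rightarrow> real ^ 'r" where
  "weighted_taylor b x \<equiv> pw_poly m b (\<lambda>j q. w x *\<^sub>R (orbit q (real j / 2 ^ b) x /\<^sub>R fact q))"

text \<open>What is needed about a single orbit: it is square integrable after multiplication with the weight,
  and its distance to the piecewise polynomials of level \<open>b\<close> is as small as that of the paired signals.\<close>

lemma AE_orbit_approximation:
  "AE x in M. square_integrable lborel (\<lambda>t. w x *\<^sub>R orbit 0 t x)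
     \<and> L2_inner lborel (\<lambda>t. w x *\<^sub>R orbit 0 t x) (\<lambda>t. w x *\<^sub>R orbit 0 t x) \<le> decay_const\<^sup>2 * energy
     \<and> (\<forall>b. L2_inner lborel (\<lambda>t. w x *\<^sub>R orbit 0 t x - weighted_taylor b x t) (\<lambda>t. w x *\<^sub>R orbit 0 t x - weighted_taylor b x t)
         \<le> (error_const\<^sup>2 * energy) * (1 / 4) ^ (b * m))"
proof -
  have A: "AE x in M. AE t in lborel. norm (orbit 0 t x) * w x \<le> decay_const * envelope t"
    by (rule AE_swap_bound[OF orbit_measurable_pair _ orbit_bound]) auto
  have "AE x in M. AE t in lborel. norm (orbit_error b t x) * w x \<le> error_const * (1 / 2) ^ (b * m) * envelope t" for b
    by (rule AE_swap_bound[OF orbit_error_measurable_pair _ orbit_error_bound]) auto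
  then have B: "AE x in M. \<forall>b. AE t in lborel. norm (orbit_error b t x) * w x \<le> error_const * (1 / 2) ^ (b * m) * envelope t"
    by (simp add: AE_all_countable)
  show ?thesis using A B AE_space
  proof eventually_elim
    case (elim x)
    then have x: "x \<in> \<Omega>" "0 \<le> w x" using w_nonneg by auto
    have m0: "(\<lambda>t. w x *\<^sub>R orbit 0 t x) \<in> borel_measurable borel"
      using orbit_slice_measurable[of 0 x] x by simp
    have n0: "AE t in lborel. norm (w x *\<^sub>R orbit 0 t x) \<le> decay_const * envelope t"
      using elim(1) x by (simp add: mult.commute)
    note I = L2_of_envelope[OF m0 n0]
    have III: "L2_inner lborel (\<lambda>t. w x *\<^sub>R orbit 0 t x - weighted_taylor b x t) (\<lambda>t. w x *\<^sub>R orbit 0 t x - weighted_taylor b x t)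
         \<le> (error_const\<^sup>2 * energy) * (1 / 4) ^ (b * m)" (is "L2_inner lborel ?g ?g \<le> _") for b
    proof -
      have eq: "?g t = w x *\<^sub>R orbit_error b t x" for t
        by (simp add: orbit_error_def scaleR_diff_right pw_poly_scaleR)
      have "AE t in lborel. norm (?g t) \<le> (error_const * (1 / 2) ^ (b * m)) * envelope t"
        unfolding eq using elim(2) x by (simp add: mult.commute)
      moreover have "?g \<in> borel_measurable borel" using m0 pw_poly_measurable by measurable
      ultimately have "L2_inner lborel ?g ?g \<le> (error_const * (1 / 2) ^ (b * m))\<^sup>2 * energy"
        by (intro L2_of_envelope(2))
      also have "(error_const * (1 / 2) ^ (b * m))\<^sup>2 = error_const\<^sup>2 * (1 / 4) ^ (b * m)"
        by (simp add: power_mult_distrib power2_eq_square flip: power_mult_distrib[of "1/2" "1/2" "b * m"])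
      finally show ?thesis by (simp add: mult_ac)
    qed
    show ?case using I III by blast
  qed
qed

lemma coefficient_eq_inner: "w x * coefficient e n x = L2_inner lborel (\<lambda>t. w x *\<^sub>R orbit 0 t x) (e n)"
  by (simp add: coefficient_def L2_inner_def)

text \<open>Fubini's theorem applies because, for each \<open>t\<close>, the integral over the domain is bounded by the
  envelope times the norm of \<open>e n t\<close>, a product of two square integrable functions.\<close>

lemma pairing_coefficient:
  assumes e: "square_integrable lborel (e n)" and \<rho>: "\<rho> \<in> L1"
  shows "pairing \<Omega> w \<rho> (coefficient e n) = L2_inner lborel (signal \<rho>) (e n)"
proof -
  define f where "f t x = \<rho> x * (orbit 0 t x \<bullet> e n t) * (w x)\<^sup>2" for t x
  note e_meas [measurable] = square_integrable_measurable[OF e]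
  have o [measurable]: "(\<lambda>p. orbit 0 (fst p) (snd p)) \<in> borel_measurable (lborel \<Otimes>\<^sub>M M)"
    using orbit_measurable_pair[of 0] by (simp add: case_prod_beta')
  have [measurable]: "(\<lambda>p. e n (fst p)) \<in> borel_measurable (lborel \<Otimes>\<^sub>M M)"
    by (rule measurable_compose[OF measurable_fst e_meas])
  have [measurable]: "(\<lambda>p. w (snd p)) \<in> borel_measurable (lborel \<Otimes>\<^sub>M M)"
    "(\<lambda>p. \<rho> (snd p)) \<in> borel_measurable (lborel \<Otimes>\<^sub>M M)"
    by (rule measurable_compose[OF measurable_snd w_measurable],
        rule measurable_compose[OF measurable_snd L1_measurable[OF \<rho>]])
  have f_meas: "case_prod f \<in> borel_measurable (lborel \<Otimes>\<^sub>M M)"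
    unfolding f_def case_prod_beta' by measurable
  have inner_sum: "(\<lambda>x. orbit 0 t x \<bullet> e n t) = (\<lambda>x. \<Sum>i\<in>UNIV. e n t $ i * orbit 0 t x $ i)" for t
    by (simp add: inner_vec_def mult.commute)
  have Linf: "(\<lambda>x. orbit 0 t x \<bullet> e n t) \<in> Linf \<Omega> w" for t
    unfolding inner_sum by (intro Linf_sum orbit_Linf) auto
  have bound: "AE x in M. \<bar>(orbit 0 t x \<bullet> e n t) * w x\<bar> \<le> decay_const * (envelope t * norm (e n t))" for t
    using orbit_bound[of t] AE_space
  proof eventually_elim
    case (elim x)
    then have w0: "0 \<le> w x" using w_nonneg by auto
    have "\<bar>(orbit 0 t x \<bullet> e n t) * w x\<bar> \<le> (norm (orbit 0 t x) * norm (e n t)) * w x"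
      using w0 by (simp add: abs_mult mult_right_mono Cauchy_Schwarz_ineq2)
    also have "\<dots> = (norm (orbit 0 t x) * w x) * norm (e n t)" by simp
    also have "\<dots> \<le> (decay_const * envelope t) * norm (e n t)" using elim by (intro mult_right_mono) auto
    finally show ?case by simp
  qed
  have env: "square_integrable lborel envelope"
    using envelope_square_integrable by (simp add: square_integrable_def)
  have I: "integrable lborel (\<lambda>t. decay_const * (envelope t * norm (e n t)) * N1 \<rho>)"
    using integrable_L2_norm_mult[OF env e] by (simp add: envelope_nonneg)
  have "integrable (lborel \<Otimes>\<^sub>M M) (case_prod f)"
  proof (rule T.Fubini_integrable[OF f_meas])
    show "AE t in lborel. integrable M (\<lambda>x. case_prod f (t, x))"
      using pairing_integrable[OF \<rho> Linf] by (simp add: f_def)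
    show "integrable lborel (\<lambda>t. LINT x|M. norm (case_prod f (t, x)))"
    proof (rule Bochner_Integration.integrable_bound[OF I])
      show "(\<lambda>t. LINT x|M. norm (case_prod f (t, x))) \<in> borel_measurable lborel"
        using f_meas by measurable
      have "(LINT x|M. \<bar>f t x\<bar>) \<le> decay_const * (envelope t * norm (e n t)) * N1 \<rho>" for t
        unfolding f_def by (rule pairing_integrand_bound(2)[OF \<rho> Linf_measurable[OF Linf] bound])
      then show "AE t in lborel. norm (LINT x|M. norm (case_prod f (t, x))) \<le> norm (decay_const * (envelope t * norm (e n t)) * N1 \<rho>)"
        by (intro AE_I2) (simp add: integral_nonneg abs_of_nonneg order_trans[OF _ abs_ge_self])
    qed
  qed
  from T.Fubini_integral[OF this]
  have "(LINT x|M. (LINT t|lborel. f t x)) = (LINT t|lborel. (LINT x|M. f t x))" .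
  moreover have "(LINT t|lborel. f t x) = \<rho> x * coefficient e n x * (w x)\<^sup>2" for x
    by (simp add: f_def coefficient_def)
  moreover have "(LINT x|M. f t x) = signal \<rho> t \<bullet> e n t" for t
  proof -
    have "(LINT x|M. f t x) = pairing \<Omega> w \<rho> (\<lambda>x. orbit 0 t x \<bullet> e n t)" by (simp add: f_def pairing_def)
    also have "\<dots> = (\<Sum>i\<in>UNIV. e n t $ i * pairing \<Omega> w \<rho> (\<lambda>x. orbit 0 t x $ i))"
      unfolding inner_sum by (intro pairing_sum_right[OF \<rho>] orbit_Linf) auto
    also have "\<dots> = signal \<rho> t \<bullet> e n t"
    proof (cases "0 \<le> t")
      case True
      then show ?thesis by (simp add: pairing_orbit[OF _ \<rho>] signal_def inner_vec_def mult.commute)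
    next
      case False
      then show ?thesis by (simp add: orbit_def orbit_value_def pairing_def signal_def)
    qed
    finally show ?thesis .
  qed
  ultimately show ?thesis by (simp add: pairing_def L2_inner_def)
qed

text \<open>Bessel's inequality for almost every orbit bounds the coefficients, and its defect bounds their
  tails; integration over the domain of finite measure gives the tails of the norms in \<open>H\<close>.
  For the paired signals the defect tends to zero, which is Parseval's identity for squares; the
  bilinear identity follows by polarisation.\<close>

lemma value_form_expansion:
  "\<exists>p :: nat \<Rightarrow> 'a \<Rightarrow> real.
     (\<forall>n. p n \<in> Linf \<Omega> w) \<and>
     (\<forall>\<phi>\<in>L1. \<forall>\<psi>\<in>L1. (\<lambda>n. pairing \<Omega> w \<phi> (p n) * pairing \<Omega> w \<psi> (p n)) sums L2_inner lborel (signal \<phi>) (signal \<psi>)) \<and>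
     summable (\<lambda>n. LINT x|M. (w x * p n x)\<^sup>2) \<and>
     (\<lambda>N. \<Sum>n. LINT x|M. (w x * p (N + n) x)\<^sup>2) \<in> O(\<lambda>N. real N powr (- real m))"
proof -
  obtain e :: "nat \<Rightarrow> real \<Rightarrow> real ^ 'r" and K where K: "0 < K" and e: "\<And>n. square_integrable lborel (e n)"
    and bessel: "\<And>g N. square_integrable lborel g \<Longrightarrow> (\<Sum>n<N. (L2_inner lborel g (e n))\<^sup>2) \<le> L2_inner lborel g g"
    and best: "\<And>g b y N. square_integrable lborel g \<Longrightarrow> K * 4 ^ Suc b \<le> N \<Longrightarrow>
      L2_inner lborel g g - (\<Sum>n<N. (L2_inner lborel g (e n))\<^sup>2)
      \<le> L2_inner lborel (\<lambda>t. g t - pw_poly m b y t) (\<lambda>t. g t - pw_poly m b y t)"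
    by (rule pw_poly_adapted_system[OF m_pos]) (rule that)
  define p where "p = coefficient e"
  define J where "J = decay_const\<^sup>2 * energy"
  define B where "B = error_const\<^sup>2 * energy"
  have J: "0 \<le> J" and B: "0 \<le> B" using energy_nonneg by (simp_all add: J_def B_def)
  have p_meas [measurable]: "p n \<in> borel_measurable M" for n
    unfolding p_def by (rule coefficient_measurable[where e = e, OF e])
  have wp: "w x * p n x = L2_inner lborel (\<lambda>t. w x *\<^sub>R orbit 0 t x) (e n)" for x n
    unfolding p_def by (rule coefficient_eq_inner)
  have total: "AE x in M. \<forall>N. (\<Sum>n<N. (w x * p n x)\<^sup>2) \<le> J"
    using AE_orbit_approximation
  proof eventually_elim
    case (elim x)
    then show ?case unfolding wp J_def using bessel order_trans by blast
  qed
  have tail: "AE x in M. \<forall>b N k. K * 4 ^ Suc b \<le> N \<longrightarrow> (\<Sum>n<k. (w x * p (N + n) x)\<^sup>2) \<le> B * (1 / 4) ^ (b * m)"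
    using AE_orbit_approximation
  proof eventually_elim
    case (elim x)
    let ?g = "\<lambda>t. w x *\<^sub>R orbit 0 t x"
    show ?case
    proof (intro allI impI)
      fix b N k assume N: "K * 4 ^ Suc b \<le> N"
      let ?P = "weighted_taylor b x"
      have "(\<Sum>n<N + k. (L2_inner lborel ?g (e n))\<^sup>2) = (\<Sum>n<N. (L2_inner lborel ?g (e n))\<^sup>2) + (\<Sum>n<k. (L2_inner lborel ?g (e (N + n)))\<^sup>2)"
        by (induction k) (simp_all add: add.assoc)
      moreover have "(\<Sum>n<N + k. (L2_inner lborel ?g (e n))\<^sup>2) \<le> L2_inner lborel ?g ?g"
        using elim by (intro bessel) blast
      moreover have "L2_inner lborel ?g ?g - (\<Sum>n<N. (L2_inner lborel ?g (e n))\<^sup>2)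
          \<le> L2_inner lborel (\<lambda>t. ?g t - ?P t) (\<lambda>t. ?g t - ?P t)"
        using elim by (intro best N) blast
      moreover have "L2_inner lborel (\<lambda>t. ?g t - ?P t) (\<lambda>t. ?g t - ?P t) \<le> B * (1 / 4) ^ (b * m)"
        using elim unfolding B_def by blast
      ultimately show "(\<Sum>n<k. (w x * p (N + n) x)\<^sup>2) \<le> B * (1 / 4) ^ (b * m)"
        unfolding wp by linarith
    qed
  qed
  (* Each single coefficient is bounded by the whole sum, so p n belongs to the dual space. *)
  have single: "AE x in M. \<forall>n. (w x * p n x)\<^sup>2 \<le> J"
    using total
  proof eventually_elim
    case (elim x)
    show ?case
    proof
      fix n
      have "(w x * p n x)\<^sup>2 \<le> (\<Sum>k<Suc n. (w x * p k x)\<^sup>2)" by (simp add: sum_nonneg)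
      also have "\<dots> \<le> J" using elim by blast
      finally show "(w x * p n x)\<^sup>2 \<le> J" .
    qed
  qed
  have p_Linf: "p n \<in> Linf \<Omega> w" for n
  proof -
    have "AE x in M. \<bar>p n x * w x\<bar> \<le> sqrt J"
      using single by eventually_elim (metis mult.commute real_sqrt_abs real_sqrt_le_mono)
    then show ?thesis using p_meas J by (auto simp: Linf_iff intro!: exI[of _ "sqrt J"])
  qed
  have sq_int: "integrable M (\<lambda>x. (w x * p n x)\<^sup>2)" for n
    using single by (intro integrable_const_bound[where B = J]) (auto elim!: eventually_mono)
  define h where "h n = (LINT x|M. (w x * p n x)\<^sup>2)" for n
  have h0: "0 \<le> h n" for n by (simp add: h_def integral_nonneg)
  define V where "V = measure M (space M)"
  have V: "0 \<le> V" by (simp add: V_def)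
  have int_bound: "(\<Sum>n<k. h (N + n)) \<le> C * V"
    if "AE x in M. (\<Sum>n<k. (w x * p (N + n) x)\<^sup>2) \<le> C" for N k C
  proof -
    have "(\<Sum>n<k. h (N + n)) = (LINT x|M. (\<Sum>n<k. (w x * p (N + n) x)\<^sup>2))"
      unfolding h_def using sq_int by simp
    also have "\<dots> \<le> (LINT x|M. C)"
      using sq_int that by (intro integral_mono_AE) auto
    finally show ?thesis by (simp add: V_def mult.commute)
  qed
  have h_summable: "summable h"
  proof (rule summableI_nonneg_bounded[of h "J * V"])
    fix k
    have "AE x in M. (\<Sum>n<k. (w x * p (0 + n) x)\<^sup>2) \<le> J" using total by (auto elim!: eventually_mono)
    from int_bound[OF this] show "(\<Sum>n<k. h n) \<le> J * V" by simp
  qed (rule h0)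
  have h_tail: "(\<Sum>n. h (N + n)) \<le> (B * V) * (1 / 4) ^ (b * m)" if N: "K * 4 ^ Suc b \<le> N" for b N
  proof (rule suminf_le_const)
    show "summable (\<lambda>n. h (N + n))" using h_summable summable_iff_shift[of h N] by (simp add: add.commute)
    fix k
    have "AE x in M. (\<Sum>n<k. (w x * p (N + n) x)\<^sup>2) \<le> B * (1 / 4) ^ (b * m)"
      using tail N by (auto elim!: eventually_mono)
    from int_bound[OF this] show "(\<Sum>n<k. h (N + n)) \<le> (B * V) * (1 / 4) ^ (b * m)" by (simp add: mult_ac)
  qed
  have h_bigo: "(\<lambda>N. \<Sum>n. h (N + n)) \<in> O(\<lambda>N. real N powr (- real m))"
  proof (rule bigo_from_levels[OF K _ h_tail])
    fix N show "0 \<le> (\<Sum>n. h (N + n))"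
      using h_summable summable_iff_shift[of h N] h0 by (intro suminf_nonneg) (simp_all add: add.commute)
  qed
  have parseval: "(\<lambda>n. (L2_inner lborel (signal \<rho>) (e n))\<^sup>2) sums L2_inner lborel (signal \<rho>) (signal \<rho>)" if \<rho>: "\<rho> \<in> L1" for \<rho>
  proof (rule sums_of_vanishing_defect[OF _ _ m_pos])
    show "(\<Sum>n<N. (L2_inner lborel (signal \<rho>) (e n))\<^sup>2) \<le> L2_inner lborel (signal \<rho>) (signal \<rho>)" for N
      by (rule bessel[OF signal_square_integrable[OF \<rho>]])
    fix b N assume N: "K * 4 ^ Suc b \<le> N"
    show "L2_inner lborel (signal \<rho>) (signal \<rho>) - (\<Sum>n<N. (L2_inner lborel (signal \<rho>) (e n))\<^sup>2)
      \<le> ((approx_const * N1 \<rho>)\<^sup>2 * energy) * (1 / 4) ^ (b * m)"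
      using best[OF signal_square_integrable[OF \<rho>] N] signal_approximation[OF \<rho>] by (rule order_trans)
  qed
  have expansion: "(\<lambda>n. pairing \<Omega> w \<phi> (p n) * pairing \<Omega> w \<psi> (p n)) sums L2_inner lborel (signal \<phi>) (signal \<psi>)"
    if \<phi>: "\<phi> \<in> L1" and \<psi>: "\<psi> \<in> L1" for \<phi> \<psi>
  proof -
    note si = signal_square_integrable[OF \<phi>] signal_square_integrable[OF \<psi>]
    (* polarisation: 4 a b = (a + b)^2 - (a - b)^2, for the coefficients and for the integrals *)
    let ?a = "\<lambda>x. 1 * \<phi> x + 1 * \<psi> x" and ?s = "\<lambda>x. 1 * \<phi> x + (-1) * \<psi> x"
    have a: "signal ?a = (\<lambda>t. signal \<phi> t + signal \<psi> t)" and s: "signal ?s = (\<lambda>t. signal \<phi> t - signal \<psi> t)"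
      using signal_lincomb[OF \<phi> \<psi>, of 1 1] signal_lincomb[OF \<phi> \<psi>, of 1 "-1"] by (auto simp: fun_eq_iff)
    have "(\<lambda>n. ((L2_inner lborel (signal ?a) (e n))\<^sup>2 - (L2_inner lborel (signal ?s) (e n))\<^sup>2) / 4) sums
       ((L2_inner lborel (signal ?a) (signal ?a) - L2_inner lborel (signal ?s) (signal ?s)) / 4)"
      by (intro sums_divide sums_diff parseval L1_lincomb(1)[OF \<phi> \<psi>])
    moreover have "((L2_inner lborel (signal ?a) (e n))\<^sup>2 - (L2_inner lborel (signal ?s) (e n))\<^sup>2) / 4
        = pairing \<Omega> w \<phi> (p n) * pairing \<Omega> w \<psi> (p n)" for n
      unfolding a s L2_inner_add_left[OF si e] L2_inner_diff_left[OF si e] p_def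
        pairing_coefficient[where e = e, OF e \<phi>] pairing_coefficient[where e = e, OF e \<psi>]
      by (simp add: power2_eq_square algebra_simps)
    moreover have "(L2_inner lborel (signal ?a) (signal ?a) - L2_inner lborel (signal ?s) (signal ?s)) / 4
        = L2_inner lborel (signal \<phi>) (signal \<psi>)"
    proof -
      have A: "L2_inner lborel (signal ?a) (signal ?a)
          = L2_inner lborel (signal \<phi>) (signal \<phi>) + 2 * L2_inner lborel (signal \<phi>) (signal \<psi>) + L2_inner lborel (signal \<psi>) (signal \<psi>)"
        using integrable_L2_inner[OF si(1) si(1)] integrable_L2_inner[OF si(1) si(2)] integrable_L2_inner[OF si(2) si(2)]
        unfolding a by (simp add: L2_inner_def inner_add_left inner_add_right inner_commute[of "signal \<psi> _" "signal \<phi> _"])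
      have S: "L2_inner lborel (signal ?s) (signal ?s)
          = L2_inner lborel (signal \<phi>) (signal \<phi>) - 2 * L2_inner lborel (signal \<phi>) (signal \<psi>) + L2_inner lborel (signal \<psi>) (signal \<psi>)"
        using integrable_L2_inner[OF si(1) si(1)] integrable_L2_inner[OF si(1) si(2)] integrable_L2_inner[OF si(2) si(2)]
        unfolding s by (simp add: L2_inner_def inner_diff_left inner_diff_right inner_commute[of "signal \<psi> _" "signal \<phi> _"])
      show ?thesis unfolding A S by simp
    qed
    ultimately show ?thesis by simp
  qed
  show ?thesis
    using p_Linf expansion h_summable h_bigo unfolding h_def[abs_def] by (intro exI[of _ p]) auto
qed

lemma observation_S:
  assumes "\<rho> \<in> L1" "0 \<le> t"
  shows "observation \<Omega> w c (S t \<rho>) = observed \<rho> 0 t"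
  using pairing_S[OF assms(2,1) chain_Linf[of 0]] chain_0
  by (simp add: observation_def observed_def)

lemma value_form_eq:
  assumes "\<phi> \<in> L1" "\<psi> \<in> L1"
  shows "set_integrable lborel {0..} (\<lambda>t. observation \<Omega> w c (S t \<phi>) \<bullet> observation \<Omega> w c (S t \<psi>))"
    and "(LINT t:{0..}|lborel. observation \<Omega> w c (S t \<phi>) \<bullet> observation \<Omega> w c (S t \<psi>)) = L2_inner lborel (signal \<phi>) (signal \<psi>)"
proof -
  have eq: "indicator {0..} t *\<^sub>R (observation \<Omega> w c (S t \<phi>) \<bullet> observation \<Omega> w c (S t \<psi>)) = signal \<phi> t \<bullet> signal \<psi> t" for t
    by (cases "0 \<le> t") (simp_all add: signal_def observation_S assms)
  show "set_integrable lborel {0..} (\<lambda>t. observation \<Omega> w c (S t \<phi>) \<bullet> observation \<Omega> w c (S t \<psi>))"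
    unfolding set_integrable_def eq by (intro integrable_L2_inner signal_square_integrable assms)
  show "(LINT t:{0..}|lborel. observation \<Omega> w c (S t \<phi>) \<bullet> observation \<Omega> w c (S t \<psi>)) = L2_inner lborel (signal \<phi>) (signal \<psi>)"
    unfolding set_lebesgue_integral_def eq L2_inner_def ..
qed

lemma H_norm_eq:
  "(Lp_norm 2 \<Omega> (\<lambda>x. (w x)\<^sup>2) p)\<^sup>2 = (LINT x|M. (w x * p x)\<^sup>2)"
proof -
  have "\<bar>p x\<bar> powr 2 * (w x)\<^sup>2 = (w x * p x)\<^sup>2" for x
    by (simp add: powr_numeral power_mult_distrib mult.commute)
  then show ?thesis
    by (simp add: Lp_norm_def powr_half_sqrt integral_nonneg)
qed

end

lemma observation_adjoint_axis:
  fixes c :: "'r::finite \<Rightarrow> 'a \<Rightarrow> real"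
  shows "observation_adjoint c (axis i 1) = c i"
proof
  fix x
  have "observation_adjoint c (axis i 1) x = (\<Sum>j\<in>UNIV. if j = i then c i x else 0)"
    unfolding observation_adjoint_def by (intro sum.cong) (auto simp: axis_def)
  then show "observation_adjoint c (axis i 1) x = c i x" by simp
qed

theorem theorem3p6:
  fixes \<Omega> :: "(real ^ 'd) set"
    and \<nu> f :: "real ^ 'd \<Rightarrow> real ^ 'd"
    and w :: "real ^ 'd \<Rightarrow> real"
    and \<Phi> :: "real \<Rightarrow> real ^ 'd \<Rightarrow> real ^ 'd"
    and S :: "real \<Rightarrow> (real ^ 'd \<Rightarrow> real) \<Rightarrow> real ^ 'd \<Rightarrow> real"
    and c :: "'r::finite \<Rightarrow> real ^ 'd \<Rightarrow> real"
    and \<omega>\<^sub>0 :: real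
    and m :: nat
  assumes domain: "bounded \<Omega>" "open \<Omega>" "connected \<Omega>" "\<Omega> \<noteq> {}"
    and boundary: "C1_boundary \<Omega>"
    and normal: "\<And>x. x \<in> frontier \<Omega> \<Longrightarrow> outer_unit_normal \<Omega> x (\<nu> x)"
    and f_C1: "C1_on UNIV f"
    and inflow: "\<And>x. x \<in> frontier \<Omega> \<Longrightarrow> \<nu> x \<bullet> f x \<le> 0"
    and flow: "flow_on f (closure \<Omega>) \<Phi>"
    and w_measurable: "w \<in> borel_measurable (lebesgue_on \<Omega>)"
    and w_nonneg: "\<And>x. x \<in> \<Omega> \<Longrightarrow> 0 \<le> w x"
    and w_pos: "AE x in lebesgue_on \<Omega>. 0 < w x"
    and w_inverse: "(\<lambda>x. inverse (w x)) \<in> W1inf \<Omega>"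
    and f_components: "\<And>i. (\<lambda>x. f x $ i) \<in> Linf \<Omega> w" "\<And>i. C1_on (closure \<Omega>) (\<lambda>x. f x $ i)"
    and f_weight: "esssup (lebesgue_on \<Omega>)
                     (\<lambda>x. ereal (- (f x \<bullet> weight_gradient \<Omega> w x) / w x)) < \<infinity>"
    and preadjoint: "preadjoint_semigroup \<Omega> w \<Phi> S"
    and c_mem: "\<And>i. c i \<in> Linf \<Omega> w"
    and C_rank: "dim (observation \<Omega> w c ` Lp 1 \<Omega> w) = CARD('r)"
    and stable: "exponentially_stable \<Omega> w S \<omega>\<^sub>0"
    and m: "0 < m" "even m"
    and C_range: "range (observation_adjoint c) \<subseteq> generator_power_domain \<Omega> w \<Phi> m"
  shows "\<exists>p :: nat \<Rightarrow> real ^ 'd \<Rightarrow> real.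
     (\<forall>n. p n \<in> Linf \<Omega> w) \<and>
     (\<forall>\<phi>\<in>Lp 1 \<Omega> w. \<forall>\<psi>\<in>Lp 1 \<Omega> w.
        set_integrable lborel {0..}
          (\<lambda>t. observation \<Omega> w c (S t \<phi>) \<bullet> observation \<Omega> w c (S t \<psi>)) \<and>
        (\<lambda>n. pairing \<Omega> w \<phi> (p n) * pairing \<Omega> w \<psi> (p n)) sums
          (LINT t:{0..}|lborel. observation \<Omega> w c (S t \<phi>) \<bullet> observation \<Omega> w c (S t \<psi>))) \<and>
     summable (\<lambda>n. (Lp_norm 2 \<Omega> (\<lambda>x. (w x)\<^sup>2) (p n))\<^sup>2) \<and>
     (\<lambda>N. \<Sum>n. (Lp_norm 2 \<Omega> (\<lambda>x. (w x)\<^sup>2) (p (N + n)))\<^sup>2) \<in> O(\<lambda>N. real N powr (- real m))"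
proof -
  have "\<forall>i. \<exists>\<psi>. \<psi> 0 = c i \<and> (\<forall>q<m. weak_star_generator \<Omega> w \<Phi> (\<psi> q) (\<psi> (Suc q)))"
  proof
    fix i
    have "c i \<in> generator_power_domain \<Omega> w \<Phi> m"
      using C_range observation_adjoint_axis[of c i] by (metis range_subsetD)
    then show "\<exists>\<psi>. \<psi> 0 = c i \<and> (\<forall>q<m. weak_star_generator \<Omega> w \<Phi> (\<psi> q) (\<psi> (Suc q)))"
      by (auto simp: generator_power_domain_def relpowp_fun_conv)
  qed
  from choice[OF this] obtain \<Psi> where "\<forall>i. \<Psi> i 0 = c i \<and>
      (\<forall>q<m. weak_star_generator \<Omega> w \<Phi> (\<Psi> i q) (\<Psi> i (Suc q)))" ..
  then have \<Psi>: "\<And>i. \<Psi> i 0 = c i"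
    "\<And>i q. q < m \<Longrightarrow> weak_star_generator \<Omega> w \<Phi> (\<Psi> i q) (\<Psi> i (Suc q))" by blast+
  have cl: "x \<in> closure \<Omega>" if "x \<in> \<Omega>" for x using that closure_subset by blast
  interpret observed_semigroup \<Omega> w \<Phi> S \<omega>\<^sub>0 c \<Psi> m
  proof
    show "continuous_on ({0..} \<times> \<Omega>) (\<lambda>(t, x). \<Phi> t x)"
      by (rule continuous_on_subset[OF flow_on_jointly_continuous[OF f_C1 flow]]) (use cl in auto)
    show "\<And>s t x. 0 \<le> s \<Longrightarrow> 0 \<le> t \<Longrightarrow> x \<in> \<Omega> \<Longrightarrow> \<Phi> t x \<in> \<Omega> \<Longrightarrow> \<Phi> s (\<Phi> t x) = \<Phi> (t + s) x"
      by (rule flow_on_semigroup[OF f_C1 flow cl _ cl])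
  qed (fact domain w_measurable w_nonneg w_pos preadjoint stable m \<Psi>)+
  show ?thesis
    using value_form_expansion by (simp add: value_form_eq H_norm_eq)
qed

end
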